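(* Let $n\ge 2$. If $\phi\in L^\infty(\mathbb T^n)$, then $\|H_\phi\|=\mathrm{dist}_\infty(\phi,H_1)$.
   Context: $\mathbb T$ is the unit circle. $H_1$ is the closed subspace of $L^\infty(\mathbb T^n)$ consisting of those $f$ whose Fourier series has the form $\sum_{m_1+\cdots+m_n\ge0}a_{m_1,\dots,m_n}z_1^{m_1}\cdots z_n^{m_n}$ (i.e. Fourier coefficients with $m_1+\cdots+m_n<0$ vanish), and $\mathrm{dist}_\infty(\phi,H_1)=\inf_{g\in H_1}\|\phi-g\|_{\mathbb T^n,\infty}$. For $\phi\in L^\infty(\mathbb T^n)$ with Fourier coefficients $a_{m_1,\dots,m_n}$ and $k\in\mathbb Z$ put $\phi_k(\lambda_1,\dots,\lambda_{n-1})=\sum_{m_1+\cdots+m_n=k}a_{m_1,\dots,m_n}\lambda_1^{m_2}\cdots\lambda_{n-1}^{m_n}$ (a function in $L^\infty(\mathbb T^{n-1})$), so that $\phi(z,\lambda_1z,\dots,\lambda_{n-1}z)=\sum_{k\in\mathbb Z}\phi_k(\lambda_1,\dots,\lambda_{n-1})z^k$. $M_{\phi_k}$ is multiplication by $\phi_k$ on $L^2(\mathbb T^{n-1})$. The Hankel operator $H_\phi$ is the operator on $L^2(\mathbb T^{n-1})\otimes\ell^2(\mathbb N_0)$ given by the block matrix \[H_\phi=\begin{pmatrix}M_{\phi_{-1}}&M_{\phi_{-2}}&M_{\phi_{-3}}&\cdots\\ M_{\phi_{-2}}&M_{\phi_{-3}}&M_{\phi_{-4}}&\cdots\\ M_{\phi_{-3}}&M_{\phi_{-4}}&M_{\phi_{-5}}&\cdots\\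 \vdots&\vdots&\vdots&\end{pmatrix}.\] *)

theory Defs
  imports "HOL-Probability.Probability"
begin

text \<open>
  Points of the torus of dimension \<open>d\<close> are functions with coordinates \<open>1, \<dots>, d\<close>;
  multi-indices are functions \<open>nat \<Rightarrow> int\<close> of which only the values on \<open>{1..d}\<close> matter.
  Elements of Lebesgue spaces are represented by measurable functions, and all norms are
  \<open>ennreal\<close>-valued, so that a supremum or infimum of norms always has its true meaning.
\<close>

definition circle_measure :: "complex measure" where
  "circle_measure =
     distr (uniform_measure lborel {0..2 * pi}) (restrict_space borel (sphere 0 1)) cis"

definition torus :: "nat \<Rightarrow> (nat \<Rightarrow> complex) measure" where
  "torus d = PiM {1..d} (\<lambda>_. circle_measure)"

definition Linf_norm :: "nat \<Rightarrow> ((nat \<Rightarrow> complex) \<Rightarrow> complex) \<Rightarrow> ennreal" where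
  "Linf_norm d f = esssup (torus d) (\<lambda>z. ennreal (norm (f z)))"

definition Linf :: "nat \<Rightarrow> ((nat \<Rightarrow> complex) \<Rightarrow> complex) set" where
  "Linf d = {f \<in> borel_measurable (torus d). Linf_norm d f < \<infinity>}"

definition fourier_coeff ::
    "nat \<Rightarrow> ((nat \<Rightarrow> complex) \<Rightarrow> complex) \<Rightarrow> (nat \<Rightarrow> int) \<Rightarrow> complex" where
  "fourier_coeff d f m = (LINT z|torus d. f z * (\<Prod>i\<in>{1..d}. z i powi (- m i)))"

definition H1 :: "nat \<Rightarrow> ((nat \<Rightarrow> complex) \<Rightarrow> complex) set" where
  "H1 n = {f \<in> Linf n. \<forall>m. (\<Sum>i\<in>{1..n}. m i) < 0 \<longrightarrow> fourier_coeff n f m = 0}"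

definition dist_inf ::
    "nat \<Rightarrow> ((nat \<Rightarrow> complex) \<Rightarrow> complex) \<Rightarrow> ((nat \<Rightarrow> complex) \<Rightarrow> complex) set \<Rightarrow> ennreal" where
  "dist_inf n \<phi> S = (INF g\<in>S. Linf_norm n (\<lambda>z. \<phi> z - g z))"

text \<open>
  The function \<open>\<phi>\<^sub>k\<close> is the element of \<open>L\<^sup>\<infinity>\<close> of the \<open>(n - 1)\<close>-torus with Fourier series
  \<open>\<Sum> a(m\<^sub>1, \<dots>, m\<^sub>n) \<lambda>\<^sub>1^m\<^sub>2 \<dots> \<lambda>\<^sub>n\<^sub>-\<^sub>1^m\<^sub>n\<close> over \<open>m\<^sub>1 + \<dots> + m\<^sub>n = k\<close>, where the \<open>a\<close> are the
  Fourier coefficients of \<open>\<phi>\<close>. The exponent \<open>p = (m\<^sub>2, \<dots>, m\<^sub>n)\<close> determines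
  \<open>m\<^sub>1 = k - (p\<^sub>1 + \<dots> + p\<^sub>n\<^sub>-\<^sub>1)\<close>. The choice below is unique up to null sets.
\<close>

definition slice_index :: "nat \<Rightarrow> int \<Rightarrow> (nat \<Rightarrow> int) \<Rightarrow> nat \<Rightarrow> int" where
  "slice_index n k p = (\<lambda>i. if i = 1 then k - (\<Sum>j\<in>{1..n - 1}. p j) else p (i - 1))"

definition slice ::
    "nat \<Rightarrow> ((nat \<Rightarrow> complex) \<Rightarrow> complex) \<Rightarrow> int \<Rightarrow> (nat \<Rightarrow> complex) \<Rightarrow> complex" where
  "slice n \<phi> k = (SOME \<psi>. \<psi> \<in> Linf (n - 1) \<and>
     (\<forall>p. fourier_coeff (n - 1) \<psi> p = fourier_coeff n \<phi> (slice_index n k p)))"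

text \<open>
  The Hilbert space tensor product of \<open>L\<^sup>2\<close> of the \<open>d\<close>-torus with \<open>\<ell>\<^sup>2\<close> is the space of
  square-summable sequences (block column vectors) in \<open>L\<^sup>2\<close>.
\<close>

definition seq_norm2 :: "nat \<Rightarrow> (nat \<Rightarrow> (nat \<Rightarrow> complex) \<Rightarrow> complex) \<Rightarrow> ennreal" where
  "seq_norm2 d F = (\<Sum>j. \<integral>\<^sup>+x. ennreal ((norm (F j x))\<^sup>2) \<partial>torus d)"

definition seq_norm :: "nat \<Rightarrow> (nat \<Rightarrow> (nat \<Rightarrow> complex) \<Rightarrow> complex) \<Rightarrow> ennreal" where
  "seq_norm d F =
     (if seq_norm2 d F = \<infinity> then \<infinity> else ennreal (sqrt (enn2real (seq_norm2 d F))))"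

definition L2_tensor_l2 :: "nat \<Rightarrow> (nat \<Rightarrow> (nat \<Rightarrow> complex) \<Rightarrow> complex) set" where
  "L2_tensor_l2 d = {F. (\<forall>j. F j \<in> borel_measurable (torus d)) \<and> seq_norm d F < \<infinity>}"

definition op_norm ::
    "nat \<Rightarrow> ((nat \<Rightarrow> (nat \<Rightarrow> complex) \<Rightarrow> complex) \<Rightarrow> nat \<Rightarrow> (nat \<Rightarrow> complex) \<Rightarrow> complex) \<Rightarrow> ennreal"
  where
  "op_norm d T = (SUP F\<in>{F \<in> L2_tensor_l2 d. seq_norm d F \<le> 1}. seq_norm d (T F))"

definition mult_op ::
    "((nat \<Rightarrow> complex) \<Rightarrow> complex) \<Rightarrow> ((nat \<Rightarrow> complex) \<Rightarrow> complex) \<Rightarrow> (nat \<Rightarrow> complex) \<Rightarrow> complex" where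
  "mult_op \<psi> f = (\<lambda>x. \<psi> x * f x)"

text \<open>
  Rows and columns are numbered from 0, so the \<open>(i, j)\<close> block is multiplication by
  \<open>\<phi>\<^sub>k\<close> with \<open>k = -(i + j + 1)\<close>. The row sums are formed pointwise: for almost every \<open>x\<close> the
  sequence of all \<open>\<phi>\<^sub>k(x)\<close> has \<open>\<ell>\<^sup>2\<close> norm at most the \<open>L\<^sup>\<infinity>\<close> norm of \<open>\<phi>\<close>, so by Cauchy-Schwarz
  the series converges absolutely at \<open>x\<close>, with partial sums dominated by a fixed \<open>L\<^sup>2\<close>
  function; thus the pointwise sum is also the sum in \<open>L\<^sup>2\<close>.
\<close>

definition hankel_op ::
    "nat \<Rightarrow> ((nat \<Rightarrow> complex) \<Rightarrow> complex) \<Rightarrow>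
     (nat \<Rightarrow> (nat \<Rightarrow> complex) \<Rightarrow> complex) \<Rightarrow> nat \<Rightarrow> (nat \<Rightarrow> complex) \<Rightarrow> complex" where
  "hankel_op n \<phi> F =
     (\<lambda>i x. \<Sum>j. mult_op (slice n \<phi> (- (int i + int j + 1))) (F j) x)"

end

theory Submission
  imports Defs
begin

text \<open>
  In the coordinates \<open>(z, \<lambda>z)\<close> the Hankel operator acts, for almost every \<open>\<lambda>\<close>, as the scalar Hankel matrix of
  \<open>z \<mapsto> \<phi>(z, \<lambda>z)\<close>. Bessel's inequality on the circle bounds its norm by the sup norm of any \<open>\<phi> - g\<close> with
  \<open>g \<in> H\<^sub>1\<close>.

  For the converse let \<open>M\<close> dominate the operator norm. A trigonometric polynomial \<open>h\<close> with frequencies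
  \<open>m\<^sub>1 + \<dots> + m\<^sub>n \<ge> 1\<close> is, up to a small uniform error, a product \<open>f g\<close> of such polynomials (with frequencies
  \<open>\<ge> 1\<close> and \<open>\<ge> 0\<close>) with \<open>\<bar>f\<bar>\<^sup>2, \<bar>g\<bar>\<^sup>2 \<le> \<bar>h\<bar> + \<epsilon>\<close>, so
  \<open>\<bar>\<integral> \<phi> h\<bar> = \<bar>\<langle>H f, cnj g\<rangle>\<bar> \<le> M \<integral> \<bar>h\<bar>\<close>. In place of the Hahn-Banach theorem and weak-star compactness, this
  bound is used as follows: finitely many negative coefficients of \<open>\<phi>\<close> can be matched with arbitrarily small error by
  functions bounded by \<open>M\<close>; the sets of such functions are convex and decrease as more coefficients are matched, so
  almost minimisers of the \<open>L\<^sup>2\<close> norm converge, by the parallelogram law, to some \<open>c\<close> with \<open>\<bar>c\<bar> \<le> M\<close> and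
  \<open>\<phi> - c \<in> H\<^sub>1\<close>.
\<close>

section \<open>The circle, the torus and the twisted product\<close>

text \<open>\<open>slice\<close> is only a choice among functions with prescribed Fourier
  coefficients, so nothing can be computed from it until Fourier coefficients on the torus are known
  to determine a function; then it is replaced almost everywhere by a one-variable Fourier
  coefficient along the circle z -> (z, x_1 z, ..., x_d z). This change of variables turns the total
  degree m_1 + ... + m_n into the exponent of z, so the half space of frequencies becomes the
  ordinary half line on every fibre. The factorization is an approximate form of h = f g with |f|^2
  = |g|^2 = |h|. Exact factors are in general no polynomials, and a fibrewise choice of outer
  factors would raise measurability questions; with polynomial factors both vectors in the pairing
  have finitely many blocks with bounded entries, and no convergence has to be discussed. The
  analytic logarithm that it needs comes without conjugate functions: conjugation inverts
  characters, so the real part of any trigonometric polynomial is also the real part of one with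
  frequencies of total degree at least 0.\<close>

lemma space_circle [simp]: "space circle_measure = sphere 0 1"
  by (simp add: circle_measure_def space_restrict_space)

lemma sets_circle: "sets circle_measure = sets (restrict_space borel (sphere 0 1))"
  by (simp add: circle_measure_def)

lemma measurable_circle_iff:
  "f \<in> measurable N circle_measure \<longleftrightarrow> f \<in> borel_measurable N \<and> f \<in> space N \<rightarrow> sphere 0 1"
proof -
  have "measurable N circle_measure = measurable N (restrict_space borel (sphere 0 1))"
    by (rule measurable_cong_sets) (simp_all add: sets_circle)
  then show ?thesis
    by (auto simp: measurable_restrict_space2_iff)
qed

lemma sets_circle_iff: "A \<in> sets circle_measure \<longleftrightarrow> A \<in> sets borel \<and> A \<subseteq> sphere 0 1"
  unfolding sets_circle by (subst sets_restrict_space_iff) auto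

lemma measurable_cis [measurable]: "cis \<in> measurable borel (restrict_space borel (sphere 0 1))"
  by (rule measurable_restrict_space2) (auto intro!: borel_measurable_continuous_onI continuous_intros)

lemma emeasure_circle:
  assumes "A \<in> sets circle_measure"
  shows "emeasure circle_measure A = emeasure lborel ({0..2*pi} \<inter> cis -` A) / ennreal (2*pi)"
proof -
  have A: "A \<in> sets (restrict_space borel (sphere 0 1))" using assms by (simp add: sets_circle)
  have B: "cis -` A \<in> sets borel" using measurable_sets[OF measurable_cis A] by simp
  show ?thesis
    unfolding circle_measure_def using A B
    by (subst emeasure_distr) (auto simp: measurable_cis)
qed

lemma prob_space_circle: "prob_space circle_measure"
  unfolding circle_measure_def
  by (rule prob_space.prob_space_distr) (auto intro!: prob_space_uniform_measure simp: measurable_cis)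

text \<open>The shifted window sticks out of one period by a piece of length \<theta>; periodicity
  moves this piece back to the start, where it fills exactly the gap.\<close>

lemma emeasure_periodic_shift:
  fixes B :: "real set"
  assumes B: "B \<in> sets borel" and per: "\<And>t. t + 2*pi \<in> B \<longleftrightarrow> t \<in> B"
    and th: "0 \<le> \<theta>" "\<theta> < 2*pi"
  shows "emeasure lborel ({0..2*pi} \<inter> {t. t + \<theta> \<in> B}) = emeasure lborel ({0..2*pi} \<inter> B)"
proof -
  have shift: "emeasure lborel {t. t + c \<in> X} = emeasure lborel X" if "X \<in> sets borel" for X and c :: real
  proof -
    have "emeasure lborel X = emeasure (distr lborel borel ((+) c)) X"
      by (simp add: lborel_distr_plus)
    also have "\<dots> = emeasure lborel {t. t + c \<in> X}"
      using that by (subst emeasure_distr) (auto simp: vimage_def add.commute)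
    finally show ?thesis by simp
  qed
  \<comment> \<open>Both end points of \<open>{0..2*pi}\<close> stand for the same point of the
    circle; dropping one of them makes the pieces below disjoint.\<close>
  have drop: "emeasure lborel ({0..2*pi} \<inter> X) = emeasure lborel ({0..<2*pi} \<inter> X)"
    if "X \<in> sets borel" for X
    using that by (intro emeasure_eq_AE) (use AE_lborel_singleton[of "2*pi"] in auto)
  have B2: "{t. t + \<theta> \<in> B} \<in> sets borel"
  proof -
    have "(\<lambda>t. t + \<theta>) -` B \<inter> space borel \<in> sets borel" by (rule measurable_sets[OF _ B]) simp
    then show ?thesis by (simp add: vimage_def)
  qed
  have 1: "emeasure lborel ({0..<2*pi} \<inter> {t. t + \<theta> \<in> B}) = emeasure lborel ({\<theta>..<2*pi+\<theta>} \<inter> B)"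
  proof -
    have "{0..<2*pi} \<inter> {t. t + \<theta> \<in> B} = {t. t + \<theta> \<in> {\<theta>..<2*pi+\<theta>} \<inter> B}" by auto
    then show ?thesis using shift[of "{\<theta>..<2*pi+\<theta>} \<inter> B" \<theta>] B by simp
  qed
  have 2: "{\<theta>..<2*pi+\<theta>} \<inter> B = ({\<theta>..<2*pi} \<inter> B) \<union> ({2*pi..<2*pi+\<theta>} \<inter> B)" using th by auto
  have 3: "emeasure lborel ({2*pi..<2*pi+\<theta>} \<inter> B) = emeasure lborel ({0..<\<theta>} \<inter> B)"
  proof -
    have "{0..<\<theta>} \<inter> B = {t. t + 2*pi \<in> {2*pi..<2*pi+\<theta>} \<inter> B}" by (auto simp: per)
    then show ?thesis using shift[of "{2*pi..<2*pi+\<theta>} \<inter> B" "2*pi"] B by simp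
  qed
  have "emeasure lborel ({\<theta>..<2*pi+\<theta>} \<inter> B)
      = emeasure lborel ({\<theta>..<2*pi} \<inter> B) + emeasure lborel ({2*pi..<2*pi+\<theta>} \<inter> B)"
    unfolding 2 using B by (intro plus_emeasure[symmetric]) auto
  also have "\<dots> = emeasure lborel (({\<theta>..<2*pi} \<inter> B) \<union> ({0..<\<theta>} \<inter> B))"
    unfolding 3 using B by (intro plus_emeasure) auto
  also have "({\<theta>..<2*pi} \<inter> B) \<union> ({0..<\<theta>} \<inter> B) = {0..<2*pi} \<inter> B" using th by auto
  finally show ?thesis using drop[OF B] drop[OF B2] 1 by simp
qed

lemma borel_measurable_circle: "(\<lambda>z. z) \<in> borel_measurable circle_measure"
  using measurable_circle_iff[of "\<lambda>z. z" circle_measure] by simp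

lemma borel_measurable_power_int [measurable]:
  fixes f :: "'a \<Rightarrow> complex"
  shows "f \<in> borel_measurable M \<Longrightarrow> (\<lambda>x. f x powi k) \<in> borel_measurable M"
  by (cases "k \<ge> 0") (simp_all add: power_int_def)

lemma measurable_rotation:
  assumes "w \<in> sphere (0::complex) 1"
  shows "(\<lambda>z. z * w) \<in> measurable circle_measure circle_measure"
  using assms by (auto simp: measurable_circle_iff norm_mult intro!: borel_measurable_times borel_measurable_circle)

lemma distr_rotation:
  assumes w: "w \<in> sphere (0::complex) 1"
  shows "distr circle_measure circle_measure (\<lambda>z. z * w) = circle_measure"
proof (rule measure_eqI)
  fix A assume "A \<in> sets (distr circle_measure circle_measure (\<lambda>z. z * w))"
  then have A: "A \<in> sets circle_measure" by simp
  obtain \<theta> where th: "0 \<le> \<theta>" "\<theta> < 2*pi" "w = cis \<theta>"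
    using w complex_unimodular_polar[of w] by (auto simp: complex_eq_iff)
  let ?A = "(\<lambda>z. z * w) -` A \<inter> sphere 0 1"
  have A': "?A \<in> sets circle_measure"
    using measurable_sets[OF measurable_rotation[OF w] A] by simp
  have B: "cis -` A \<in> sets borel"
    using measurable_sets[OF measurable_cis, of A] A by (simp add: sets_circle)
  have "cis -` ?A = {t. t + \<theta> \<in> cis -` A}" by (auto simp: th cis_mult)
  moreover have "emeasure lborel ({0..2*pi} \<inter> {t. t + \<theta> \<in> cis -` A}) = emeasure lborel ({0..2*pi} \<inter> cis -` A)"
    by (rule emeasure_periodic_shift) (use B th in \<open>auto simp flip: cis_mult\<close>)
  ultimately show "emeasure (distr circle_measure circle_measure (\<lambda>z. z * w)) A = emeasure circle_measure A"
    using A A' by (simp add: emeasure_distr measurable_rotation[OF w] emeasure_circle)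
qed simp

lemma integral_circle_powi: "(LINT z|circle_measure. z powi k) = (if k = 0 then 1 else 0)"
proof (cases "k = 0")
  case True
  interpret prob_space circle_measure by (rule prob_space_circle)
  show ?thesis using True prob_space by simp
next
  case False
  \<comment> \<open>A k-th root of -1: rotating by it changes the sign of the integrand, so by
    rotation invariance the integral is its own negative.\<close>
  define w where "w = cis (pi / real_of_int k)"
  have w: "w \<in> sphere 0 1" by (simp add: w_def)
  have wk: "w powi k = -1"
    using False by (simp add: w_def cis_power_int)
  have "(LINT z|circle_measure. z powi k)
      = (LINT z|distr circle_measure circle_measure (\<lambda>z. z * w). z powi k)"
    by (simp add: distr_rotation[OF w])
  also have "\<dots> = (LINT z|circle_measure. (z * w) powi k)"
    by (rule integral_distr[OF measurable_rotation[OF w]]) (simp add: borel_measurable_circle borel_measurable_power_int)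
  also have "\<dots> = - (LINT z|circle_measure. z powi k)"
    by (simp add: power_int_mult_distrib wk)
  finally show ?thesis using False by (simp add: eq_neg_iff_add_eq_0 flip: mult_2)
qed

section \<open>The torus and its twisted coordinates\<close>

lemma space_torus: "space (torus d) = {1..d} \<rightarrow>\<^sub>E sphere 0 1"
  by (simp add: torus_def space_PiM)

lemma prob_space_torus: "prob_space (torus d)"
  unfolding torus_def by (intro prob_space_PiM prob_space_circle)

lemma norm_torus: "x \<in> space (torus d) \<Longrightarrow> i \<in> {1..d} \<Longrightarrow> norm (x i) = 1"
  by (auto simp: space_torus PiE_iff)

lemma measurable_torus_component: "i \<in> {1..d} \<Longrightarrow> (\<lambda>x. x i) \<in> borel_measurable (torus d)"
proof -
  assume "i \<in> {1..d}"
  then have "(\<lambda>x. x i) \<in> measurable (torus d) circle_measure"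
    unfolding torus_def by (rule measurable_component_singleton)
  then show ?thesis by (simp add: measurable_circle_iff)
qed

text \<open>The substitution (z, x_1 z, ..., x_d z) from the definition of the slices. Restriction
  to \<open>{1..Suc d}\<close> makes the result extensional, as points of the product space have to
  be.\<close>

definition twist :: "nat \<Rightarrow> complex \<times> (nat \<Rightarrow> complex) \<Rightarrow> nat \<Rightarrow> complex" where
  "twist d = (\<lambda>(z, x). \<lambda>i\<in>{1..Suc d}. if i = 1 then z else x (i - 1) * z)"

lemma measurable_circle_fst: "fst \<in> borel_measurable (circle_measure \<Otimes>\<^sub>M torus d)"
  using measurable_fst[of circle_measure "torus d"] by (simp add: measurable_circle_iff)

lemma measurable_twist: "twist d \<in> measurable (circle_measure \<Otimes>\<^sub>M torus d) (torus (Suc d))"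
  unfolding torus_def[of "Suc d"]  twist_def case_prod_unfold
proof (rule measurable_restrict)
  fix i assume i: "i \<in> {1..Suc d}"
  show "(\<lambda>p. if i = 1 then fst p else snd p (i - 1) * fst p) \<in> measurable (circle_measure \<Otimes>\<^sub>M torus d) circle_measure"
  proof (cases "i = 1")
    case True
    then show ?thesis by simp
  next
    case False
    then have i': "i - 1 \<in> {1..d}" using i by auto
    have "(\<lambda>p. snd p (i - 1)) \<in> borel_measurable (circle_measure \<Otimes>\<^sub>M torus d)"
      by (rule measurable_compose[OF measurable_snd measurable_torus_component[OF i']])
    from borel_measurable_times[OF this measurable_circle_fst]
    have "(\<lambda>p. snd p (i - 1) * fst p) \<in> borel_measurable (circle_measure \<Otimes>\<^sub>M torus d)" .
    then show ?thesis using False i' norm_torus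
      by (auto simp: measurable_circle_iff space_pair_measure norm_mult)
  qed
qed

lemma prod_split_first:
  fixes g :: "nat \<Rightarrow> 'a::comm_monoid_mult"
  shows "(\<Prod>i\<in>{1..Suc d}. g i) = (\<Prod>i\<in>{1..d}. g (Suc i)) * g 1"
  by (induction d) (simp_all add: mult_ac)

text \<open>For fixed z the map rotates each remaining coordinate by z, and rotations preserve the
  circle measure. So z must be the outer variable: the section of a rectangle at z is then a
  rectangle with rotated sides, or empty.\<close>

lemma distr_twist: "distr (circle_measure \<Otimes>\<^sub>M torus d) (torus (Suc d)) (twist d) = torus (Suc d)"
proof -
  interpret C: prob_space circle_measure by (rule prob_space_circle)
  interpret T: prob_space "torus d" by (rule prob_space_torus)
  interpret P: product_prob_space "\<lambda>_::nat. circle_measure" ..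
  show ?thesis
    unfolding torus_def[of "Suc d"]
  proof (rule P.PiM_eqI)
    fix A :: "nat \<Rightarrow> complex set" assume A: "\<And>i. i \<in> {1..Suc d} \<Longrightarrow> A i \<in> sets circle_measure"
    let ?X = "twist d -` PiE {1..Suc d} A \<inter> space (circle_measure \<Otimes>\<^sub>M torus d)"
    have PA: "PiE {1..Suc d} A \<in> sets (torus (Suc d))"
      unfolding torus_def by (rule sets_PiM_I_finite) (use A in auto)
    have X: "?X \<in> sets (circle_measure \<Otimes>\<^sub>M torus d)"
      by (rule measurable_sets[OF measurable_twist PA])
    have A1: "A 1 \<in> sets circle_measure" using A by simp
    let ?R = "\<lambda>z i. (\<lambda>y. y * z) -` A (Suc i) \<inter> sphere 0 1"
    have R: "?R z i \<in> sets circle_measure" if "z \<in> sphere 0 1" "i \<in> {1..d}" for z i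
      using measurable_sets[OF measurable_rotation[OF that(1)], of "A (Suc i)"] A that by simp
    have eR: "emeasure circle_measure (?R z i) = emeasure circle_measure (A (Suc i))"
      if "z \<in> sphere 0 1" "i \<in> {1..d}" for z i
    proof -
      have "emeasure circle_measure (A (Suc i)) = emeasure (distr circle_measure circle_measure (\<lambda>y. y * z)) (A (Suc i))"
        by (simp add: distr_rotation[OF that(1)])
      also have "\<dots> = emeasure circle_measure (?R z i)"
        using A that by (subst emeasure_distr[OF measurable_rotation[OF that(1)]]) auto
      finally show ?thesis by simp
    qed
    have sl: "Pair z -` ?X = (if z \<in> A 1 then PiE {1..d} (?R z) else {})" if z: "z \<in> sphere 0 1" for z
    proof -
      have "twist d (z, x) \<in> PiE {1..Suc d} A \<longleftrightarrow> z \<in> A 1 \<and> (\<forall>i\<in>{1..d}. x i * z \<in> A (Suc i))" for x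
      proof -
        have "(\<forall>i\<in>{1..Suc d}. (if i = 1 then z else x (i - 1) * z) \<in> A i)
          \<longleftrightarrow> z \<in> A 1 \<and> (\<forall>i\<in>{1..d}. x i * z \<in> A (Suc i))" (is "?l \<longleftrightarrow> ?r")
        proof
          assume ?l
          then have "\<forall>i\<in>{1..d}. x i * z \<in> A (Suc i)" by (auto dest!: bspec[of _ _ "Suc _"])
          with \<open>?l\<close> show ?r by force
        next
          assume r: ?r
          show ?l
          proof
            fix i assume "i \<in> {1..Suc d}"
            then have "i - 1 \<in> {1..d}" "Suc (i - 1) = i" if "i \<noteq> 1" using that by auto
            with r show "(if i = 1 then z else x (i - 1) * z) \<in> A i" by metis
          qed
        qed
        then show ?thesis by (auto simp: twist_def PiE_iff)
      qed
      then have "Pair z -` ?X = {x \<in> space (torus d). z \<in> A 1 \<and> (\<forall>i\<in>{1..d}. x i * z \<in> A (Suc i))}"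
        using z by (auto simp: space_pair_measure simp del: PiE_iff)
      then show ?thesis by (auto simp: space_torus PiE_iff extensional_def)
    qed
    have "emeasure (distr (circle_measure \<Otimes>\<^sub>M torus d) (torus (Suc d)) (twist d)) (PiE {1..Suc d} A)
        = emeasure (circle_measure \<Otimes>\<^sub>M torus d) ?X"
      by (rule emeasure_distr[OF measurable_twist PA])
    also have "\<dots> = (\<integral>\<^sup>+z. emeasure (torus d) (Pair z -` ?X) \<partial>circle_measure)"
      by (rule T.emeasure_pair_measure_alt[OF X])
    also have "\<dots> = (\<integral>\<^sup>+z. (\<Prod>i\<in>{1..d}. emeasure circle_measure (A (Suc i))) * indicator (A 1) z \<partial>circle_measure)"
    proof (rule nn_integral_cong)
      fix z assume "z \<in> space circle_measure"
      then have z: "z \<in> sphere 0 1" by simp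
      have "emeasure (torus d) (PiE {1..d} (?R z)) = (\<Prod>i\<in>{1..d}. emeasure circle_measure (?R z i))"
        unfolding torus_def by (rule P.emeasure_PiM) (use R[OF z] in auto)
      also have "\<dots> = (\<Prod>i\<in>{1..d}. emeasure circle_measure (A (Suc i)))"
        by (rule prod.cong) (use eR[OF z] in auto)
      finally show "emeasure (torus d) (Pair z -` ?X) = (\<Prod>i\<in>{1..d}. emeasure circle_measure (A (Suc i))) * indicator (A 1) z"
        by (simp only: sl[OF z]) (simp add: indicator_def)
    qed
    also have "\<dots> = (\<Prod>i\<in>{1..d}. emeasure circle_measure (A (Suc i))) * emeasure circle_measure (A 1)"
      using A1 by (rule nn_integral_cmult_indicator)
    also have "\<dots> = (\<Prod>i\<in>{1..Suc d}. emeasure circle_measure (A i))"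
      by (rule prod_split_first[symmetric])
    finally show "emeasure (distr (circle_measure \<Otimes>\<^sub>M torus d) (Pi\<^sub>M {1..Suc d} (\<lambda>_. circle_measure)) (twist d)) (PiE {1..Suc d} A)
        = (\<Prod>i\<in>{1..Suc d}. emeasure circle_measure (A i))" by (simp add: torus_def)
  qed (auto simp: torus_def)
qed


lemma integrable_bounded_prob:
  fixes f :: "'a \<Rightarrow> complex"
  assumes "prob_space M" "f \<in> borel_measurable M" "\<And>x. x \<in> space M \<Longrightarrow> norm (f x) \<le> B"
  shows "integrable M f"
proof -
  interpret prob_space M by fact
  show ?thesis using assms(2,3) by (intro integrable_const_bound[of _ B]) auto
qed

lemma norm_integral_le_prob:
  fixes f :: "'a \<Rightarrow> complex"
  assumes "prob_space M" "\<And>x. x \<in> space M \<Longrightarrow> norm (f x) \<le> B" "B \<ge> 0"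
  shows "norm (integral\<^sup>L M f) \<le> B"
proof (cases "integrable M f")
  case True
  interpret prob_space M by fact
  have "norm (integral\<^sup>L M f) \<le> (LINT x|M. norm (f x))" by simp
  also have "\<dots> \<le> (LINT x|M. B)" using True assms by (intro integral_mono) auto
  finally show ?thesis by (simp add: prob_space)
\<comment> \<open>A function that is not integrable has Bochner integral 0, so the pointwise bound
  is enough.\<close>
qed (use assms in \<open>simp add: not_integrable_integral_eq\<close>)

lemma twist_in_space: "z \<in> sphere 0 1 \<Longrightarrow> x \<in> space (torus d) \<Longrightarrow> twist d (z, x) \<in> space (torus (Suc d))"
  using measurable_space[OF measurable_twist, of "(z, x)" d] by (simp add: space_pair_measure)

lemma measurable_twist_fst: "x \<in> space (torus d) \<Longrightarrow> (\<lambda>z. twist d (z, x)) \<in> measurable circle_measure (torus (Suc d))"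
  by (rule measurable_compose[OF _ measurable_twist]) simp

lemma borel_measurable_integral_twist:
  fixes f :: "_ \<Rightarrow> complex"
  assumes "f \<in> borel_measurable (torus (Suc d))" "g \<in> borel_measurable circle_measure"
  shows "(\<lambda>x. LINT z|circle_measure. f (twist d (z, x)) * g z) \<in> borel_measurable (torus d)"
proof -
  interpret C: prob_space circle_measure by (rule prob_space_circle)
  have "(\<lambda>p. f (twist d (snd p, fst p)) * g (snd p)) \<in> borel_measurable (torus d \<Otimes>\<^sub>M circle_measure)"
    by (intro borel_measurable_times measurable_compose[OF _ assms(1)] measurable_compose[OF _ assms(2)]
        measurable_compose[OF _ measurable_twist] measurable_Pair measurable_snd measurable_fst)
  then show ?thesis
    by (intro C.borel_measurable_lebesgue_integral) (simp add: case_prod_unfold)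
qed

lemma integral_torus_Suc:
  fixes f :: "_ \<Rightarrow> complex"
  assumes f: "f \<in> borel_measurable (torus (Suc d))"
    and B: "\<And>y. y \<in> space (torus (Suc d)) \<Longrightarrow> norm (f y) \<le> B"
  shows "(LINT y|torus (Suc d). f y) = (LINT x|torus d. LINT z|circle_measure. f (twist d (z, x)))"
proof -
  interpret C: prob_space circle_measure by (rule prob_space_circle)
  interpret T: prob_space "torus d" by (rule prob_space_torus)
  interpret P: pair_prob_space circle_measure "torus d" ..
  have "(LINT y|torus (Suc d). f y) = (LINT y|(distr (circle_measure \<Otimes>\<^sub>M torus d) (torus (Suc d)) (twist d)). f y)"
    by (simp add: distr_twist)
  also have "\<dots> = (LINT p|(circle_measure \<Otimes>\<^sub>M torus d). f (twist d p))"
    by (rule integral_distr[OF measurable_twist f])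
  also have "\<dots> = (LINT x|torus d. LINT z|circle_measure. f (twist d (z, x)))"
  proof -
    have "integrable (circle_measure \<Otimes>\<^sub>M torus d) (\<lambda>p. f (twist d p))"
      by (rule integrable_bounded_prob[of _ _ B])
         (use B twist_in_space measurable_compose[OF measurable_twist f] P.prob_space_axioms
           in \<open>auto simp: space_pair_measure\<close>)
    then show ?thesis by (subst P.integral_snd) (simp_all add: case_prod_unfold)
  qed
  finally show ?thesis .
qed

section \<open>Trigonometric polynomials\<close>

definition torus_char :: "nat \<Rightarrow> (nat \<Rightarrow> int) \<Rightarrow> (nat \<Rightarrow> complex) \<Rightarrow> complex" where
  "torus_char n m z = (\<Prod>i\<in>{1..n}. z i powi m i)"

text \<open>Rule \<open>cong\<close> makes membership depend only on the values on the torus: off it, where \<open>0 powi k\<close> takes junk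
  values, a product of two characters need not be a character.\<close>
inductive_set trig_poly :: "nat \<Rightarrow> int set \<Rightarrow> ((nat \<Rightarrow> complex) \<Rightarrow> complex) set" for n K where
  zero: "(\<lambda>z. 0) \<in> trig_poly n K"
| step: "f \<in> trig_poly n K \<Longrightarrow> (\<Sum>i\<in>{1..n}. m i) \<in> K \<Longrightarrow> (\<lambda>z. f z + a * torus_char n m z) \<in> trig_poly n K"
| cong: "f \<in> trig_poly n K \<Longrightarrow> (\<And>z. z \<in> space (torus n) \<Longrightarrow> g z = f z) \<Longrightarrow> g \<in> trig_poly n K"

lemma norm_torus_char [simp]: "z \<in> space (torus n) \<Longrightarrow> norm (torus_char n m z) = 1"
  by (simp add: torus_char_def norm_power_int norm_torus flip: prod_norm)

lemma torus_char_add: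
  "z \<in> space (torus n) \<Longrightarrow> torus_char n (\<lambda>i. m i + k i) z = torus_char n m z * torus_char n k z"
  unfolding torus_char_def prod.distrib[symmetric]
proof (rule prod.cong)
  fix i assume "z \<in> space (torus n)" "i \<in> {1..n}"
  then have "z i \<noteq> 0" using norm_torus by force
  then show "z i powi (m i + k i) = z i powi m i * z i powi k i" by (simp add: power_int_add)
qed simp

lemma cnj_torus_char:
  assumes "z \<in> space (torus n)"
  shows "cnj (torus_char n m z) = torus_char n (\<lambda>i. - m i) z"
proof -
  have "torus_char n m z * torus_char n (\<lambda>i. - m i) z = 1"
    using torus_char_add[OF assms, of m "\<lambda>i. - m i"] by (simp add: torus_char_def)
  moreover have "cnj (torus_char n m z) * torus_char n m z = 1"
    using norm_torus_char[OF assms, of m] by (metis complex_norm_square mult.commute of_real_1 power_one)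
  ultimately show ?thesis by (metis mult.assoc mult.left_neutral mult.right_neutral)
qed

lemma torus_char_measurable: "torus_char n m \<in> borel_measurable (torus n)"
  unfolding torus_char_def[abs_def]
  by (intro borel_measurable_prod borel_measurable_power_int measurable_torus_component)

lemma fourier_coeff_char: "fourier_coeff n f m = (LINT z|torus n. f z * torus_char n (\<lambda>i. - m i) z)"
  by (simp add: fourier_coeff_def torus_char_def)

lemma trig_poly_add: "g \<in> trig_poly n K \<Longrightarrow> f \<in> trig_poly n K \<Longrightarrow> (\<lambda>z. f z + g z) \<in> trig_poly n K"
proof (induction rule: trig_poly.induct)
  case (step g m a)
  then have "(\<lambda>z. f z + g z + a * torus_char n m z) \<in> trig_poly n K" by (simp only: trig_poly.step)
  then show ?case by (simp add: add.assoc)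
next
  case (cong g g')
  show ?case by (rule trig_poly.cong[OF cong.IH]) (use cong in auto)
qed auto

lemma trig_poly_char: "(\<Sum>i\<in>{1..n}. m i) \<in> K \<Longrightarrow> (\<lambda>z. a * torus_char n m z) \<in> trig_poly n K"
  using trig_poly.step[OF trig_poly.zero, where m = m and n = n and K = K and a = a] by simp

lemma trig_poly_const: "0 \<in> K \<Longrightarrow> (\<lambda>z. a) \<in> trig_poly n K"
  using trig_poly_char[of "\<lambda>_. 0" n K a] by (simp add: torus_char_def)

lemma trig_poly_sum:
  "(\<And>i. i \<in> I \<Longrightarrow> f i \<in> trig_poly n K) \<Longrightarrow> (\<lambda>z. \<Sum>i\<in>I. f i z) \<in> trig_poly n K"
  by (induction I rule: infinite_finite_induct) (simp_all add: trig_poly.zero trig_poly_add)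

lemma trig_poly_mult:
  assumes KL: "\<And>k l. k \<in> K \<Longrightarrow> l \<in> L \<Longrightarrow> k + l \<in> J" and f: "f \<in> trig_poly n K" and g: "g \<in> trig_poly n L"
  shows "(\<lambda>z. f z * g z) \<in> trig_poly n J"
proof -
  have char: "(\<lambda>z. f z * (a * torus_char n m z)) \<in> trig_poly n J" if m: "(\<Sum>i\<in>{1..n}. m i) \<in> L" for a m
    using f
  proof (induction rule: trig_poly.induct)
    case zero
    then show ?case by (simp add: trig_poly.zero)
  next
    case (step f k b)
    have "(\<lambda>z. f z * (a * torus_char n m z) + (a * b) * torus_char n (\<lambda>i. k i + m i) z) \<in> trig_poly n J"
      using step m KL by (intro trig_poly.step) (auto simp: sum.distrib)
    then show ?case by (rule trig_poly.cong) (simp add: torus_char_add algebra_simps)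
  next
    case (cong f f')
    show ?case by (rule trig_poly.cong[OF cong.IH]) (use cong in auto)
  qed
  show ?thesis using g
  proof (induction rule: trig_poly.induct)
    case zero
    then show ?case by (simp add: trig_poly.zero)
  next
    case (step g m a)
    from trig_poly_add[OF char[OF step.hyps(2), of a] step.IH] show ?case by (simp add: distrib_left)
  next
    case (cong g g')
    show ?case by (rule trig_poly.cong[OF cong.IH]) (use cong in auto)
  qed
qed

lemma trig_poly_scale: "f \<in> trig_poly n K \<Longrightarrow> (\<lambda>z. a * f z) \<in> trig_poly n K"
  by (rule trig_poly_mult[of "{0}" K]) (auto intro: trig_poly_const)

lemma trig_poly_power: "f \<in> trig_poly n {0..} \<Longrightarrow> (\<lambda>z. f z ^ k) \<in> trig_poly n {0..}"
proof (induction k)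
  case 0
  show ?case by (simp add: trig_poly_const)
next
  case (Suc k)
  then show ?case unfolding power_Suc by (intro trig_poly_mult[of "{0..}" "{0..}"]) auto
qed

lemma trig_poly_cnj: "f \<in> trig_poly n UNIV \<Longrightarrow> (\<lambda>z. cnj (f z)) \<in> trig_poly n UNIV"
proof (induction rule: trig_poly.induct)
  case zero
  then show ?case by (simp add: trig_poly.zero)
next
  case (step f m a)
  have "(\<lambda>z. cnj (f z) + cnj a * torus_char n (\<lambda>i. - m i) z) \<in> trig_poly n UNIV"
    using step by (intro trig_poly.step) auto
  then show ?case by (rule trig_poly.cong) (simp add: cnj_torus_char)
next
  case (cong g g')
  show ?case by (rule trig_poly.cong[OF cong.IH]) (use cong in auto)
qed

lemma trig_poly_measurable: "f \<in> trig_poly n K \<Longrightarrow> f \<in> borel_measurable (torus n)"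
proof (induction rule: trig_poly.induct)
  case (cong f g)
  then show ?case using measurable_cong[of "torus n" g f borel] by simp
next
  case (step f m a)
  then show ?case by (intro borel_measurable_add borel_measurable_times borel_measurable_const torus_char_measurable)
qed simp

lemma trig_poly_bounded:
  "f \<in> trig_poly n K \<Longrightarrow> \<exists>B\<ge>0. \<forall>z\<in>space (torus n). norm (f z) \<le> B"
proof (induction rule: trig_poly.induct)
  case (step f m a)
  then obtain B where "B \<ge> 0" "\<And>z. z \<in> space (torus n) \<Longrightarrow> norm (f z) \<le> B" by auto
  then show ?case
    by (intro exI[of _ "B + norm a"])
       (auto intro!: norm_triangle_le add_mono simp: norm_mult)
qed auto

lemma trig_poly_continuous: "f \<in> trig_poly n K \<Longrightarrow> continuous_on (space (torus n)) f"
proof (induction rule: trig_poly.induct)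
  case (step f m a)
  have nz: "z i \<noteq> 0" if "z \<in> space (torus n)" "i \<in> {1..n}" for z i
    using norm_torus[OF that] by force
  have "continuous_on (space (torus n)) (\<lambda>z. z i)" for i
    by (rule continuous_on_subset[OF continuous_on_product_coordinates]) auto
  then have "continuous_on (space (torus n)) (torus_char n m)"
    unfolding torus_char_def[abs_def] by (intro continuous_on_prod continuous_on_power_int) (use nz in auto)
  then show ?case using step by (intro continuous_intros)
next
  case (cong f g)
  then show ?case using continuous_on_cong[of "space (torus n)" _ g f] by simp
qed auto

text \<open>A term of negative total degree is replaced by its complex conjugate, which has the same
  real part and the opposite frequency. This is what permits analytic polynomials to be prescribed
  by their real parts.\<close>

lemma trig_poly_Re_nonneg:
  "f \<in> trig_poly n UNIV \<Longrightarrow> \<exists>g\<in>trig_poly n {0..}. \<forall>z\<in>space (torus n). Re (g z) = Re (f z)"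
proof (induction rule: trig_poly.induct)
  case (step f m a)
  then obtain g where g: "g \<in> trig_poly n {0..}" "\<And>z. z \<in> space (torus n) \<Longrightarrow> Re (g z) = Re (f z)" by auto
  show ?case
  proof (cases "(\<Sum>i\<in>{1..n}. m i) \<ge> 0")
    case True
    then show ?thesis using g
      by (intro bexI[of _ "\<lambda>z. g z + a * torus_char n m z"]) (auto intro!: trig_poly.step)
  next
    case False
    then have "(\<lambda>z. g z + cnj a * torus_char n (\<lambda>i. - m i) z) \<in> trig_poly n {0..}"
      using g by (intro trig_poly.step) (auto simp: sum_negf)
    moreover have "Re (cnj a * torus_char n (\<lambda>i. - m i) z) = Re (a * torus_char n m z)"
      if "z \<in> space (torus n)" for z
      using cnj_torus_char[OF that, of m] by (metis complex_cnj_mult cnj.sel(1))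
    ultimately show ?thesis using g by (intro bexI[of _ "\<lambda>z. g z + cnj a * torus_char n (\<lambda>i. - m i) z"]) auto
  qed
next
  case (cong f g)
  then show ?case by simp
qed (auto intro!: bexI[of _ "\<lambda>_. 0"] trig_poly.zero)

text \<open>Outside \<open>{1..n}\<close> the coordinates are frozen at \<open>undefined\<close>, so
  the space is a product over all of \<open>nat\<close> with circles and singletons as factors, and
  Tychonoff's theorem applies.\<close>

lemma compact_space_torus: "compact (space (torus n))"
proof -
  let ?S = "\<lambda>i. if i \<in> {1..n} then sphere (0::complex) 1 else {undefined}"
  have "space (torus n) = PiE UNIV ?S"
    by (auto simp: space_torus PiE_iff extensional_def split: if_splits)
  moreover have "compactin (product_topology (\<lambda>i::nat. euclidean::complex topology) UNIV) (PiE UNIV ?S)"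
    unfolding compactin_PiE by auto
  ultimately show ?thesis by (simp add: euclidean_product_topology)
qed

text \<open>Real Stone-Weierstrass for the real parts of all trigonometric polynomials, followed by
  the reflection of the negative frequencies.\<close>

lemma trig_poly_dense:
  assumes u: "continuous_on (space (torus n)) u" and e: "e > 0"
  shows "\<exists>f\<in>trig_poly n {0..}. \<forall>z\<in>space (torus n). \<bar>u z - Re (f z)\<bar> < e"
proof -
  let ?R = "{\<lambda>z. Re (f z) |f. f \<in> trig_poly n UNIV}"
  have "function_ring_on ?R (space (torus n))"
  proof
    show "compact (space (torus n))" by (rule compact_space_torus)
    show "continuous_on (space (torus n)) f" if "f \<in> ?R" for f
      using that by (auto intro!: continuous_on_Re trig_poly_continuous)
    show "(\<lambda>x. f x + g x) \<in> ?R" if fg: "f \<in> ?R" "g \<in> ?R" for f g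
    proof -
      obtain f' g' where "f' \<in> trig_poly n UNIV" "g' \<in> trig_poly n UNIV" "f = (\<lambda>z. Re (f' z))" "g = (\<lambda>z. Re (g' z))"
        using fg by auto
      then show ?thesis by (intro CollectI exI[of _ "\<lambda>z. f' z + g' z"]) (auto intro: trig_poly_add)
    qed
    show "(\<lambda>x. f x * g x) \<in> ?R" if fg: "f \<in> ?R" "g \<in> ?R" for f g
    proof -
      obtain f' g' where *: "f' \<in> trig_poly n UNIV" "g' \<in> trig_poly n UNIV" "f = (\<lambda>z. Re (f' z))" "g = (\<lambda>z. Re (g' z))"
        using fg by auto
      \<comment> \<open>A product of real parts is again a real part: Re f Re g = Re (f Re g), where
        Re g = (g + cnj g)/2 is itself a trigonometric polynomial.\<close>
      have "(\<lambda>z. f' z * ((1/2) * (g' z + cnj (g' z)))) \<in> trig_poly n UNIV"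
        by (intro trig_poly_mult[of UNIV UNIV] trig_poly_scale trig_poly_add trig_poly_cnj) (use * in auto)
      moreover have "Re (f' z * ((1/2) * (g' z + cnj (g' z)))) = f z * g z" for z
        by (simp add: * complex_add_cnj)
      ultimately show ?thesis by (intro CollectI exI[of _ "\<lambda>z. f' z * ((1/2) * (g' z + cnj (g' z)))"]) auto
    qed
    show "(\<lambda>_. c) \<in> ?R" for c
      by (intro CollectI exI[of _ "\<lambda>_. complex_of_real c"]) (auto intro: trig_poly_const)
    show "\<exists>f\<in>?R. f x \<noteq> f y" if xy: "x \<in> space (torus n)" "y \<in> space (torus n)" "x \<noteq> y" for x y
    proof -
      obtain i where i: "i \<in> {1..n}" "x i \<noteq> y i"
        using xy by (metis PiE_ext space_torus)
      have ch: "torus_char n (\<lambda>j. if j = i then 1 else 0) z = z i" for z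
      proof -
        have "torus_char n (\<lambda>j. if j = i then 1 else 0) z = (\<Prod>j\<in>{1..n}. if j = i then z j else 1)"
          unfolding torus_char_def by (rule prod.cong) auto
        then show ?thesis using i by simp
      qed
      have mem: "(\<lambda>z. a * z i) \<in> trig_poly n UNIV" for a
        using trig_poly_char[of "\<lambda>j. if j = i then 1 else 0" n UNIV a] by (simp add: ch)
      show ?thesis
      \<comment> \<open>Coordinates with equal real parts differ in their imaginary parts, and Im w
        = Re (-i w).\<close>
      proof (cases "Re (x i) = Re (y i)")
        case True
        then have "Re ((-\<i>) * x i) \<noteq> Re ((-\<i>) * y i)" using i by (auto simp: complex_eq_iff)
        moreover have "(\<lambda>z. Re ((-\<i>) * z i)) \<in> ?R"
          by (rule CollectI, rule exI[of _ "\<lambda>z. (-\<i>) * z i"]) (simp only: mem simp_thms)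
        ultimately show ?thesis by (rule bexI[of _ "\<lambda>z. Re ((-\<i>) * z i)"])
      next
        case False
        then have "Re (1 * x i) \<noteq> Re (1 * y i)" by simp
        moreover have "(\<lambda>z. Re (1 * z i)) \<in> ?R"
          by (rule CollectI, rule exI[of _ "\<lambda>z. 1 * z i"]) (simp only: mem simp_thms)
        ultimately show ?thesis by (rule bexI[of _ "\<lambda>z. Re (1 * z i)"])
      qed
    qed
  qed
  from function_ring_on.Stone_Weierstrass_basic[OF this u e]
  obtain f where f: "f \<in> trig_poly n UNIV" "\<And>z. z \<in> space (torus n) \<Longrightarrow> \<bar>u z - Re (f z)\<bar> < e" by auto
  from trig_poly_Re_nonneg[OF f(1)] obtain g where
    "g \<in> trig_poly n {0..}" "\<forall>z\<in>space (torus n). Re (g z) = Re (f z)" by auto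
  with f(2) show ?thesis by (intro bexI[of _ g]) auto
qed

section \<open>Approximate factorization of analytic trigonometric polynomials\<close>

lemma exp_uniform_partial_sum:
  assumes "\<eta> > (0::real)"
  shows "\<exists>N. \<forall>w::complex. norm w \<le> K \<longrightarrow> norm ((\<Sum>k<N. w ^ k /\<^sub>R fact k) - exp w) < \<eta>"
proof -
  have "uniform_limit (cball (0::complex) K) (\<lambda>n w. \<Sum>k<n. w ^ k /\<^sub>R fact k) (\<lambda>w. \<Sum>k. w ^ k /\<^sub>R fact k) sequentially"
  proof (rule Weierstrass_m_test)
    show "norm (w ^ k /\<^sub>R fact k) \<le> \<bar>K\<bar> ^ k /\<^sub>R fact k" if "w \<in> cball 0 K" for w :: complex and k
      using that by (auto simp: norm_power divide_simps intro!: power_mono)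
    show "summable (\<lambda>k. \<bar>K\<bar> ^ k /\<^sub>R fact k)" by (rule summable_exp_generic)
  qed
  then have "\<forall>\<^sub>F n in sequentially. \<forall>w\<in>cball (0::complex) K. dist (\<Sum>k<n. w ^ k /\<^sub>R fact k) (\<Sum>k. w ^ k /\<^sub>R fact k) < \<eta>"
    using assms by (rule uniform_limitD)
  then obtain N where "\<forall>w\<in>cball (0::complex) K. dist (\<Sum>k<N. w ^ k /\<^sub>R fact k) (\<Sum>k. w ^ k /\<^sub>R fact k) < \<eta>"
    unfolding eventually_sequentially by blast
  then show ?thesis by (intro exI[of _ N]) (auto simp: dist_norm exp_def)
qed

text \<open>The outer function \<open>exp A\<close> with \<open>2 Re A \<approx> ln (\<bar>h\<bar> + t)\<close> takes the role of the square root of the outer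
  part of \<open>h\<close>; truncating the exponential series keeps both factors trigonometric polynomials.\<close>
lemma trig_poly_factorization:
  assumes h: "h \<in> trig_poly n {1..}" and e: "e > 0"
  shows "\<exists>f\<in>trig_poly n {1..}. \<exists>g\<in>trig_poly n {0..}. \<forall>z\<in>space (torus n).
    norm (h z - f z * g z) \<le> e \<and> (norm (f z))\<^sup>2 \<le> norm (h z) + e \<and> (norm (g z))\<^sup>2 \<le> norm (h z) + e"
proof -
  obtain B0 where B0: "\<And>z. z \<in> space (torus n) \<Longrightarrow> norm (h z) \<le> B0" using trig_poly_bounded[OF h] by auto
  \<comment> \<open>The bound is raised to at least 1 so that 1 and B are both dominated by B^2, the
    factor for which \<eta> is chosen below.\<close>
  define B where "B = max B0 1"
  have B: "B \<ge> 1" "\<And>z. z \<in> space (torus n) \<Longrightarrow> norm (h z) \<le> B" using B0 by (auto simp: B_def le_max_iff_disj)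
  \<comment> \<open>The shift t keeps the logarithm finite at zeros of h, and the same t is the
    multiplicative precision; its size makes (1 + t)(x + t) \<le> x + e/2 for all values x of
    |h|.\<close>
  define t where "t = min 1 (e / (2 * (B + 2)))"
  have t: "t > 0" "t \<le> 1" "t * (B + 2) \<le> e / 2"
  proof -
    show "t > 0" "t \<le> 1" using e B by (auto simp: t_def)
    have "t * (B + 2) \<le> e / (2 * (B + 2)) * (B + 2)"
      using B by (intro mult_right_mono) (auto simp: t_def)
    also have "\<dots> = e / 2" using B by (simp add: divide_simps)
    finally show "t * (B + 2) \<le> e / 2" .
  qed
  have t_le: "(1 + t) * (x + t) \<le> x + e / 2" if "0 \<le> x" "x \<le> B" for x
  proof -
    have "(1 + t) * (x + t) = x + t * (x + 1 + t)" by (simp add: algebra_simps)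
    also have "t * (x + 1 + t) \<le> t * (B + 2)" using t that by (intro mult_left_mono) auto
    finally show ?thesis using t by linarith
  qed
  let ?u = "\<lambda>z. ln (norm (h z) + t) / 2"
  have "continuous_on (space (torus n)) ?u"
  proof (intro continuous_intros trig_poly_continuous[OF h] ballI)
    fix z show "cmod (h z) + t \<noteq> 0" using t norm_ge_zero[of "h z"] by linarith
  qed auto
  moreover have "ln (1 + t) / 2 > 0" using t by simp
  ultimately obtain A where A: "A \<in> trig_poly n {0..}"
    "\<And>z. z \<in> space (torus n) \<Longrightarrow> \<bar>?u z - Re (A z)\<bar> < ln (1 + t) / 2"
    using trig_poly_dense by blast
  obtain K where K: "\<And>z. z \<in> space (torus n) \<Longrightarrow> norm (A z) \<le> K" using trig_poly_bounded[OF A(1)] by auto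
  define P where "P = exp K"
  have P: "P > 0" by (simp add: P_def)
  \<comment> \<open>Squaring a quantity of size at most P with error \<eta> costs at most (2P +
    1)\<eta>; the factor B^2 is there because this error is multiplied by |h|^2 in the estimate for
    f.\<close>
  define \<eta> where "\<eta> = min 1 (e / (2 * (B\<^sup>2 * (2 * P + 1))))"
  have D: "B\<^sup>2 * (2 * P + 1) > 0" using B P by (intro mult_pos_pos) auto
  have eta: "\<eta> > 0" "\<eta> \<le> 1" "B\<^sup>2 * ((2 * P + 1) * \<eta>) \<le> e / 2"
  proof -
    show "\<eta> > 0" "\<eta> \<le> 1" using e D by (auto simp: \<eta>_def)
    have "B\<^sup>2 * (2 * P + 1) * \<eta> \<le> B\<^sup>2 * (2 * P + 1) * (e / (2 * (B\<^sup>2 * (2 * P + 1))))"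
      using D by (intro mult_left_mono) (auto simp: \<eta>_def)
    also have "\<dots> = e / 2"
    proof -
      have "c * (e / (2 * c)) = e / 2" if "c > 0" for c using that by simp
      then show ?thesis using D .
    qed
    finally show "B\<^sup>2 * ((2 * P + 1) * \<eta>) \<le> e / 2" by (simp add: mult.assoc)
  qed
  obtain N where N: "\<And>w::complex. norm w \<le> K \<Longrightarrow> norm ((\<Sum>k<N. w ^ k /\<^sub>R fact k) - exp w) < \<eta>"
    using exp_uniform_partial_sum[OF eta(1), of K] by blast
  define E where "E w = (\<Sum>k<N. w ^ k /\<^sub>R fact k)" for w :: complex
  have E_mem: "(\<lambda>z. E (F z)) \<in> trig_poly n {0..}" if "F \<in> trig_poly n {0..}" for F
    unfolding E_def scaleR_conv_of_real
    by (intro trig_poly_sum trig_poly_scale trig_poly_power that)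
  have mA: "(\<lambda>z. - A z) \<in> trig_poly n {0..}" using trig_poly_scale[OF A(1), of "-1"] by simp
  show ?thesis
  proof (intro bexI ballI)
    \<comment> \<open>The factors are f = h E(-A) and g = E(A). Since exp(-A) exp(A) = 1, no zero of
      h needs to be divided out, and f inherits the frequencies of total degree at least 1 from
      h.\<close>
    show "(\<lambda>z. E (A z)) \<in> trig_poly n {0..}" by (rule E_mem[OF A(1)])
    show "(\<lambda>z. h z * E (- A z)) \<in> trig_poly n {1..}"
      by (rule trig_poly_mult[OF _ h E_mem[OF mA]]) auto
    fix z assume z: "z \<in> space (torus n)"
    define w where "w = A z"
    define x where "x = norm (h z)"
    have x: "0 \<le> x" "x \<le> B" using B(2)[OF z] by (auto simp: x_def)
    have w: "norm w \<le> K" using K[OF z] by (simp add: w_def)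
    have ex: "norm (exp w) \<le> P" "norm (exp (-w)) \<le> P"
      using w abs_Re_le_cmod[of w] by (auto simp: P_def)
    have Ew: "norm (E w - exp w) \<le> \<eta>" "norm (E (-w) - exp (-w)) \<le> \<eta>"
      using N[of w] N[of "-w"] w by (auto simp: E_def)
    have nE: "norm (E w) \<le> norm (exp w) + \<eta>" "norm (E (-w)) \<le> norm (exp (-w)) + \<eta>"
      using Ew norm_triangle_ineq2[of "E w" "exp w"] norm_triangle_ineq2[of "E (-w)" "exp (-w)"] by linarith+
    have sq: "a\<^sup>2 \<le> b\<^sup>2 + (2 * P + 1) * \<eta>" if "0 \<le> a" "a \<le> b + \<eta>" "0 \<le> b" "b \<le> P" for a b
    proof -
      have "a\<^sup>2 \<le> (b + \<eta>)\<^sup>2" using that by (intro power_mono) auto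
      also have "\<dots> = b\<^sup>2 + (2 * b + \<eta>) * \<eta>" by (simp add: power2_eq_square algebra_simps)
      also have "\<dots> \<le> b\<^sup>2 + (2 * P + 1) * \<eta>" using that eta by (intro add_left_mono mult_right_mono) auto
      finally show ?thesis .
    qed
    have B2: "B\<^sup>2 \<ge> 1" using B by simp
    have small: "(2 * P + 1) * \<eta> \<le> e / 2" "B * ((2 * P + 1) * \<eta>) \<le> e / 2"
    proof -
      have pos: "(2 * P + 1) * \<eta> \<ge> 0" using P eta by auto
      show "(2 * P + 1) * \<eta> \<le> e / 2"
        using mult_right_mono[OF B2 pos] eta by linarith
      have "B \<le> B\<^sup>2" using B by (simp add: power2_eq_square)
      then show "B * ((2 * P + 1) * \<eta>) \<le> e / 2"
        using mult_right_mono[OF _ pos, of B "B\<^sup>2"] eta by linarith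
    qed
    have Rew: "\<bar>ln (x + t) - 2 * Re w\<bar> \<le> ln (1 + t)"
      using A(2)[OF z] unfolding w_def x_def by linarith
    have expw: "(norm (exp w))\<^sup>2 = exp (2 * Re w)" "(norm (exp (-w)))\<^sup>2 = exp (- (2 * Re w))"
      by (simp_all add: power2_eq_square flip: exp_add)
    have xt: "x + t > 0" using x t by auto
    have up: "exp (2 * Re w) \<le> (1 + t) * (x + t)"
    proof -
      have "exp (2 * Re w) \<le> exp (ln (1 + t) + ln (x + t))" using Rew by simp
      then show ?thesis using t xt by (simp add: exp_add)
    qed
    have lo: "exp (- (2 * Re w)) \<le> (1 + t) / (x + t)"
    proof -
      have "exp (- (2 * Re w)) \<le> exp (ln (1 + t) - ln (x + t))" using Rew by simp
      then show ?thesis using t xt by (simp add: exp_diff)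
    qed
    have g: "(norm (E w))\<^sup>2 \<le> x + e"
      using sq[OF _ nE(1) _ ex(1)] expw(1) up t_le[OF x] small by simp
    \<comment> \<open>The denominator x + t is absorbed by one factor x of |h|^2, which is why the
      bound stays uniform where h is small.\<close>
    have "x\<^sup>2 * (norm (exp (-w)))\<^sup>2 \<le> x\<^sup>2 * ((1 + t) / (x + t))"
      unfolding expw using lo by (intro mult_left_mono) auto
    also have "\<dots> = (1 + t) * (x * (x / (x + t)))" by (simp add: power2_eq_square)
    also have "\<dots> \<le> (1 + t) * (x * 1)" using x t xt by (intro mult_left_mono) auto
    also have "\<dots> \<le> (1 + t) * (x + t)" using t by (intro mult_left_mono) auto
    also have "\<dots> \<le> x + e / 2" by (rule t_le[OF x])
    finally have f1: "x\<^sup>2 * (norm (exp (-w)))\<^sup>2 \<le> x + e / 2" .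
    have "(x * norm (E (-w)))\<^sup>2 \<le> x\<^sup>2 * ((norm (exp (-w)))\<^sup>2 + (2 * P + 1) * \<eta>)"
      unfolding power_mult_distrib using sq[OF _ nE(2) _ ex(2)] by (intro mult_left_mono) auto
    also have "\<dots> = x\<^sup>2 * (norm (exp (-w)))\<^sup>2 + x\<^sup>2 * ((2 * P + 1) * \<eta>)" by (simp add: distrib_left)
    also have "x\<^sup>2 * ((2 * P + 1) * \<eta>) \<le> B\<^sup>2 * ((2 * P + 1) * \<eta>)"
      using x P eta by (intro mult_right_mono power_mono) auto
    finally have f: "(x * norm (E (-w)))\<^sup>2 \<le> x + e" using f1 eta by linarith
    \<comment> \<open>Inserting exp(-w) exp(w) = 1 expresses the defect through the two truncation
      errors.\<close>
    have "1 - E (-w) * E w = exp (-w) * (exp w - E w) + E w * (exp (-w) - E (-w))"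
      by (simp add: algebra_simps exp_minus)
    then have "norm (1 - E (-w) * E w) \<le> norm (exp (-w)) * norm (exp w - E w) + norm (E w) * norm (exp (-w) - E (-w))"
      by (metis norm_mult norm_triangle_ineq)
    also have "\<dots> \<le> P * \<eta> + (P + 1) * \<eta>"
      using ex Ew nE eta P by (intro add_mono mult_mono) (auto simp: norm_minus_commute)
    also have "\<dots> = (2 * P + 1) * \<eta>" by (simp add: algebra_simps)
    finally have pr: "norm (1 - E (-w) * E w) \<le> (2 * P + 1) * \<eta>" .
    have "norm (h z - h z * E (-w) * E w) = x * norm (1 - E (-w) * E w)"
      unfolding x_def norm_mult[symmetric] by (simp add: algebra_simps)
    also have "\<dots> \<le> B * ((2 * P + 1) * \<eta>)" using x pr by (intro mult_mono) auto
    finally have "norm (h z - h z * E (-w) * E w) \<le> e" using small e by linarith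
    with f g show "norm (h z - h z * E (- A z) * E (A z)) \<le> e \<and> (norm (h z * E (- A z)))\<^sup>2 \<le> norm (h z) + e
        \<and> (norm (E (A z)))\<^sup>2 \<le> norm (h z) + e"
      by (simp add: w_def x_def norm_mult)
  qed
qed

section \<open>Uniqueness of Fourier coefficients\<close>

text \<open>The bound holds at every point, not just almost everywhere, so that it passes to each
  single fibre of the twisted coordinates, which is a null set in general.\<close>

definition bounded_measurable :: "'a measure \<Rightarrow> ('a \<Rightarrow> complex) \<Rightarrow> bool" where
  "bounded_measurable M f \<longleftrightarrow> f \<in> borel_measurable M \<and> (\<exists>B\<ge>0. \<forall>x\<in>space M. norm (f x) \<le> B)"

lemma bounded_measurableI:
  "f \<in> borel_measurable M \<Longrightarrow> (\<And>x. x \<in> space M \<Longrightarrow> norm (f x) \<le> B) \<Longrightarrow> bounded_measurable M f"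
  unfolding bounded_measurable_def by (intro conjI exI[of _ "\<bar>B\<bar>"]) force+

lemma bounded_measurableE:
  assumes "bounded_measurable M f"
  obtains B where "B \<ge> 0" "f \<in> borel_measurable M" "\<And>x. x \<in> space M \<Longrightarrow> norm (f x) \<le> B"
  using assms unfolding bounded_measurable_def by blast

lemma bounded_measurable_measurable: "bounded_measurable M f \<Longrightarrow> f \<in> borel_measurable M"
  by (simp add: bounded_measurable_def)

lemma bounded_measurable_const: "bounded_measurable M (\<lambda>x. c)"
  by (rule bounded_measurableI[of _ _ "norm c"]) auto

lemma bounded_measurable_add:
  assumes "bounded_measurable M f" "bounded_measurable M g"
  shows "bounded_measurable M (\<lambda>x. f x + g x)"
proof -
  obtain A B where "f \<in> borel_measurable M" "\<And>x. x \<in> space M \<Longrightarrow> norm (f x) \<le> A"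
    "g \<in> borel_measurable M" "\<And>x. x \<in> space M \<Longrightarrow> norm (g x) \<le> B"
    using assms by (metis bounded_measurableE)
  then show ?thesis by (intro bounded_measurableI[of _ _ "A + B"]) (auto intro!: norm_triangle_le add_mono)
qed

lemma bounded_measurable_mult:
  assumes "bounded_measurable M f" "bounded_measurable M g"
  shows "bounded_measurable M (\<lambda>x. f x * g x)"
proof -
  obtain A B where "A \<ge> 0" "B \<ge> 0" "f \<in> borel_measurable M" "\<And>x. x \<in> space M \<Longrightarrow> norm (f x) \<le> A"
    "g \<in> borel_measurable M" "\<And>x. x \<in> space M \<Longrightarrow> norm (g x) \<le> B"
    using assms by (metis bounded_measurableE)
  then show ?thesis by (intro bounded_measurableI[of _ _ "A * B"]) (auto simp: norm_mult intro!: mult_mono)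
qed

lemma bounded_measurable_diff:
  "bounded_measurable M f \<Longrightarrow> bounded_measurable M g \<Longrightarrow> bounded_measurable M (\<lambda>x. f x - g x)"
  using bounded_measurable_add[of M f "\<lambda>x. (-1) * g x"] bounded_measurable_mult[OF bounded_measurable_const, of M g "-1"] by simp

lemma bounded_measurable_sum:
  "(\<And>i. i \<in> I \<Longrightarrow> bounded_measurable M (f i)) \<Longrightarrow> bounded_measurable M (\<lambda>x. \<Sum>i\<in>I. f i x)"
  by (induction I rule: infinite_finite_induct) (auto intro: bounded_measurable_const bounded_measurable_add)

lemma bounded_measurable_cnj: "bounded_measurable M f \<Longrightarrow> bounded_measurable M (\<lambda>x. cnj (f x))"
  unfolding bounded_measurable_def
  by (auto intro: borel_measurable_continuous_on[of cnj] intro!: continuous_intros)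

lemma bounded_measurable_integrable: "prob_space M \<Longrightarrow> bounded_measurable M f \<Longrightarrow> integrable M f"
  by (metis bounded_measurableE integrable_bounded_prob)

lemma bounded_measurable_trig_poly: "f \<in> trig_poly n K \<Longrightarrow> bounded_measurable (torus n) f"
  unfolding bounded_measurable_def using trig_poly_bounded trig_poly_measurable by blast

lemma bounded_measurable_torus_char: "bounded_measurable (torus n) (torus_char n m)"
  by (rule bounded_measurableI[of _ _ 1]) (auto simp: torus_char_measurable)

lemma integrable_norm_sq:
  assumes "prob_space M" "bounded_measurable M v"
  shows "integrable M (\<lambda>x. (norm (v x))\<^sup>2)"
proof -
  have "integrable M (\<lambda>x. v x * cnj (v x))"
    by (intro bounded_measurable_integrable assms bounded_measurable_mult bounded_measurable_cnj)
  then have "integrable M (\<lambda>x. complex_of_real ((norm (v x))\<^sup>2))"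
    by (simp only: complex_norm_square)
  then show ?thesis by (simp only: complex_of_real_integrable_eq)
qed

lemmas bounded_measurable_intros = bounded_measurable_const bounded_measurable_add bounded_measurable_mult
  bounded_measurable_diff bounded_measurable_sum bounded_measurable_cnj bounded_measurable_torus_char

lemma integrable_torus: "bounded_measurable (torus n) f \<Longrightarrow> integrable (torus n) f"
  by (rule bounded_measurable_integrable[OF prob_space_torus])

lemma integral_trig_poly_eq_0:
  assumes f: "bounded_measurable (torus n) f"
    and z: "\<And>m. (\<Sum>i\<in>{1..n}. m i) \<in> K \<Longrightarrow> fourier_coeff n f (\<lambda>i. - m i) = 0"
    and p: "p \<in> trig_poly n K"
  shows "(LINT x|torus n. f x * p x) = 0"
  using p
proof (induction rule: trig_poly.induct)
  case (step p m a)
  have "(LINT x|torus n. f x * (p x + a * torus_char n m x))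
      = (LINT x|torus n. f x * p x + a * (f x * torus_char n m x))"
    by (simp add: algebra_simps)
  also have "\<dots> = (LINT x|torus n. f x * p x) + (LINT x|torus n. a * (f x * torus_char n m x))"
    by (intro Bochner_Integration.integral_add integrable_torus bounded_measurable_intros f
        bounded_measurable_trig_poly[OF step.hyps(1)])
  also have "(LINT x|torus n. a * (f x * torus_char n m x)) = a * fourier_coeff n f (\<lambda>i. - m i)"
    by (simp add: fourier_coeff_char)
  finally show ?case using step z by simp
next
  case (cong p q)
  then have "(LINT x|torus n. f x * q x) = (LINT x|torus n. f x * p x)"
    by (intro Bochner_Integration.integral_cong) auto
  then show ?case using cong by simp
qed simp

text \<open>The integral against every trigonometric polynomial vanishes, and the continuous
  function is a uniform limit of real parts of such polynomials.\<close>

lemma integral_continuous_eq_0: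
  assumes f: "bounded_measurable (torus n) f" and z: "\<And>m. fourier_coeff n f m = 0"
    and c: "continuous_on (space (torus n)) c" "bounded_measurable (torus n) (\<lambda>x. complex_of_real (c x))"
  shows "(LINT x|torus n. f x * complex_of_real (c x)) = 0"
proof -
  obtain B where B: "B \<ge> 0" "\<And>x. x \<in> space (torus n) \<Longrightarrow> norm (f x) \<le> B"
    using f by (metis bounded_measurableE)
  have le: "norm (LINT x|torus n. f x * complex_of_real (c x)) \<le> B * e" if e: "e > 0" for e
  proof -
    obtain p where p: "p \<in> trig_poly n {0..}" "\<And>x. x \<in> space (torus n) \<Longrightarrow> \<bar>c x - Re (p x)\<bar> < e"
      using trig_poly_dense[OF c(1) e] by blast
    have p': "p \<in> trig_poly n UNIV"
      using trig_poly_mult[of "{0..}" "{0}" UNIV p n "\<lambda>_. 1"] p(1) trig_poly_const[of "{0}" 1 n] by auto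
    have q: "(\<lambda>x. (1/2) * (p x + cnj (p x))) \<in> trig_poly n UNIV"
      by (intro trig_poly_scale trig_poly_add trig_poly_cnj p')
    have qRe: "(1/2) * (p x + cnj (p x)) = complex_of_real (Re (p x))" for x by (simp add: complex_add_cnj)
    have bq: "bounded_measurable (torus n) (\<lambda>x. complex_of_real (Re (p x)))"
      using bounded_measurable_trig_poly[OF q] unfolding qRe .
    have "(LINT x|torus n. f x * complex_of_real (c x)) = (LINT x|torus n. f x * complex_of_real (c x)) - (LINT x|torus n. f x * complex_of_real (Re (p x)))"
      using integral_trig_poly_eq_0[OF f _ q] z unfolding qRe by simp
    also have "\<dots> = (LINT x|torus n. f x * complex_of_real (c x) - f x * complex_of_real (Re (p x)))"
      by (intro Bochner_Integration.integral_diff[symmetric] integrable_torus bounded_measurable_mult f c bq)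
    also have "norm \<dots> \<le> B * e"
    proof (rule norm_integral_le_prob[OF prob_space_torus])
      fix x assume x: "x \<in> space (torus n)"
      have "norm (f x * complex_of_real (c x) - f x * complex_of_real (Re (p x))) = norm (f x) * \<bar>c x - Re (p x)\<bar>"
        by (metis norm_mult norm_of_real of_real_diff right_diff_distrib)
      also have "\<dots> \<le> B * e" using B p(2)[OF x] x by (intro mult_mono) auto
      finally show "norm (f x * complex_of_real (c x) - f x * complex_of_real (Re (p x))) \<le> B * e" .
    qed (use B e in auto)
    finally show ?thesis .
  qed
  have "norm (LINT x|torus n. f x * complex_of_real (c x)) \<le> 0 + e" if e: "e > 0" for e
  proof -
    have "B * (e / (B + 1)) \<le> e" using B e by (simp add: field_simps)
    moreover have "e / (B + 1) > 0" using B e by simp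
    ultimately show ?thesis using le[of "e / (B + 1)"] by linarith
  qed
  then show ?thesis using field_le_epsilon norm_le_zero_iff by blast
qed

lemma integral_closed_rectangle_eq_0:
  assumes f: "bounded_measurable (torus n) f" and z: "\<And>m. fourier_coeff n f m = 0"
    and A: "\<And>i. closed (A i)"
  shows "(LINT x|torus n. f x * (\<Prod>i\<in>{1..n}. indicator (A i) (x i))) = 0"
\<comment> \<open>An empty side has to be split off: \<open>infdist\<close> to the empty set is 0 by
  convention, so the functions below would converge to 1 instead of 0.\<close>
proof (cases "\<exists>i\<in>{1..n}. A i = {}")
  case True
  then obtain i where "i \<in> {1..n}" "A i = {}" by blast
  then have "(\<Prod>i\<in>{1..n}. indicator (A i) (x i)) = (0::complex)" for x
    by (intro prod_zero bexI[of _ i]) auto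
  then show ?thesis by (simp only: mult_zero_right Bochner_Integration.integral_zero)
next
  case False
  \<comment> \<open>Continuous functions that decrease to the indicator of the closed set
    \<open>A i\<close>; their products over the coordinates remain bounded by 1, so dominated
    convergence applies.\<close>
  define b where "b k w i = max 0 (1 - real k * infdist w (A i))" for k :: nat and w i
  have b: "0 \<le> b k w i" "b k w i \<le> 1" for k w i by (auto simp: b_def infdist_nonneg)
  define c where "c k x = (\<Prod>i\<in>{1..n}. b k (x i) i)" for k :: nat and x
  have c: "0 \<le> c k x" "c k x \<le> 1" for k x
    unfolding c_def using b by (auto intro!: prod_nonneg prod_le_1)
  have cont: "continuous_on (space (torus n)) (c k)" for k
  proof -
    have "continuous_on (space (torus n)) (\<lambda>z. z i)" for i
      by (rule continuous_on_subset[OF continuous_on_product_coordinates]) auto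
    then show ?thesis unfolding c_def[abs_def] b_def by (intro continuous_intros)
  qed
  have meas: "c k \<in> borel_measurable (torus n)" for k
    unfolding c_def[abs_def] b_def
    by (intro borel_measurable_prod borel_measurable_max borel_measurable_diff borel_measurable_times
        borel_measurable_const measurable_compose[OF measurable_torus_component]
        borel_measurable_continuous_onI continuous_intros)
  have bm: "bounded_measurable (torus n) (\<lambda>x. complex_of_real (c k x))" for k
    by (rule bounded_measurableI[of _ _ 1]) (use meas c in auto)
  obtain B where B: "B \<ge> 0" "f \<in> borel_measurable (torus n)" "\<And>x. x \<in> space (torus n) \<Longrightarrow> norm (f x) \<le> B"
    using f by (metis bounded_measurableE)
  have lim1: "(\<lambda>k. b k w i) \<longlonglongrightarrow> indicator (A i) w" if i: "i \<in> {1..n}" for w i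
  proof (cases "w \<in> A i")
    case True
    then show ?thesis by (simp add: b_def)
  next
    case w: False
    then have "infdist w (A i) > 0"
      using in_closed_iff_infdist_zero[OF A, of i w] False i infdist_nonneg[of w "A i"] by force
    moreover obtain k0 :: nat where "real k0 > 1 / infdist w (A i)" using reals_Archimedean2 by blast
    ultimately have "b k w i = 0" if "k \<ge> k0" for k
    proof -
      have "1 < real k0 * infdist w (A i)"
        using \<open>real k0 > _\<close> \<open>infdist w (A i) > 0\<close> by (simp add: field_simps)
      also have "\<dots> \<le> real k * infdist w (A i)" using that by (intro mult_right_mono) (auto simp: infdist_nonneg)
      finally show ?thesis by (simp add: b_def)
    qed
    then have "eventually (\<lambda>k. b k w i = 0) sequentially" by (auto simp: eventually_sequentially)
    then show ?thesis using w by (simp add: tendsto_eventually)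
  qed
  have lim: "(\<lambda>k. f x * complex_of_real (c k x)) \<longlonglongrightarrow> f x * (\<Prod>i\<in>{1..n}. indicator (A i) (x i))" for x
  proof -
    have "(\<lambda>k. c k x) \<longlonglongrightarrow> (\<Prod>i\<in>{1..n}. indicator (A i) (x i))"
      unfolding c_def by (intro tendsto_prod lim1)
    then have "(\<lambda>k. complex_of_real (c k x)) \<longlonglongrightarrow> complex_of_real (\<Prod>i\<in>{1..n}. indicator (A i) (x i))"
      by (rule tendsto_of_real)
    also have "complex_of_real (\<Prod>i\<in>{1..n}. indicator (A i) (x i)) = (\<Prod>i\<in>{1..n}. indicator (A i) (x i))"
      by (auto simp: indicator_def of_real_prod intro!: prod.cong)
    finally show ?thesis by (intro tendsto_mult tendsto_const)
  qed
  interpret prob_space "torus n" by (rule prob_space_torus)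
  have "(\<lambda>k. LINT x|torus n. f x * complex_of_real (c k x)) \<longlonglongrightarrow> (LINT x|torus n. f x * (\<Prod>i\<in>{1..n}. indicator (A i) (x i)))"
  proof (rule integral_dominated_convergence[where w = "\<lambda>_. B"])
    show "(\<lambda>x. f x * (\<Prod>i\<in>{1..n}. indicator (A i) (x i))) \<in> borel_measurable (torus n)"
      using A B(2) by (intro borel_measurable_times borel_measurable_prod
        measurable_compose[OF measurable_torus_component] borel_measurable_indicator) auto
    show "(\<lambda>x. f x * complex_of_real (c k x)) \<in> borel_measurable (torus n)" for k
      using B(2) bm bounded_measurable_measurable by (intro borel_measurable_times) auto
    show "AE x in torus n. norm (f x * complex_of_real (c k x)) \<le> B" for k
    proof (rule AE_I2)
      fix x assume "x \<in> space (torus n)"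
      then have "norm (f x) * \<bar>c k x\<bar> \<le> B * 1" using B c[of k x] by (intro mult_mono) auto
      then show "norm (f x * complex_of_real (c k x)) \<le> B" by (simp add: norm_mult)
    qed
  qed (use lim in auto)
  moreover have "(LINT x|torus n. f x * complex_of_real (c k x)) = 0" for k
    by (rule integral_continuous_eq_0[OF f z cont bm])
  ultimately show ?thesis by (simp add: LIMSEQ_const_iff)
qed

text \<open>An intersection-stable generator of the sigma-algebra on whose members integrals are
  reachable from continuous functions.\<close>

definition closed_rectangles :: "nat \<Rightarrow> (nat \<Rightarrow> complex) set set" where
  "closed_rectangles n = {space (torus n) \<inter> {x. \<forall>i\<in>{1..n}. x i \<in> A i} |A. \<forall>i. closed (A i)}"

lemma closed_rectangle_in_sets:
  assumes "\<And>i. closed (A i)"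
  shows "space (torus n) \<inter> {x. \<forall>i\<in>{1..n}. x i \<in> A i} \<in> sets (torus n)"
proof -
  have "{x \<in> space (torus n). \<forall>i\<in>{1..n}. x i \<in> A i} \<in> sets (torus n)"
  proof (rule sets.sets_Collect_finite_All)
    fix i assume "i \<in> {1..n}"
    from measurable_sets[OF measurable_torus_component[OF this], of "A i"] assms
    show "{x \<in> space (torus n). x i \<in> A i} \<in> sets (torus n)" by (simp add: vimage_def Int_def conj_commute)
  qed simp
  then show ?thesis by (simp add: Int_def)
qed

lemma sets_torus: "sets (torus n) = sigma_sets (space (torus n)) (closed_rectangles n)"
proof
  show "sigma_sets (space (torus n)) (closed_rectangles n) \<subseteq> sets (torus n)"
    using closed_rectangle_in_sets[of _ n] by (intro sets.sigma_sets_subset) (auto simp: closed_rectangles_def)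
  have sub: "closed_rectangles n \<subseteq> Pow (space (torus n))" by (auto simp: closed_rectangles_def)
  let ?N = "sigma (space (torus n)) (closed_rectangles n)"
  have spN: "space ?N = space (torus n)" by (simp add: space_measure_of sub)
  have comp: "(\<lambda>x. x i) \<in> borel_measurable ?N" if i: "i \<in> {1..n}" for i
    unfolding borel_eq_closed
  proof (rule measurable_measure_of)
    fix C :: "complex set" assume "C \<in> Collect closed"
    then have C: "closed C" by simp
    have "(\<lambda>x. x i) -` C \<inter> space ?N = space (torus n) \<inter> {x. \<forall>j\<in>{1..n}. x j \<in> (if j = i then C else UNIV)}"
      using i spN by auto
    moreover have "\<forall>j. closed (if j = i then C else UNIV)" using C by simp
    ultimately have "(\<lambda>x. x i) -` C \<inter> space ?N \<in> closed_rectangles n"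
      unfolding closed_rectangles_def
      by (intro CollectI exI[of _ "\<lambda>j. if j = i then C else UNIV"] conjI) auto
    then show "(\<lambda>x. x i) -` C \<inter> space ?N \<in> sets ?N" using sub by auto
  qed auto
  have "sets (torus n) \<subseteq> sets ?N"
    unfolding torus_def
  proof (rule sets_PiM_in_sets)
    show "space (sigma (space (Pi\<^sub>M {1..n} (\<lambda>_. circle_measure))) (closed_rectangles n)) = {1..n} \<rightarrow>\<^sub>E space circle_measure"
      using spN by (simp add: torus_def space_PiM)
    fix i and A :: "complex set" assume iA: "i \<in> {1..n}" "A \<in> sets circle_measure"
    then have "A \<in> sets borel" by (simp add: sets_circle_iff)
    from measurable_sets[OF comp[OF iA(1)] this]
    show "{x \<in> space (sigma (space (Pi\<^sub>M {1..n} (\<lambda>_. circle_measure))) (closed_rectangles n)). x i \<in> A}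
        \<in> sets (sigma (space (Pi\<^sub>M {1..n} (\<lambda>_. circle_measure))) (closed_rectangles n))"
      by (simp add: torus_def vimage_def Int_def conj_commute)
  qed
  then show "sets (torus n) \<subseteq> sigma_sets (space (torus n)) (closed_rectangles n)"
    using sub by simp
qed

text \<open>The sets over which f has integral 0 form a Dynkin system that contains the closed
  rectangles, hence all measurable sets; a density with vanishing set integrals is null.\<close>

lemma fourier_coeff_zero_AE:
  assumes f: "bounded_measurable (torus n) f" and z: "\<And>m. fourier_coeff n f m = 0"
  shows "AE x in torus n. f x = 0"
proof (rule sigma_finite_measure.density_zero[OF prob_space_imp_sigma_finite[OF prob_space_torus]])
  have int: "integrable (torus n) f" by (rule integrable_torus[OF f])
  then show "integrable (torus n) f" .
  have si: "set_integrable (torus n) X f" if "X \<in> sets (torus n)" for X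
    using int that unfolding set_integrable_def by (intro integrable_mult_indicator) auto
  \<comment> \<open>The coefficient of the trivial character is the total integral; its vanishing
    handles complements.\<close>
  have tot: "set_lebesgue_integral (torus n) (space (torus n)) f = 0"
    using z[of "\<lambda>_. 0"] by (simp add: set_integral_space int fourier_coeff_char torus_char_def)
  fix X assume X: "X \<in> sets (torus n)"
  have "Int_stable (closed_rectangles n)"
  proof (rule Int_stableI)
    fix a b assume "a \<in> closed_rectangles n" "b \<in> closed_rectangles n"
    then obtain A B where AB: "\<forall>i. closed (A i)" "\<forall>i. closed (B i)"
      "a = space (torus n) \<inter> {x. \<forall>i\<in>{1..n}. x i \<in> A i}" "b = space (torus n) \<inter> {x. \<forall>i\<in>{1..n}. x i \<in> B i}"
      unfolding closed_rectangles_def by (elim CollectE exE conjE)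
    then have "a \<inter> b = space (torus n) \<inter> {x. \<forall>i\<in>{1..n}. x i \<in> A i \<inter> B i}"
      by (simp only: set_eq_iff Int_iff mem_Collect_eq ball_conj_distrib) blast
    moreover have "\<forall>i. closed (A i \<inter> B i)" using AB(1,2) by (simp add: closed_Int)
    ultimately show "a \<inter> b \<in> closed_rectangles n"
      unfolding closed_rectangles_def by (intro CollectI exI[of _ "\<lambda>i. A i \<inter> B i"] conjI)
  qed
  moreover have "closed_rectangles n \<subseteq> Pow (space (torus n))" by (auto simp: closed_rectangles_def)
  moreover have "X \<in> sigma_sets (space (torus n)) (closed_rectangles n)" using X sets_torus by simp
  ultimately show "set_lebesgue_integral (torus n) X f = 0"
  proof (induction rule: sigma_sets_induct_disjoint)
    case (basic X)
    then obtain A where A: "\<And>i. closed (A i)" "X = space (torus n) \<inter> {x. \<forall>i\<in>{1..n}. x i \<in> A i}"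
      unfolding closed_rectangles_def by blast
    have "set_lebesgue_integral (torus n) X f = (LINT x|torus n. f x * (\<Prod>i\<in>{1..n}. indicator (A i) (x i)))"
      unfolding set_lebesgue_integral_def
    proof (rule Bochner_Integration.integral_cong)
      fix x assume x: "x \<in> space (torus n)"
      have "(\<Prod>i\<in>{1..n}. indicator (A i) (x i)) = (if x \<in> X then 1 else 0 :: complex)"
      proof (cases "x \<in> X")
        case True
        then show ?thesis using A(2) by (auto intro!: prod.neutral)
      next
        case False
        then obtain i where i: "i \<in> {1..n}" "x i \<notin> A i" using A(2) x by blast
        then have "(\<Prod>i\<in>{1..n}. indicator (A i) (x i)) = (0::complex)"
          by (intro prod_zero bexI[of _ i]) simp_all
        then show ?thesis using False by simp
      qed
      then show "indicat_real X x *\<^sub>R f x = f x * (\<Prod>i\<in>{1..n}. indicator (A i) (x i))" by simp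
    qed simp
    then show ?case using integral_closed_rectangle_eq_0[OF f z A(1)] by simp
  next
    case empty
    then show ?case by (simp add: set_lebesgue_integral_def)
  next
    case (compl Y)
    then have Y: "Y \<in> sets (torus n)" using sets_torus by simp
    have "set_lebesgue_integral (torus n) (Y \<union> (space (torus n) - Y)) f
        = set_lebesgue_integral (torus n) Y f + set_lebesgue_integral (torus n) (space (torus n) - Y) f"
      by (rule set_integral_Un) (use si Y in auto)
    moreover have "Y \<union> (space (torus n) - Y) = space (torus n)" using sets.sets_into_space[OF Y] by auto
    ultimately show ?case using tot compl by simp
  next
    case (union Y)
    then have Y: "\<And>i. Y i \<in> sets (torus n)" using sets_torus by auto
    have "set_lebesgue_integral (torus n) (\<Union>i. Y i) f = (\<Sum>i. set_lebesgue_integral (torus n) (Y i) f)"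
      by (rule lebesgue_integral_countable_add)
         (use Y si union.hyps in \<open>auto simp: disjoint_family_on_def\<close>)
    then show ?case using union by simp
  qed
qed

lemma fourier_coeff_eq_AE:
  assumes f: "bounded_measurable (torus n) f" and g: "bounded_measurable (torus n) g"
    and eq: "\<And>m. fourier_coeff n f m = fourier_coeff n g m"
  shows "AE x in torus n. f x = g x"
proof -
  have "fourier_coeff n (\<lambda>x. f x - g x) m = 0" for m
  proof -
    have "fourier_coeff n (\<lambda>x. f x - g x) m = fourier_coeff n f m - fourier_coeff n g m"
      unfolding fourier_coeff_char left_diff_distrib
      by (intro Bochner_Integration.integral_diff integrable_torus bounded_measurable_intros f g)
    then show ?thesis using eq by simp
  qed
  from fourier_coeff_zero_AE[OF bounded_measurable_diff[OF f g] this] show ?thesis by simp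
qed

section \<open>Slices\<close>

lemma bounded_measurable_twist:
  assumes "bounded_measurable (torus (Suc d)) f" "x \<in> space (torus d)"
  shows "bounded_measurable circle_measure (\<lambda>z. f (twist d (z, x)))"
proof -
  obtain B where "f \<in> borel_measurable (torus (Suc d))" "\<And>y. y \<in> space (torus (Suc d)) \<Longrightarrow> norm (f y) \<le> B"
    using assms(1) by (metis bounded_measurableE)
  then show ?thesis
    using twist_in_space[OF _ assms(2)] measurable_compose[OF measurable_twist_fst[OF assms(2)]]
    by (intro bounded_measurableI[of _ _ B]) auto
qed

lemma bounded_measurable_powi: "bounded_measurable circle_measure (\<lambda>z. z powi k)"
  by (rule bounded_measurableI[of _ _ 1])
     (auto simp: norm_power_int intro: borel_measurable_power_int borel_measurable_circle)

lemma integrable_circle: "bounded_measurable circle_measure f \<Longrightarrow> integrable circle_measure f"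
  by (rule bounded_measurable_integrable[OF prob_space_circle])

text \<open>An explicit representative of the k-th slice: the k-th Fourier coefficient in z of f(z,
  x_1 z, ..., x_d z).\<close>

definition fibre_coeff :: "nat \<Rightarrow> ((nat \<Rightarrow> complex) \<Rightarrow> complex) \<Rightarrow> int \<Rightarrow> (nat \<Rightarrow> complex) \<Rightarrow> complex" where
  "fibre_coeff d f k x = (LINT z|circle_measure. f (twist d (z, x)) * z powi (- k))"

lemma borel_measurable_fibre_coeff:
  assumes "f \<in> borel_measurable (torus (Suc d))"
  shows "fibre_coeff d f k \<in> borel_measurable (torus d)"
  unfolding fibre_coeff_def[abs_def]
  by (rule borel_measurable_integral_twist[OF assms]) (intro borel_measurable_power_int borel_measurable_circle)

lemma bounded_measurable_fibre_coeff:
  assumes "bounded_measurable (torus (Suc d)) f"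
  shows "bounded_measurable (torus d) (fibre_coeff d f k)"
proof -
  obtain B where B: "B \<ge> 0" "f \<in> borel_measurable (torus (Suc d))" "\<And>y. y \<in> space (torus (Suc d)) \<Longrightarrow> norm (f y) \<le> B"
    using assms by (metis bounded_measurableE)
  show ?thesis
  proof (rule bounded_measurableI[of _ _ B])
    show "fibre_coeff d f k \<in> borel_measurable (torus d)" by (rule borel_measurable_fibre_coeff[OF B(2)])
    fix x assume x: "x \<in> space (torus d)"
    show "norm (fibre_coeff d f k x) \<le> B"
      unfolding fibre_coeff_def
      by (rule norm_integral_le_prob[OF prob_space_circle])
         (use B twist_in_space[OF _ x] in \<open>auto simp: norm_mult norm_power_int\<close>)
  qed
qed

lemma sum_split_first:
  fixes g :: "nat \<Rightarrow> 'a::comm_monoid_add"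
  shows "(\<Sum>i\<in>{1..Suc d}. g i) = (\<Sum>i\<in>{1..d}. g (Suc i)) + g 1"
  by (induction d) (simp_all add: add_ac)

lemma prod_powi_exponent_sum:
  "finite I \<Longrightarrow> z \<noteq> (0::complex) \<Longrightarrow> (\<Prod>i\<in>I. z powi m i) = z powi (\<Sum>i\<in>I. m i)"
  by (induction I rule: finite_induct) (simp_all add: power_int_add)

text \<open>Every coordinate contributes one factor z with its own exponent, so the total degree
  appears as the power of z. This is the reason why the grading by m_1 + ... + m_n is visible in one
  variable.\<close>

lemma torus_char_twist:
  assumes z: "z \<in> sphere 0 1"
  shows "torus_char (Suc d) m (twist d (z, x)) = torus_char d (\<lambda>i. m (Suc i)) x * z powi (\<Sum>i\<in>{1..Suc d}. m i)"
proof -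
  have nz: "z \<noteq> 0" using z by auto
  have "torus_char (Suc d) m (twist d (z, x)) = (\<Prod>i\<in>{1..d}. (x i * z) powi m (Suc i)) * z powi m 1"
    unfolding torus_char_def prod_split_first
    by (intro arg_cong2[where f = "(*)"] prod.cong) (auto simp: twist_def)
  also have "(\<Prod>i\<in>{1..d}. (x i * z) powi m (Suc i)) = torus_char d (\<lambda>i. m (Suc i)) x * (\<Prod>i\<in>{1..d}. z powi m (Suc i))"
    by (simp add: torus_char_def power_int_mult_distrib prod.distrib)
  also have "(\<Prod>i\<in>{1..d}. z powi m (Suc i)) = z powi (\<Sum>i\<in>{1..d}. m (Suc i))"
    by (rule prod_powi_exponent_sum[OF _ nz]) simp
  finally show ?thesis
    unfolding sum_split_first using nz by (simp add: power_int_add)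
qed

lemma sum_slice_index: "(\<Sum>i\<in>{1..Suc d}. slice_index (Suc d) k p i) = k"
proof -
  have "(\<Sum>i\<in>{1..d}. slice_index (Suc d) k p (Suc i)) = (\<Sum>i\<in>{1..d}. p i)"
    by (rule sum.cong) (auto simp: slice_index_def)
  then show ?thesis unfolding sum_split_first by (simp add: slice_index_def)
qed

text \<open>The character belonging to the slice index has total degree k and splits on fibres into
  z^k and the character of p, so Fubini gives the property by which \<open>slice\<close> is
  chosen.\<close>

lemma fourier_coeff_fibre_coeff:
  assumes f: "bounded_measurable (torus (Suc d)) f"
  shows "fourier_coeff d (fibre_coeff d f k) p = fourier_coeff (Suc d) f (slice_index (Suc d) k p)"
proof -
  let ?m = "slice_index (Suc d) k p"
  let ?c = "torus_char (Suc d) (\<lambda>i. - ?m i)"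
  obtain B where B: "(\<lambda>y. f y * ?c y) \<in> borel_measurable (torus (Suc d))"
     "\<And>y. y \<in> space (torus (Suc d)) \<Longrightarrow> norm (f y * ?c y) \<le> B"
    using bounded_measurable_mult[OF f bounded_measurable_torus_char[of "Suc d" "\<lambda>i. - ?m i"]] by (metis bounded_measurableE)
  have "fourier_coeff (Suc d) f ?m = (LINT x|torus d. LINT z|circle_measure. f (twist d (z, x)) * ?c (twist d (z, x)))"
    unfolding fourier_coeff_char by (rule integral_torus_Suc[OF B])
  also have "\<dots> = (LINT x|torus d. fibre_coeff d f k x * torus_char d (\<lambda>i. - p i) x)"
  proof (rule Bochner_Integration.integral_cong)
    fix x assume "x \<in> space (torus d)"
    have "torus_char d (\<lambda>i. - ?m (Suc i)) x = torus_char d (\<lambda>i. - p i) x"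
      unfolding torus_char_def by (rule prod.cong) (auto simp: slice_index_def)
    then have "?c (twist d (z, x)) = z powi (-k) * torus_char d (\<lambda>i. - p i) x" if "z \<in> sphere 0 1" for z
      using torus_char_twist[OF that, of d "\<lambda>i. - ?m i" x]
      unfolding sum_negf sum_slice_index by (simp only: mult.commute)
    then have "(LINT z|circle_measure. f (twist d (z, x)) * ?c (twist d (z, x)))
        = (LINT z|circle_measure. (f (twist d (z, x)) * z powi (-k)) * torus_char d (\<lambda>i. - p i) x)"
      by (intro Bochner_Integration.integral_cong) (auto simp: mult_ac)
    then show "(LINT z|circle_measure. f (twist d (z, x)) * ?c (twist d (z, x))) = fibre_coeff d f k x * torus_char d (\<lambda>i. - p i) x"
      by (simp add: fibre_coeff_def)
  qed simp
  finally show ?thesis unfolding fourier_coeff_char by simp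
qed

section \<open>Representatives of essentially bounded functions and of slices\<close>

lemma Linf_norm_le_iff:
  assumes "f \<in> borel_measurable (torus d)"
  shows "Linf_norm d f \<le> ennreal L \<longleftrightarrow> (AE x in torus d. ennreal (norm (f x)) \<le> ennreal L)"
proof
  assume L: "Linf_norm d f \<le> ennreal L"
  have "AE x in torus d. ennreal (norm (f x)) \<le> Linf_norm d f" unfolding Linf_norm_def by (rule esssup_AE)
  then show "AE x in torus d. ennreal (norm (f x)) \<le> ennreal L" by eventually_elim (use L in auto)
next
  assume "AE x in torus d. ennreal (norm (f x)) \<le> ennreal L"
  with assms show "Linf_norm d f \<le> ennreal L" unfolding Linf_norm_def by (intro esssup_I) auto
qed

lemma bounded_measurable_Linf: "bounded_measurable (torus d) f \<Longrightarrow> f \<in> Linf d"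
proof -
  assume "bounded_measurable (torus d) f"
  then obtain B where B: "B \<ge> 0" "f \<in> borel_measurable (torus d)" "\<And>x. x \<in> space (torus d) \<Longrightarrow> norm (f x) \<le> B"
    by (metis bounded_measurableE)
  have "Linf_norm d f \<le> ennreal B"
    unfolding Linf_norm_le_iff[OF B(2)] by (rule AE_I2) (use B in \<open>auto intro: ennreal_leI\<close>)
  also have "\<dots> < \<infinity>" by simp
  finally show ?thesis using B by (simp add: Linf_def)
qed

text \<open>Setting the function to 0 where it exceeds its essential bound gives a version that
  obeys the bound everywhere.\<close>

lemma Linf_truncate:
  assumes "f \<in> Linf d"
  obtains g where "g \<in> borel_measurable (torus d)" "\<And>x. norm (g x) \<le> enn2real (Linf_norm d f)"
    "AE x in torus d. f x = g x"
proof -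
  let ?L = "enn2real (Linf_norm d f)"
  have f: "f \<in> borel_measurable (torus d)" and L: "Linf_norm d f = ennreal ?L"
    using assms by (auto simp: Linf_def less_top)
  have ae: "AE x in torus d. norm (f x) \<le> ?L"
  proof -
    have "AE x in torus d. ennreal (norm (f x)) \<le> ennreal ?L"
      by (rule Linf_norm_le_iff[OF f, THEN iffD1]) (simp only: L[symmetric] order_refl)
    then show ?thesis by eventually_elim (simp add: ennreal_le_iff)
  qed
  show ?thesis
  proof
    show "(\<lambda>x. if norm (f x) \<le> ?L then f x else 0) \<in> borel_measurable (torus d)"
      by (intro measurable_If borel_measurable_le measurable_compose[OF f borel_measurable_norm] borel_measurable_const f)
    show "norm (if norm (f x) \<le> ?L then f x else 0) \<le> ?L" for x by auto
    show "AE x in torus d. f x = (if norm (f x) \<le> ?L then f x else 0)" using ae by eventually_elim auto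
  qed
qed

lemma fourier_coeff_cong_AE:
  assumes "f \<in> borel_measurable (torus d)" "g \<in> borel_measurable (torus d)" "AE x in torus d. f x = g x"
  shows "fourier_coeff d f m = fourier_coeff d g m"
  unfolding fourier_coeff_char
  using assms torus_char_measurable by (intro integral_cong_AE borel_measurable_times) auto

text \<open>The function g has to share with \<phi> only the coefficients of total degree k. So one
  and the same g may represent all slices of negative degree although it differs from \<phi>
  elsewhere. The existence of g also ensures that the choice in \<open>slice\<close> is not
  vacuous.\<close>

lemma slice_AE:
  assumes g: "bounded_measurable (torus (Suc d)) g"
    and eq: "\<And>m. (\<Sum>i\<in>{1..Suc d}. m i) = k \<Longrightarrow> fourier_coeff (Suc d) \<phi> m = fourier_coeff (Suc d) g m"
  shows "slice (Suc d) \<phi> k \<in> Linf d" "AE x in torus d. slice (Suc d) \<phi> k x = fibre_coeff d g k x"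
proof -
  have "fibre_coeff d g k \<in> Linf d \<and>
     (\<forall>p. fourier_coeff d (fibre_coeff d g k) p = fourier_coeff (Suc d) \<phi> (slice_index (Suc d) k p))"
    using bounded_measurable_Linf[OF bounded_measurable_fibre_coeff[OF g]] fourier_coeff_fibre_coeff[OF g]
      eq[OF sum_slice_index] by simp
  then have ex: "\<exists>\<psi>. \<psi> \<in> Linf (Suc d - 1) \<and>
     (\<forall>p. fourier_coeff (Suc d - 1) \<psi> p = fourier_coeff (Suc d) \<phi> (slice_index (Suc d) k p))"
    by auto
  have s: "slice (Suc d) \<phi> k \<in> Linf d"
    "\<And>p. fourier_coeff d (slice (Suc d) \<phi> k) p = fourier_coeff (Suc d) \<phi> (slice_index (Suc d) k p)"
    using someI_ex[OF ex] by (auto simp: slice_def)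
  show "slice (Suc d) \<phi> k \<in> Linf d" by (rule s)
  obtain h where h: "h \<in> borel_measurable (torus d)" "\<And>x. norm (h x) \<le> enn2real (Linf_norm d (slice (Suc d) \<phi> k))"
    "AE x in torus d. slice (Suc d) \<phi> k x = h x" using Linf_truncate[OF s(1)] by blast
  have bh: "bounded_measurable (torus d) h" using h by (intro bounded_measurableI) auto
  have "fourier_coeff d h p = fourier_coeff d (fibre_coeff d g k) p" for p
    using fourier_coeff_cong_AE[OF _ h(1,3)] s eq[OF sum_slice_index] fourier_coeff_fibre_coeff[OF g]
    by (simp add: Linf_def)
  from fourier_coeff_eq_AE[OF bh bounded_measurable_fibre_coeff[OF g] this] h(3)
  show "AE x in torus d. slice (Suc d) \<phi> k x = fibre_coeff d g k x" by eventually_elim simp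
qed

section \<open>The norm of the Hankel operator is at most the distance\<close>

lemma circle_parseval:
  fixes e :: "nat \<Rightarrow> int" and x :: "nat \<Rightarrow> complex"
  assumes e: "inj_on e I" and fin: "finite I"
  shows "(LINT z|circle_measure. (\<Sum>j\<in>I. x j * z powi e j) * cnj (\<Sum>j\<in>I. x j * z powi e j)) = (\<Sum>j\<in>I. x j * cnj (x j))"
proof -
  have "(LINT z|circle_measure. (\<Sum>j\<in>I. x j * z powi e j) * cnj (\<Sum>j\<in>I. x j * z powi e j))
      = (LINT z|circle_measure. (\<Sum>j\<in>I. \<Sum>k\<in>I. (x j * cnj (x k)) * z powi (e j - e k)))"
  proof (rule Bochner_Integration.integral_cong)
    fix z assume "z \<in> space circle_measure"
    then have z: "norm z = 1" "z \<noteq> 0" by auto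
    have "cnj z = inverse z"
      using z by (metis complex_norm_square left_inverse mult.commute mult_cancel_right of_real_1 power_one)
    then have c: "cnj z powi k = z powi (- k)" for k
      by (simp add: power_int_minus power_int_inverse)
    show "(\<Sum>j\<in>I. x j * z powi e j) * cnj (\<Sum>j\<in>I. x j * z powi e j) = (\<Sum>j\<in>I. \<Sum>k\<in>I. (x j * cnj (x k)) * z powi (e j - e k))"
      using z by (simp add: sum_product c power_int_diff power_int_minus field_simps)
  qed simp
  also have "\<dots> = (\<Sum>j\<in>I. \<Sum>k\<in>I. (x j * cnj (x k)) * (LINT z|circle_measure. z powi (e j - e k)))"
    by (simp add: Bochner_Integration.integral_sum integrable_circle bounded_measurable_powi
       bounded_measurable_mult bounded_measurable_const bounded_measurable_sum)
  also have "\<dots> = (\<Sum>j\<in>I. \<Sum>k\<in>I. if k = j then x j * cnj (x j) else 0)"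
    using e by (intro sum.cong) (auto simp: integral_circle_powi inj_on_def)
  also have "\<dots> = (\<Sum>j\<in>I. x j * cnj (x j))" using fin by simp
  finally show ?thesis .
qed

lemma circle_parseval_norm:
  fixes e :: "nat \<Rightarrow> int" and x :: "nat \<Rightarrow> complex"
  assumes "inj_on e I" "finite I"
  shows "(LINT z|circle_measure. (norm (\<Sum>j\<in>I. x j * z powi e j))\<^sup>2) = (\<Sum>j\<in>I. (norm (x j))\<^sup>2)"
proof -
  have "complex_of_real (LINT z|circle_measure. (norm (\<Sum>j\<in>I. x j * z powi e j))\<^sup>2)
     = (LINT z|circle_measure. complex_of_real ((norm (\<Sum>j\<in>I. x j * z powi e j))\<^sup>2))"
    by (rule integral_complex_of_real[symmetric])
  also have "\<dots> = complex_of_real (\<Sum>j\<in>I. (norm (x j))\<^sup>2)"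
    unfolding of_real_sum complex_norm_square by (rule circle_parseval[OF assms])
  finally show ?thesis by (simp only: of_real_eq_iff)
qed

lemma circle_bessel:
  assumes u: "bounded_measurable circle_measure u"
  shows "(\<Sum>i<N. (norm (LINT z|circle_measure. u z * z powi (int i)))\<^sup>2) \<le> (LINT z|circle_measure. (norm (u z))\<^sup>2)"
proof -
  define c where "c i = (LINT z|circle_measure. u z * z powi (int i))" for i
  \<comment> \<open>The orthogonal projection of u onto the span of z^0, z^(-1), ..., z^(1-N):
    pairing with z^i picks the coefficient of index -i.\<close>
  define p where "p z = (\<Sum>i<N. c i * z powi (- int i))" for z
  have bp: "bounded_measurable circle_measure p"
    unfolding p_def[abs_def] by (intro bounded_measurable_intros bounded_measurable_powi)
  define S where "S = (\<Sum>i<N. c i * cnj (c i))"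
  have pp: "(LINT z|circle_measure. p z * cnj (p z)) = S"
    unfolding p_def S_def by (rule circle_parseval) (auto simp: inj_on_def)
  have up: "(LINT z|circle_measure. u z * cnj (p z)) = S"
  proof -
    have "(LINT z|circle_measure. u z * cnj (p z)) = (LINT z|circle_measure. (\<Sum>i<N. cnj (c i) * (u z * z powi (int i))))"
    proof (rule Bochner_Integration.integral_cong)
      fix z assume "z \<in> space circle_measure"
      then have z: "norm z = 1" "z \<noteq> 0" by auto
      have "cnj z = inverse z" using z by (metis complex_norm_square left_inverse mult.commute mult_cancel_right of_real_1 power_one)
      then have "cnj (z powi (- int i)) = z powi int i" for i
        by (simp add: power_int_minus power_inverse)
      then show "u z * cnj (p z) = (\<Sum>i<N. cnj (c i) * (u z * z powi (int i)))"
        by (simp add: p_def sum_distrib_left mult_ac)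
    qed simp
    also have "\<dots> = (\<Sum>i<N. LINT z|circle_measure. cnj (c i) * (u z * z powi (int i)))"
      by (intro Bochner_Integration.integral_sum integrable_circle bounded_measurable_intros bounded_measurable_powi u)
    also have "\<dots> = S" by (simp add: S_def c_def mult.commute)
    finally show ?thesis .
  qed
  have cS: "cnj S = S" by (simp add: S_def mult.commute)
  have pu: "(LINT z|circle_measure. p z * cnj (u z)) = S"
  proof -
    have "(LINT z|circle_measure. p z * cnj (u z)) = (LINT z|circle_measure. cnj (u z * cnj (p z)))" by (simp add: mult.commute)
    also have "\<dots> = cnj S" unfolding up[symmetric] by (rule Bochner_Integration.integral_cnj)
    finally show ?thesis using cS by simp
  qed
  have "complex_of_real (LINT z|circle_measure. (norm (u z - p z))\<^sup>2) = (LINT z|circle_measure. (u z - p z) * cnj (u z - p z))"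
    by (subst integral_complex_of_real[symmetric]) (simp only: complex_norm_square)
  also have "\<dots> = (LINT z|circle_measure. ((u z * cnj (u z) - u z * cnj (p z)) - p z * cnj (u z)) + p z * cnj (p z))"
    by (simp add: algebra_simps)
  also have "\<dots> = (LINT z|circle_measure. u z * cnj (u z)) - S - S + S"
    unfolding up[symmetric]
    by (simp add: Bochner_Integration.integral_add Bochner_Integration.integral_diff integrable_circle
        bounded_measurable_intros bounded_measurable_powi u bp up pp pu)
  also have "(LINT z|circle_measure. u z * cnj (u z)) = complex_of_real (LINT z|circle_measure. (norm (u z))\<^sup>2)"
    by (subst integral_complex_of_real[symmetric]) (simp only: complex_norm_square)
  also have "S = complex_of_real (\<Sum>i<N. (norm (c i))\<^sup>2)" by (simp only: S_def of_real_sum complex_norm_square)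
  finally have "complex_of_real (LINT z|circle_measure. (norm (u z - p z))\<^sup>2)
      = complex_of_real ((LINT z|circle_measure. (norm (u z))\<^sup>2) - (\<Sum>i<N. (norm (c i))\<^sup>2))"
    by (simp only: of_real_diff diff_add_cancel)
  then have "(LINT z|circle_measure. (norm (u z - p z))\<^sup>2) = (LINT z|circle_measure. (norm (u z))\<^sup>2) - (\<Sum>i<N. (norm (c i))\<^sup>2)"
    by (simp only: of_real_eq_iff)
  moreover have "(LINT z|circle_measure. (norm (u z - p z))\<^sup>2) \<ge> 0" by simp
  ultimately show ?thesis unfolding c_def by linarith
qed

text \<open>The i-th row applied to x is the Fourier coefficient of index -i of u p with p = x_0 z +
  x_1 z^2 + ...; the exponents start at 1 because the upper left entry of the matrix is the
  coefficient of index -1. Bessel's inequality for u p, the bound |u| \<le> L and Parseval's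
  identity for p give the estimate.\<close>

lemma circle_hankel_finite:
  assumes u: "u \<in> borel_measurable circle_measure" and L: "\<And>z. z \<in> space circle_measure \<Longrightarrow> norm (u z) \<le> L" "L \<ge> 0"
  shows "(\<Sum>i<N. (norm (\<Sum>j<J. (LINT z|circle_measure. u z * z powi (int i + int j + 1)) * x j))\<^sup>2) \<le> L\<^sup>2 * (\<Sum>j<J. (norm (x j))\<^sup>2)"
proof -
  have bu: "bounded_measurable circle_measure u" using u L(1) by (rule bounded_measurableI)
  define p where "p z = (\<Sum>j<J. x j * z powi (int j + 1))" for z
  have bp: "bounded_measurable circle_measure p"
    unfolding p_def[abs_def] by (intro bounded_measurable_intros bounded_measurable_powi)
  have "(LINT z|circle_measure. (u z * p z) * z powi int i) = (\<Sum>j<J. (LINT z|circle_measure. u z * z powi (int i + int j + 1)) * x j)" for i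
  proof -
    have "(LINT z|circle_measure. (u z * p z) * z powi int i)
        = (LINT z|circle_measure. (\<Sum>j<J. (u z * z powi (int i + int j + 1)) * x j))"
    proof (rule Bochner_Integration.integral_cong)
      fix z assume "z \<in> space circle_measure"
      then have "z \<noteq> 0" by auto
      then have "z powi (int i + int j + 1) = z powi (int j + 1) * z powi int i" for j
        by (subst power_int_add[symmetric]) (auto simp: ac_simps)
      then show "(u z * p z) * z powi int i = (\<Sum>j<J. (u z * z powi (int i + int j + 1)) * x j)"
        by (simp add: p_def sum_distrib_left sum_distrib_right mult_ac)
    qed simp
    also have "\<dots> = (\<Sum>j<J. LINT z|circle_measure. (u z * z powi (int i + int j + 1)) * x j)"
      by (intro Bochner_Integration.integral_sum integrable_circle bounded_measurable_intros bounded_measurable_powi bu)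
    finally show ?thesis by simp
  qed
  then have "(\<Sum>i<N. (norm (\<Sum>j<J. (LINT z|circle_measure. u z * z powi (int i + int j + 1)) * x j))\<^sup>2)
     \<le> (LINT z|circle_measure. (norm (u z * p z))\<^sup>2)"
    using circle_bessel[OF bounded_measurable_mult[OF bu bp], of N] by simp
  also have "\<dots> \<le> (LINT z|circle_measure. L\<^sup>2 * (norm (p z))\<^sup>2)"
  proof (rule integral_mono)
    note sq = integrable_norm_sq[OF prob_space_circle]
    show "integrable circle_measure (\<lambda>z. (norm (u z * p z))\<^sup>2)" by (rule sq[OF bounded_measurable_mult[OF bu bp]])
    show "integrable circle_measure (\<lambda>z. L\<^sup>2 * (norm (p z))\<^sup>2)" using sq[OF bp] by simp
    show "(norm (u z * p z))\<^sup>2 \<le> L\<^sup>2 * (norm (p z))\<^sup>2" if "z \<in> space circle_measure" for z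
      using L(1)[OF that] by (simp add: norm_mult power_mult_distrib mult_right_mono power_mono)
  qed
  also have "\<dots> = L\<^sup>2 * (\<Sum>j<J. (norm (x j))\<^sup>2)"
    using circle_parseval_norm[of "\<lambda>j. int j + 1" "{..<J}" x] by (simp add: p_def inj_on_def)
  finally show ?thesis .
qed

text \<open>Only the number of columns tends to infinity. Each row is square-summable by Bessel's
  inequality, so its product with x is absolutely summable and \<open>suminf\<close> is a genuine
  limit.\<close>

lemma circle_hankel:
  assumes u: "u \<in> borel_measurable circle_measure" and L: "\<And>z. z \<in> space circle_measure \<Longrightarrow> norm (u z) \<le> L" "L \<ge> 0"
    and x: "summable (\<lambda>j. (norm (x j))\<^sup>2)"
  shows "(\<Sum>i<N. (norm (\<Sum>j. (LINT z|circle_measure. u z * z powi (int i + int j + 1)) * x j))\<^sup>2) \<le> L\<^sup>2 * (\<Sum>j. (norm (x j))\<^sup>2)"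
proof -
  define a where "a k = (LINT z|circle_measure. u z * z powi (int k))" for k
  have a: "(LINT z|circle_measure. u z * z powi (int i + int j + 1)) = a (i + j + 1)" for i j
    by (simp add: a_def ac_simps)
  have bu: "bounded_measurable circle_measure u" using u L(1) by (rule bounded_measurableI)
  have "summable (\<lambda>k. (norm (a k))\<^sup>2)"
    by (rule summableI_nonneg_bounded[OF _ circle_bessel[OF bu, folded a_def]]) simp
  then have sa: "summable (\<lambda>j. (norm (a (i + j + 1)))\<^sup>2)" for i
    using summable_ignore_initial_segment[of "\<lambda>k. (norm (a k))\<^sup>2" "i + 1"] by (simp add: ac_simps)
  have sum: "summable (\<lambda>j. a (i + j + 1) * x j)" for i
  proof (rule summable_comparison_test)
    show "summable (\<lambda>j. (norm (a (i + j + 1)))\<^sup>2 + (norm (x j))\<^sup>2)" by (rule summable_add[OF sa x])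
    have "norm (a (i + j + 1) * x j) \<le> (norm (a (i + j + 1)))\<^sup>2 + (norm (x j))\<^sup>2" for j
    proof -
      have "2 * (norm (a (i + j + 1)) * norm (x j)) \<le> (norm (a (i + j + 1)))\<^sup>2 + (norm (x j))\<^sup>2"
        using sum_squares_bound[of "norm (a (i + j + 1))" "norm (x j)"] by (simp add: mult.assoc)
      moreover have "norm (a (i + j + 1)) * norm (x j) \<ge> 0" by simp
      ultimately show ?thesis unfolding norm_mult by linarith
    qed
    then show "\<exists>N. \<forall>n\<ge>N. norm (a (i + n + 1) * x n) \<le> (norm (a (i + n + 1)))\<^sup>2 + (norm (x n))\<^sup>2" by blast
  qed
  have lim: "(\<lambda>J. \<Sum>i<N. (norm (\<Sum>j<J. a (i + j + 1) * x j))\<^sup>2) \<longlonglongrightarrow> (\<Sum>i<N. (norm (\<Sum>j. a (i + j + 1) * x j))\<^sup>2)"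
    by (intro tendsto_sum tendsto_power tendsto_norm summable_LIMSEQ sum)
  show ?thesis unfolding a
  proof (rule LIMSEQ_le_const2[OF lim], intro exI[of _ 0] allI impI)
    fix J
    have "(\<Sum>i<N. (norm (\<Sum>j<J. a (i + j + 1) * x j))\<^sup>2) \<le> L\<^sup>2 * (\<Sum>j<J. (norm (x j))\<^sup>2)"
      using circle_hankel_finite[OF u L, where N = N and J = J and x = x] unfolding a .
    also have "\<dots> \<le> L\<^sup>2 * (\<Sum>j. (norm (x j))\<^sup>2)"
      by (intro mult_left_mono sum_le_suminf x) auto
    finally show "(\<Sum>i<N. (norm (\<Sum>j<J. a (i + j + 1) * x j))\<^sup>2) \<le> L\<^sup>2 * (\<Sum>j. (norm (x j))\<^sup>2)" .
  qed
qed

section \<open>From scalar Hankel matrices to the block operator\<close>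

lemma seq_norm_le_iff:
  assumes "c \<ge> 0"
  shows "seq_norm d F \<le> ennreal c \<longleftrightarrow> seq_norm2 d F \<le> ennreal (c\<^sup>2)"
proof (cases "seq_norm2 d F = \<infinity>")
  case True
  then show ?thesis by (simp add: seq_norm_def top_unique)
next
  case False
  define r where "r = enn2real (seq_norm2 d F)"
  have r: "seq_norm2 d F = ennreal r" "r \<ge> 0" using False by (auto simp: r_def less_top)
  have "sqrt r \<le> c \<longleftrightarrow> r \<le> c\<^sup>2"
    using assms real_sqrt_le_iff[of r "c\<^sup>2"] by simp
  then show ?thesis using False assms r by (simp add: seq_norm_def ennreal_le_iff)
qed

lemma seq_norm2_eq_nn_integral:
  assumes "\<And>j. F j \<in> borel_measurable (torus d)"
  shows "seq_norm2 d F = (\<integral>\<^sup>+x. (\<Sum>j. ennreal ((norm (F j x))\<^sup>2)) \<partial>torus d)"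
  unfolding seq_norm2_def using assms by (intro nn_integral_suminf[symmetric]) measurable

text \<open>Written as \<open>lim\<close> of partial sums, the series is measurable also at points
  where it diverges.\<close>

lemma hankel_op_measurable:
  assumes "\<And>k. slice n \<phi> k \<in> borel_measurable (torus d)" "\<And>j. F j \<in> borel_measurable (torus d)"
  shows "hankel_op n \<phi> F i \<in> borel_measurable (torus d)"
  unfolding hankel_op_def mult_op_def suminf_eq_lim
  using assms by (intro borel_measurable_lim_metric borel_measurable_sum borel_measurable_times) auto

text \<open>The constant L bounds some function \<psi> whose slices of negative degree are those of
  \<phi>, and not \<phi> itself; this freedom is what brings in the distance.\<close>

lemma seq_norm2_hankel_op_le:
  assumes meas: "\<And>k. slice (Suc d) \<phi> k \<in> borel_measurable (torus d)"
    and \<psi>: "\<psi> \<in> borel_measurable (torus (Suc d))" "\<And>y. norm (\<psi> y) \<le> L" and L: "L \<ge> 0"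
    and ae: "\<And>k. k < 0 \<Longrightarrow> AE x in torus d. slice (Suc d) \<phi> k x = fibre_coeff d \<psi> k x"
    and F: "\<And>j. F j \<in> borel_measurable (torus d)" "seq_norm2 d F < \<infinity>"
  shows "seq_norm2 d (hankel_op (Suc d) \<phi> F) \<le> ennreal (L\<^sup>2) * seq_norm2 d F"
proof -
  have fin: "AE x in torus d. (\<Sum>j. ennreal ((norm (F j x))\<^sup>2)) \<noteq> \<infinity>"
    using F by (intro nn_integral_PInf_AE) (auto simp: seq_norm2_eq_nn_integral)
  \<comment> \<open>One null set has to serve for all blocks at once; countably many indices -(m +
    1) occur.\<close>
  have all: "AE x in torus d. \<forall>m::nat. slice (Suc d) \<phi> (- (int m + 1)) x = fibre_coeff d \<psi> (- (int m + 1)) x"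
    unfolding AE_all_countable using ae by simp
  have "AE x in torus d. (\<Sum>i. ennreal ((norm (hankel_op (Suc d) \<phi> F i x))\<^sup>2)) \<le> ennreal (L\<^sup>2) * (\<Sum>j. ennreal ((norm (F j x))\<^sup>2))"
    using fin all AE_space
  proof eventually_elim
    case (elim x)
    have x: "summable (\<lambda>j. (norm (F j x))\<^sup>2)"
      using elim(1) by (intro summable_suminf_not_top) auto
    have u: "(\<lambda>z. \<psi> (twist d (z, x))) \<in> borel_measurable circle_measure"
      by (rule measurable_compose[OF measurable_twist_fst[OF elim(3)] \<psi>(1)])
    have op: "hankel_op (Suc d) \<phi> F i x = (\<Sum>j. (LINT z|circle_measure. \<psi> (twist d (z, x)) * z powi (int i + int j + 1)) * F j x)" for i
    proof -
      have "slice (Suc d) \<phi> (- (int i + int j + 1)) x = (LINT z|circle_measure. \<psi> (twist d (z, x)) * z powi (int i + int j + 1))" for j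
        using elim(2)[rule_format, of "i + j"] by (simp only: fibre_coeff_def of_nat_add minus_minus)
      then show ?thesis by (simp add: hankel_op_def mult_op_def)
    qed
    have "(\<Sum>i. ennreal ((norm (hankel_op (Suc d) \<phi> F i x))\<^sup>2)) \<le> ennreal (L\<^sup>2 * (\<Sum>j. (norm (F j x))\<^sup>2))"
    proof (rule suminf_le_const)
      show "summable (\<lambda>i. ennreal ((norm (hankel_op (Suc d) \<phi> F i x))\<^sup>2))" by simp
      fix N
      show "(\<Sum>i<N. ennreal ((norm (hankel_op (Suc d) \<phi> F i x))\<^sup>2)) \<le> ennreal (L\<^sup>2 * (\<Sum>j. (norm (F j x))\<^sup>2))"
        using circle_hankel[OF u \<psi>(2) L x, of N] by (simp add: op ennreal_leI)
    qed
    also have "\<dots> = ennreal (L\<^sup>2) * (\<Sum>j. ennreal ((norm (F j x))\<^sup>2))"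
      using x by (simp add: ennreal_mult suminf_nonneg suminf_ennreal2)
    finally show ?case .
  qed
  then have "(\<integral>\<^sup>+x. (\<Sum>i. ennreal ((norm (hankel_op (Suc d) \<phi> F i x))\<^sup>2)) \<partial>torus d)
      \<le> (\<integral>\<^sup>+x. ennreal (L\<^sup>2) * (\<Sum>j. ennreal ((norm (F j x))\<^sup>2)) \<partial>torus d)"
    by (rule nn_integral_mono_AE)
  also have "\<dots> = ennreal (L\<^sup>2) * seq_norm2 d F"
    unfolding seq_norm2_eq_nn_integral[OF F(1)] using F by (intro nn_integral_cmult) measurable
  finally show ?thesis
    by (simp add: seq_norm2_eq_nn_integral hankel_op_measurable meas F)
qed

lemma Linf_integrable: "f \<in> Linf d \<Longrightarrow> integrable (torus d) f"
proof -
  assume f: "f \<in> Linf d"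
  then obtain g where g: "g \<in> borel_measurable (torus d)" "\<And>x. norm (g x) \<le> enn2real (Linf_norm d f)"
    "AE x in torus d. f x = g x" using Linf_truncate by blast
  have "integrable (torus d) g"
    by (rule integrable_torus[OF bounded_measurableI[OF g(1,2)]])
  moreover have "f \<in> borel_measurable (torus d)" using f by (simp add: Linf_def)
  ultimately show ?thesis using integrable_cong_AE[OF _ g(1,3)] by blast
qed

lemma Linf_char_integrable: "f \<in> Linf d \<Longrightarrow> integrable (torus d) (\<lambda>x. f x * torus_char d m x)"
proof (rule Bochner_Integration.integrable_bound[OF Linf_integrable])
  assume f: "f \<in> Linf d"
  then show "(\<lambda>x. f x * torus_char d m x) \<in> borel_measurable (torus d)"
    using torus_char_measurable by (intro borel_measurable_times) (auto simp: Linf_def)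
  show "AE x in torus d. norm (f x * torus_char d m x) \<le> norm (f x)"
    by (rule AE_I2) (simp add: norm_mult)
qed

text \<open>All blocks have index at most -1, where the coefficients of g vanish, so \<phi> - g has
  the same Hankel operator up to null sets.\<close>

lemma op_norm_hankel_le:
  assumes \<phi>: "\<phi> \<in> Linf (Suc d)" and g: "g \<in> H1 (Suc d)"
  shows "op_norm d (hankel_op (Suc d) \<phi>) \<le> Linf_norm (Suc d) (\<lambda>z. \<phi> z - g z)"
\<comment> \<open>Splitting off the value \<infinity>, for which the claim is trivial, makes \<phi>
  - g a member of \<open>Linf\<close> without a triangle inequality for the essential
  supremum.\<close>
proof (cases "Linf_norm (Suc d) (\<lambda>z. \<phi> z - g z) = \<infinity>")
  case False
  have gL: "g \<in> Linf (Suc d)" using g by (simp add: H1_def)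
  define L where "L = enn2real (Linf_norm (Suc d) (\<lambda>z. \<phi> z - g z))"
  have dL: "(\<lambda>z. \<phi> z - g z) \<in> Linf (Suc d)"
    using \<phi> gL False by (auto simp: Linf_def less_top)
  obtain \<psi> where \<psi>: "\<psi> \<in> borel_measurable (torus (Suc d))" "\<And>x. norm (\<psi> x) \<le> L"
    "AE x in torus (Suc d). \<phi> x - g x = \<psi> x"
    using Linf_truncate[OF dL] unfolding L_def by blast
  obtain \<phi>' where \<phi>': "\<phi>' \<in> borel_measurable (torus (Suc d))" "\<And>x. norm (\<phi>' x) \<le> enn2real (Linf_norm (Suc d) \<phi>)"
    "AE x in torus (Suc d). \<phi> x = \<phi>' x"
    using Linf_truncate[OF \<phi>] by blast
  have bm: "bounded_measurable (torus (Suc d)) \<phi>'" "bounded_measurable (torus (Suc d)) \<psi>"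
    using \<psi> \<phi>' by (auto intro: bounded_measurableI)
  have "slice (Suc d) \<phi> k \<in> Linf d" for k
    using slice_AE(1)[OF bm(1), of k \<phi>] fourier_coeff_cong_AE[OF _ \<phi>'(1,3)] \<phi> by (simp add: Linf_def)
  then have meas: "slice (Suc d) \<phi> k \<in> borel_measurable (torus d)" for k by (simp add: Linf_def)
  have ae: "AE x in torus d. slice (Suc d) \<phi> k x = fibre_coeff d \<psi> k x" if "k < 0" for k
  proof (rule slice_AE(2)[OF bm(2)])
    fix m assume m: "(\<Sum>i\<in>{1..Suc d}. m i) = k"
    have "fourier_coeff (Suc d) \<psi> m = fourier_coeff (Suc d) (\<lambda>z. \<phi> z - g z) m"
      using fourier_coeff_cong_AE[OF _ \<psi>(1,3)] dL by (simp add: Linf_def)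
    also have "\<dots> = fourier_coeff (Suc d) \<phi> m - fourier_coeff (Suc d) g m"
      unfolding fourier_coeff_char left_diff_distrib
      by (intro Bochner_Integration.integral_diff Linf_char_integrable \<phi> gL)
    also have "fourier_coeff (Suc d) g m = 0" using g m that by (simp add: H1_def)
    finally show "fourier_coeff (Suc d) \<phi> m = fourier_coeff (Suc d) \<psi> m" by simp
  qed
  have L0: "L \<ge> 0" by (simp add: L_def)
  have "op_norm d (hankel_op (Suc d) \<phi>) \<le> ennreal L"
    unfolding op_norm_def
  proof (rule SUP_least)
    fix F assume "F \<in> {F \<in> L2_tensor_l2 d. seq_norm d F \<le> 1}"
    then have F: "\<And>j. F j \<in> borel_measurable (torus d)" and F1: "seq_norm2 d F \<le> 1"
      using seq_norm_le_iff[of 1 d F] by (auto simp: L2_tensor_l2_def)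
    from F1 have fin: "seq_norm2 d F < \<infinity>" by (rule le_less_trans) simp
    have "seq_norm2 d (hankel_op (Suc d) \<phi> F) \<le> ennreal (L\<^sup>2) * seq_norm2 d F"
      by (rule seq_norm2_hankel_op_le[OF meas \<psi>(1,2) L0 ae F fin])
    also have "\<dots> \<le> ennreal (L\<^sup>2) * 1" using F1 by (rule mult_left_mono) simp
    finally show "seq_norm d (hankel_op (Suc d) \<phi> F) \<le> ennreal L"
      using seq_norm_le_iff[OF L0] by simp
  qed
  also have "ennreal L = Linf_norm (Suc d) (\<lambda>z. \<phi> z - g z)" using False by (simp add: L_def less_top)
  finally show ?thesis .
qed simp

section \<open>The functional induced by the Hankel operator\<close>

text \<open>On a fibre the polynomial becomes a Laurent polynomial in z with lowest exponent k; its
  coefficients form a block vector with finitely many nonzero entries.\<close>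

lemma trig_poly_fibre_expansion:
  assumes "f \<in> trig_poly (Suc d) {k..}"
  shows "\<exists>J a. (\<forall>j. bounded_measurable (torus d) (a j)) \<and> (\<forall>j\<ge>J. \<forall>x. a j x = 0) \<and>
    (\<forall>x\<in>space (torus d). \<forall>z\<in>sphere 0 1. f (twist d (z, x)) = (\<Sum>j<J. a j x * z powi (k + int j)))"
  using assms
proof (induction rule: trig_poly.induct)
  case zero
  show ?case by (intro exI[of _ 0] exI[of _ "\<lambda>_ _. 0"]) (auto intro: bounded_measurable_const)
next
  case (step f m c)
  then obtain J a where a: "\<And>j. bounded_measurable (torus d) (a j)" "\<And>j x. j \<ge> J \<Longrightarrow> a j x = 0"
    "\<And>x z. x \<in> space (torus d) \<Longrightarrow> z \<in> sphere 0 1 \<Longrightarrow> f (twist d (z, x)) = (\<Sum>j<J. a j x * z powi (k + int j))"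
    by blast
  \<comment> \<open>The block that receives the new character; \<open>nat\<close> loses nothing
    because the total degree is at least k.\<close>
  define s where "s = nat ((\<Sum>i\<in>{1..Suc d}. m i) - k)"
  have s: "k + int s = (\<Sum>i\<in>{1..Suc d}. m i)" using step.hyps(2) by (simp add: s_def)
  define J' where "J' = max J (Suc s)"
  define b where "b j x = a j x + (if j = s then c * torus_char d (\<lambda>i. m (Suc i)) x else 0)" for j x
  show ?case
  proof (intro exI[of _ J'] exI[of _ b] conjI allI ballI impI)
    show "bounded_measurable (torus d) (b j)" for j
      unfolding b_def[abs_def] by (cases "j = s") (auto intro!: bounded_measurable_intros a)
    show "b j x = 0" if "j \<ge> J'" for j x using that a(2)[of j x] by (auto simp: b_def J'_def)
    fix x z assume xz: "x \<in> space (torus d)" "z \<in> sphere (0::complex) 1"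
    have "(\<Sum>j<J'. b j x * z powi (k + int j))
        = (\<Sum>j<J'. a j x * z powi (k + int j)) + (\<Sum>j<J'. if j = s then c * torus_char d (\<lambda>i. m (Suc i)) x * z powi (k + int s) else 0)"
      unfolding sum.distrib[symmetric] by (rule sum.cong) (auto simp: b_def distrib_right)
    also have "(\<Sum>j<J'. a j x * z powi (k + int j)) = (\<Sum>j<J. a j x * z powi (k + int j))"
      by (rule sum.mono_neutral_right) (auto simp: J'_def a(2))
    also have "\<dots> = f (twist d (z, x))" using a(3)[OF xz] by simp
    also have "(\<Sum>j<J'. if j = s then c * torus_char d (\<lambda>i. m (Suc i)) x * z powi (k + int s) else 0)
        = c * torus_char d (\<lambda>i. m (Suc i)) x * z powi (k + int s)"
      by (simp add: J'_def)
    also have "\<dots> = c * torus_char (Suc d) m (twist d (z, x))"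
      unfolding torus_char_twist[OF xz(2)] s by simp
    finally show "f (twist d (z, x)) + c * torus_char (Suc d) m (twist d (z, x)) = (\<Sum>j<J'. b j x * z powi (k + int j))"
      by simp
  qed
next
  case (cong f g)
  then obtain J a where "\<forall>j. bounded_measurable (torus d) (a j)" "\<forall>j\<ge>J. \<forall>x. a j x = 0"
    "\<forall>x\<in>space (torus d). \<forall>z\<in>sphere 0 1. f (twist d (z, x)) = (\<Sum>j<J. a j x * z powi (k + int j))"
    by (elim exE conjE)
  then show ?case
    by (intro exI[of _ J] exI[of _ a] conjI ballI) (simp_all add: cong.hyps(2) twist_in_space)
qed

text \<open>Parseval's identity on each fibre, integrated over x: passing to the block vector is
  isometric.\<close>

lemma fibre_expansion_parseval:
  assumes f: "bounded_measurable (torus (Suc d)) f" and a: "\<And>j. bounded_measurable (torus d) (a j)"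
    and eq: "\<And>x z. x \<in> space (torus d) \<Longrightarrow> z \<in> sphere 0 1 \<Longrightarrow> f (twist d (z, x)) = (\<Sum>j<J. a j x * z powi (k + int j))"
  shows "(\<Sum>j<J. LINT x|torus d. (norm (a j x))\<^sup>2) = (LINT y|torus (Suc d). (norm (f y))\<^sup>2)"
proof -
  obtain B where B: "(\<lambda>y. f y * cnj (f y)) \<in> borel_measurable (torus (Suc d))"
     "\<And>y. y \<in> space (torus (Suc d)) \<Longrightarrow> norm (f y * cnj (f y)) \<le> B"
    by (rule bounded_measurableE[OF bounded_measurable_mult[OF f bounded_measurable_cnj[OF f]]]) (rule that, assumption+)
  have "complex_of_real (LINT y|torus (Suc d). (norm (f y))\<^sup>2) = (LINT y|torus (Suc d). f y * cnj (f y))"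
    by (subst integral_complex_of_real[symmetric]) (simp only: complex_norm_square)
  also have "\<dots> = (LINT x|torus d. LINT z|circle_measure. f (twist d (z, x)) * cnj (f (twist d (z, x))))"
    by (rule integral_torus_Suc[OF B])
  also have "\<dots> = (LINT x|torus d. (\<Sum>j<J. a j x * cnj (a j x)))"
  proof (rule Bochner_Integration.integral_cong)
    fix x assume x: "x \<in> space (torus d)"
    have "(LINT z|circle_measure. f (twist d (z, x)) * cnj (f (twist d (z, x))))
        = (LINT z|circle_measure. (\<Sum>j<J. a j x * z powi (k + int j)) * cnj (\<Sum>j<J. a j x * z powi (k + int j)))"
      using eq[OF x] by (intro Bochner_Integration.integral_cong) auto
    also have "\<dots> = (\<Sum>j<J. a j x * cnj (a j x))"
      by (rule circle_parseval) (auto simp: inj_on_def)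
    finally show "(LINT z|circle_measure. f (twist d (z, x)) * cnj (f (twist d (z, x)))) = (\<Sum>j<J. a j x * cnj (a j x))" .
  qed simp
  also have "\<dots> = (\<Sum>j<J. LINT x|torus d. a j x * cnj (a j x))"
    by (intro Bochner_Integration.integral_sum integrable_torus bounded_measurable_intros a)
  also have "\<dots> = complex_of_real (\<Sum>j<J. LINT x|torus d. (norm (a j x))\<^sup>2)"
    by (simp only: of_real_sum integral_complex_of_real[symmetric] complex_norm_square)
  finally show ?thesis by (simp only: of_real_eq_iff)
qed

lemma nn_integral_norm_sq:
  assumes "bounded_measurable (torus d) v"
  shows "(\<integral>\<^sup>+x. ennreal ((norm (v x))\<^sup>2) \<partial>torus d) = ennreal (LINT x|torus d. (norm (v x))\<^sup>2)"
  by (rule nn_integral_eq_integral[OF integrable_norm_sq[OF prob_space_torus assms]]) simp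

text \<open>Exponents 1 + j of f and i of g multiply to i + j + 1, which meets the coefficient of
  \<psi> of index -(i + j + 1), the (i, j) block. The coefficients of g enter unconjugated, so the
  pairing is bilinear.\<close>

lemma hankel_pairing_fibre:
  assumes \<psi>: "bounded_measurable (torus (Suc d)) \<psi>"
    and f: "bounded_measurable (torus (Suc d)) f" and g: "bounded_measurable (torus (Suc d)) g"
    and a: "\<And>j. bounded_measurable (torus d) (a j)" and b: "\<And>j. bounded_measurable (torus d) (b j)"
    and fa: "\<And>x z. x \<in> space (torus d) \<Longrightarrow> z \<in> sphere 0 1 \<Longrightarrow> f (twist d (z, x)) = (\<Sum>j<J. a j x * z powi (1 + int j))"
    and gb: "\<And>x z. x \<in> space (torus d) \<Longrightarrow> z \<in> sphere 0 1 \<Longrightarrow> g (twist d (z, x)) = (\<Sum>i<I. b i x * z powi (0 + int i))"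
  shows "(LINT y|torus (Suc d). \<psi> y * f y * g y)
    = (LINT x|torus d. (\<Sum>i<I. b i x * (\<Sum>j<J. fibre_coeff d \<psi> (- (int i + int j + 1)) x * a j x)))"
proof -
  obtain B where B: "(\<lambda>y. \<psi> y * f y * g y) \<in> borel_measurable (torus (Suc d))"
     "\<And>y. y \<in> space (torus (Suc d)) \<Longrightarrow> norm (\<psi> y * f y * g y) \<le> B"
    by (rule bounded_measurableE[OF bounded_measurable_mult[OF bounded_measurable_mult[OF \<psi> f] g]]) (rule that, assumption+)
  have "(LINT y|torus (Suc d). \<psi> y * f y * g y) = (LINT x|torus d. LINT z|circle_measure. \<psi> (twist d (z, x)) * f (twist d (z, x)) * g (twist d (z, x)))"
    by (rule integral_torus_Suc[OF B])
  also have "\<dots> = (LINT x|torus d. (\<Sum>i<I. b i x * (\<Sum>j<J. fibre_coeff d \<psi> (- (int i + int j + 1)) x * a j x)))"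
  proof (rule Bochner_Integration.integral_cong)
    fix x assume x: "x \<in> space (torus d)"
    note bu = bounded_measurable_twist[OF \<psi> x]
    have "(LINT z|circle_measure. \<psi> (twist d (z, x)) * f (twist d (z, x)) * g (twist d (z, x)))
        = (LINT z|circle_measure. (\<Sum>i<I. \<Sum>j<J. (b i x * a j x) * (\<psi> (twist d (z, x)) * z powi (int i + int j + 1))))"
    proof (rule Bochner_Integration.integral_cong)
      fix z assume z: "z \<in> space circle_measure"
      then have nz: "z \<noteq> 0" by auto
      have e: "z powi (int i + int j + 1) = z powi (1 + int j) * z powi (0 + int i)" for i j
        using nz by (subst power_int_add[symmetric]) (auto simp: ac_simps)
      show "\<psi> (twist d (z, x)) * f (twist d (z, x)) * g (twist d (z, x))
          = (\<Sum>i<I. \<Sum>j<J. (b i x * a j x) * (\<psi> (twist d (z, x)) * z powi (int i + int j + 1)))"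
        using z x unfolding e
        by (subst sum.swap) (simp add: fa gb sum_distrib_left sum_distrib_right mult_ac)
    qed simp
    also have "\<dots> = (\<Sum>i<I. LINT z|circle_measure. (\<Sum>j<J. (b i x * a j x) * (\<psi> (twist d (z, x)) * z powi (int i + int j + 1))))"
      by (intro Bochner_Integration.integral_sum integrable_circle bounded_measurable_intros bounded_measurable_powi bu)
    also have "\<dots> = (\<Sum>i<I. \<Sum>j<J. LINT z|circle_measure. (b i x * a j x) * (\<psi> (twist d (z, x)) * z powi (int i + int j + 1)))"
      by (intro sum.cong refl Bochner_Integration.integral_sum integrable_circle bounded_measurable_intros bounded_measurable_powi bu)
    also have "\<dots> = (\<Sum>i<I. b i x * (\<Sum>j<J. fibre_coeff d \<psi> (- (int i + int j + 1)) x * a j x))"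
      unfolding fibre_coeff_def minus_minus by (simp add: sum_distrib_left mult_ac)
    finally show "(LINT z|circle_measure. \<psi> (twist d (z, x)) * f (twist d (z, x)) * g (twist d (z, x)))
        = (\<Sum>i<I. b i x * (\<Sum>j<J. fibre_coeff d \<psi> (- (int i + int j + 1)) x * a j x))" .
  qed simp
  finally show ?thesis .
qed

text \<open>The Hankel operator is applied to the block vector of f and the result is paired with
  that of g; f and g are given a common norm bound s, so that a single scaling suffices.\<close>

lemma hankel_op_pairing:
  assumes \<psi>: "bounded_measurable (torus (Suc d)) \<psi>"
    and slice: "\<And>k. AE x in torus d. slice (Suc d) \<phi> k x = fibre_coeff d \<psi> k x"
    and M: "M > 0" "op_norm d (hankel_op (Suc d) \<phi>) \<le> ennreal M"
    and f: "f \<in> trig_poly (Suc d) {1..}" and g: "g \<in> trig_poly (Suc d) {0..}"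
    and s: "s > 0" "(LINT y|torus (Suc d). (norm (f y))\<^sup>2) \<le> s\<^sup>2" "(LINT y|torus (Suc d). (norm (g y))\<^sup>2) \<le> s\<^sup>2"
  shows "norm (LINT y|torus (Suc d). \<psi> y * f y * g y) \<le> M * s\<^sup>2"
proof -
  obtain J a where a: "\<And>j. bounded_measurable (torus d) (a j)" "\<And>j x. j \<ge> J \<Longrightarrow> a j x = 0"
    and fa: "\<And>x z. x \<in> space (torus d) \<Longrightarrow> z \<in> sphere 0 1 \<Longrightarrow> f (twist d (z, x)) = (\<Sum>j<J. a j x * z powi (1 + int j))"
    using trig_poly_fibre_expansion[OF f] by blast
  obtain I b where b: "\<And>j. bounded_measurable (torus d) (b j)"
    and gb: "\<And>x z. x \<in> space (torus d) \<Longrightarrow> z \<in> sphere 0 1 \<Longrightarrow> g (twist d (z, x)) = (\<Sum>i<I. b i x * z powi (0 + int i))"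
    using trig_poly_fibre_expansion[OF g] by blast
  note bf = bounded_measurable_trig_poly[OF f] and bg = bounded_measurable_trig_poly[OF g]
  note sq_int = integrable_norm_sq[OF prob_space_torus]
  have na: "(\<Sum>j<J. LINT x|torus d. (norm (a j x))\<^sup>2) \<le> s\<^sup>2"
    using fibre_expansion_parseval[OF bf a(1) fa] s by simp
  have nb: "(\<Sum>i<I. LINT x|torus d. (norm (b i x))\<^sup>2) \<le> s\<^sup>2"
    using fibre_expansion_parseval[OF bg b gb] s by simp
  \<comment> \<open>Division by s moves the block vector of f into the unit ball over which
    \<open>op_norm\<close> takes its supremum.\<close>
  define F where "F j x = a j x * (1 / complex_of_real s)" for j x
  have bF: "bounded_measurable (torus d) (F j)" for j
    unfolding F_def[abs_def] by (intro bounded_measurable_intros a)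
  define Y where "Y i x = (\<Sum>j<J. fibre_coeff d \<psi> (- (int i + int j + 1)) x * F j x)" for i x
  have bY: "bounded_measurable (torus d) (Y i)" for i
    unfolding Y_def[abs_def] by (intro bounded_measurable_intros bounded_measurable_fibre_coeff \<psi> bF)
  have F0: "F j x = 0" if "j \<ge> J" for j x using a(2)[OF that] by (simp add: F_def)
  have "seq_norm2 d F = (\<Sum>j<J. \<integral>\<^sup>+x. ennreal ((norm (F j x))\<^sup>2) \<partial>torus d)"
    unfolding seq_norm2_def by (rule suminf_finite) (auto simp: F0)
  also have "\<dots> = (\<Sum>j<J. ennreal (LINT x|torus d. (norm (F j x))\<^sup>2))" by (simp only: nn_integral_norm_sq[OF bF])
  also have "\<dots> = ennreal (\<Sum>j<J. (LINT x|torus d. (norm (F j x))\<^sup>2))" by (rule sum_ennreal) simp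
  also have "(\<Sum>j<J. (LINT x|torus d. (norm (F j x))\<^sup>2)) = (\<Sum>j<J. LINT x|torus d. (norm (a j x))\<^sup>2) / s\<^sup>2"
    using s(1) by (simp add: F_def norm_mult norm_divide power_mult_distrib power_divide sum_divide_distrib)
  also have "\<dots> \<le> 1" using na s(1) by simp
  finally have F1: "seq_norm2 d F \<le> 1" by (simp add: ennreal_leI)
  then have sF: "seq_norm d F \<le> 1" using seq_norm_le_iff[of 1 d F] by simp
  have "F \<in> {F \<in> L2_tensor_l2 d. seq_norm d F \<le> 1}"
    using sF bF le_less_trans[OF sF, of \<infinity>] by (simp add: L2_tensor_l2_def bounded_measurable_measurable)
  then have "seq_norm d (hankel_op (Suc d) \<phi> F) \<le> op_norm d (hankel_op (Suc d) \<phi>)"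
    unfolding op_norm_def by (rule SUP_upper)
  also note M(2)
  finally have HF: "seq_norm2 d (hankel_op (Suc d) \<phi> F) \<le> ennreal (M\<^sup>2)"
    using seq_norm_le_iff[of M] M(1) by simp
  have all: "AE x in torus d. \<forall>m::nat. slice (Suc d) \<phi> (- (int m + 1)) x = fibre_coeff d \<psi> (- (int m + 1)) x"
    unfolding AE_all_countable using slice by simp
  have XY: "AE x in torus d. \<forall>i. hankel_op (Suc d) \<phi> F i x = Y i x"
    using all
  proof eventually_elim
    case (elim x)
    show ?case
    proof
      fix i
      have "slice (Suc d) \<phi> (- (int i + int j + 1)) x = fibre_coeff d \<psi> (- (int i + int j + 1)) x" for j
        using elim[rule_format, of "i + j"] by simp
      then have "hankel_op (Suc d) \<phi> F i x = (\<Sum>j. fibre_coeff d \<psi> (- (int i + int j + 1)) x * F j x)"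
        by (simp add: hankel_op_def mult_op_def)
      also have "\<dots> = Y i x" unfolding Y_def by (rule suminf_finite) (auto simp: F0)
      finally show "hankel_op (Suc d) \<phi> F i x = Y i x" .
    qed
  qed
  have "ennreal (\<Sum>i<I. LINT x|torus d. (norm (Y i x))\<^sup>2) = (\<Sum>i<I. ennreal (LINT x|torus d. (norm (Y i x))\<^sup>2))"
    by (rule sum_ennreal[symmetric]) simp
  also have "\<dots> = (\<Sum>i<I. \<integral>\<^sup>+x. ennreal ((norm (Y i x))\<^sup>2) \<partial>torus d)" by (simp only: nn_integral_norm_sq[OF bY])
  also have "\<dots> = (\<Sum>i<I. \<integral>\<^sup>+x. ennreal ((norm (hankel_op (Suc d) \<phi> F i x))\<^sup>2) \<partial>torus d)"
    using XY by (intro sum.cong refl nn_integral_cong_AE) (auto elim: eventually_mono)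
  also have "\<dots> \<le> seq_norm2 d (hankel_op (Suc d) \<phi> F)"
    unfolding seq_norm2_def by (rule sum_le_suminf) auto
  also note HF
  finally have nY: "(\<Sum>i<I. LINT x|torus d. (norm (Y i x))\<^sup>2) \<le> M\<^sup>2" by (simp add: ennreal_le_iff)
  have aF: "a j x = complex_of_real s * F j x" for j x using s(1) by (simp add: F_def)
  have "(LINT y|torus (Suc d). \<psi> y * f y * g y)
      = (LINT x|torus d. (\<Sum>i<I. b i x * (\<Sum>j<J. fibre_coeff d \<psi> (- (int i + int j + 1)) x * a j x)))"
    by (rule hankel_pairing_fibre[OF \<psi> bf bg a(1) b fa gb])
  also have "\<dots> = (LINT x|torus d. complex_of_real s * (\<Sum>i<I. b i x * Y i x))"
    unfolding aF Y_def by (simp add: sum_distrib_left mult_ac)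
  also have "\<dots> = complex_of_real s * (LINT x|torus d. (\<Sum>i<I. b i x * Y i x))" by simp
  finally have pair: "norm (LINT y|torus (Suc d). \<psi> y * f y * g y) = s * norm (LINT x|torus d. (\<Sum>i<I. b i x * Y i x))"
    using s(1) by (simp add: norm_mult)
  \<comment> \<open>A weighted arithmetic-geometric mean inequality does the work of Cauchy-Schwarz;
    the weights balance the two sums at the bounds M^2 for Y and s^2 for b, where they give exactly
    M s.\<close>
  have amgm: "norm (b i x * Y i x) \<le> s / (2 * M) * (norm (Y i x))\<^sup>2 + M / (2 * s) * (norm (b i x))\<^sup>2" for i x
  proof -
    define p q where "p = norm (b i x)" and "q = norm (Y i x)"
    have "0 \<le> (s * q - M * p)\<^sup>2 / (2 * M * s)" using M(1) s(1) by simp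
    also have "\<dots> = s / (2 * M) * q\<^sup>2 + M / (2 * s) * p\<^sup>2 - p * q"
      using M(1) s(1) by (simp add: field_simps power2_eq_square)
    finally show ?thesis by (simp add: norm_mult p_def q_def)
  qed
  have "norm (LINT x|torus d. (\<Sum>i<I. b i x * Y i x))
      \<le> (LINT x|torus d. (\<Sum>i<I. s / (2 * M) * (norm (Y i x))\<^sup>2 + M / (2 * s) * (norm (b i x))\<^sup>2))"
  proof -
    have "norm (LINT x|torus d. (\<Sum>i<I. b i x * Y i x)) \<le> (LINT x|torus d. norm (\<Sum>i<I. b i x * Y i x))"
      by simp
    also have "\<dots> \<le> (LINT x|torus d. (\<Sum>i<I. s / (2 * M) * (norm (Y i x))\<^sup>2 + M / (2 * s) * (norm (b i x))\<^sup>2))"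
    proof (rule integral_mono)
      show "integrable (torus d) (\<lambda>x. norm (\<Sum>i<I. b i x * Y i x))"
        by (intro integrable_norm integrable_torus bounded_measurable_intros b bY)
      show "integrable (torus d) (\<lambda>x. \<Sum>i<I. s / (2 * M) * (norm (Y i x))\<^sup>2 + M / (2 * s) * (norm (b i x))\<^sup>2)"
        by (intro Bochner_Integration.integrable_sum Bochner_Integration.integrable_add integrable_mult_right sq_int bY b)
      show "norm (\<Sum>i<I. b i x * Y i x) \<le> (\<Sum>i<I. s / (2 * M) * (norm (Y i x))\<^sup>2 + M / (2 * s) * (norm (b i x))\<^sup>2)" for x
        by (rule order_trans[OF norm_sum sum_mono[OF amgm]])
    qed
    finally show ?thesis .
  qed
  also have "\<dots> = (\<Sum>i<I. s / (2 * M) * (LINT x|torus d. (norm (Y i x))\<^sup>2) + M / (2 * s) * (LINT x|torus d. (norm (b i x))\<^sup>2))"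
    by (simp add: Bochner_Integration.integral_sum Bochner_Integration.integral_add sq_int bY b)
  also have "\<dots> = s / (2 * M) * (\<Sum>i<I. LINT x|torus d. (norm (Y i x))\<^sup>2) + M / (2 * s) * (\<Sum>i<I. LINT x|torus d. (norm (b i x))\<^sup>2)"
    by (simp add: sum.distrib sum_distrib_left)
  also have "\<dots> \<le> s / (2 * M) * M\<^sup>2 + M / (2 * s) * s\<^sup>2"
    using M(1) s(1) nY nb by (intro add_mono mult_left_mono) auto
  also have "\<dots> = M * s" using M(1) s(1) by (simp add: power2_eq_square)
  finally have "s * norm (LINT x|torus d. (\<Sum>i<I. b i x * Y i x)) \<le> s * (M * s)" using s(1) by (intro mult_left_mono) auto
  then show ?thesis unfolding pair by (simp add: power2_eq_square mult_ac)
qed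

lemma hankel_op_functional_bound:
  assumes \<psi>: "bounded_measurable (torus (Suc d)) \<psi>"
    and slice: "\<And>k. AE x in torus d. slice (Suc d) \<phi> k x = fibre_coeff d \<psi> k x"
    and M: "M > 0" "op_norm d (hankel_op (Suc d) \<phi>) \<le> ennreal M"
    and h: "h \<in> trig_poly (Suc d) {1..}"
  shows "norm (LINT y|torus (Suc d). \<psi> y * h y) \<le> M * (LINT y|torus (Suc d). norm (h y))"
proof (rule field_le_epsilon)
  fix \<epsilon> :: real assume \<epsilon>: "\<epsilon> > 0"
  let ?T = "torus (Suc d)"
  interpret T: prob_space ?T by (rule prob_space_torus)
  obtain B where B: "B \<ge> 0" "\<And>y. y \<in> space ?T \<Longrightarrow> norm (\<psi> y) \<le> B"
    by (rule bounded_measurableE[OF \<psi>]) (rule that, assumption+)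
  note bh = bounded_measurable_trig_poly[OF h]
  have ih: "integrable ?T (\<lambda>y. norm (h y))" by (intro integrable_norm integrable_torus bh)
  \<comment> \<open>The factorization error costs B e through \<psi> and M e through the norms of
    the factors.\<close>
  define e where "e = \<epsilon> / (B + M)"
  have e: "e > 0" "(B + M) * e = \<epsilon>" using \<epsilon> B M by (auto simp: e_def)
  obtain f g where f: "f \<in> trig_poly (Suc d) {1..}" and g: "g \<in> trig_poly (Suc d) {0..}"
    and fg: "\<And>z. z \<in> space ?T \<Longrightarrow> norm (h z - f z * g z) \<le> e"
     "\<And>z. z \<in> space ?T \<Longrightarrow> (norm (f z))\<^sup>2 \<le> norm (h z) + e"
     "\<And>z. z \<in> space ?T \<Longrightarrow> (norm (g z))\<^sup>2 \<le> norm (h z) + e"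
    using trig_poly_factorization[OF h e(1)] by blast
  note bf = bounded_measurable_trig_poly[OF f] and bg = bounded_measurable_trig_poly[OF g]
  \<comment> \<open>Both factors satisfy this bound because the measure has total mass 1; the
    summand e makes s positive even if h vanishes.\<close>
  define s where "s = sqrt ((LINT y|?T. norm (h y)) + e)"
  have h0: "(LINT y|?T. norm (h y)) \<ge> 0" by simp
  have s: "s > 0" "s\<^sup>2 = (LINT y|?T. norm (h y)) + e" using e(1) h0 by (auto simp: s_def intro: add_nonneg_pos)
  have he: "(LINT y|?T. norm (h y) + e) = s\<^sup>2"
    using ih by (simp add: s T.prob_space)
  have nf: "(LINT y|?T. (norm (f y))\<^sup>2) \<le> s\<^sup>2"
    unfolding he[symmetric] using ih by (intro integral_mono integrable_norm_sq prob_space_torus bf fg) auto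
  have ng: "(LINT y|?T. (norm (g y))\<^sup>2) \<le> s\<^sup>2"
    unfolding he[symmetric] using ih by (intro integral_mono integrable_norm_sq prob_space_torus bg fg) auto
  have "(LINT y|?T. \<psi> y * h y) = (LINT y|?T. \<psi> y * (h y - f y * g y) + \<psi> y * f y * g y)"
    by (simp add: algebra_simps)
  also have "\<dots> = (LINT y|?T. \<psi> y * (h y - f y * g y)) + (LINT y|?T. \<psi> y * f y * g y)"
    by (intro Bochner_Integration.integral_add integrable_torus bounded_measurable_intros \<psi> bf bg bh)
  finally have "norm (LINT y|?T. \<psi> y * h y) \<le> norm (LINT y|?T. \<psi> y * (h y - f y * g y)) + norm (LINT y|?T. \<psi> y * f y * g y)"
    by (simp add: norm_triangle_ineq)
  also have "norm (LINT y|?T. \<psi> y * (h y - f y * g y)) \<le> B * e"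
    by (rule norm_integral_le_prob[OF prob_space_torus])
       (use B fg e in \<open>auto simp: norm_mult intro!: mult_mono\<close>)
  also have "norm (LINT y|?T. \<psi> y * f y * g y) \<le> M * s\<^sup>2"
    by (rule hankel_op_pairing[OF \<psi> slice M f g s(1) nf ng])
  finally show "norm (LINT y|?T. \<psi> y * h y) \<le> M * (LINT y|?T. norm (h y)) + \<epsilon>"
    unfolding s(2) e(2)[symmetric] by (simp add: algebra_simps)
qed

section \<open>The distance is at most the norm of the Hankel operator\<close>

lemma fourier_coeff_trig_sum:
  assumes f: "bounded_measurable (torus n) f"
  shows "(LINT x|torus n. f x * (\<Sum>m\<in>Q. w m * torus_char n (\<lambda>i. - m i) x)) = (\<Sum>m\<in>Q. w m * fourier_coeff n f m)"
proof -
  have "(LINT x|torus n. f x * (\<Sum>m\<in>Q. w m * torus_char n (\<lambda>i. - m i) x))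
      = (LINT x|torus n. (\<Sum>m\<in>Q. w m * (f x * torus_char n (\<lambda>i. - m i) x)))"
    by (simp add: sum_distrib_left mult_ac)
  also have "\<dots> = (\<Sum>m\<in>Q. LINT x|torus n. w m * (f x * torus_char n (\<lambda>i. - m i) x))"
    by (intro Bochner_Integration.integral_sum integrable_torus bounded_measurable_intros f)
  finally show ?thesis by (simp add: fourier_coeff_char)
qed

lemma norm_fourier_coeff_le:
  assumes "\<And>x. x \<in> space (torus n) \<Longrightarrow> norm (f x) \<le> B" "B \<ge> 0"
  shows "norm (fourier_coeff n f m) \<le> B"
  unfolding fourier_coeff_char
  by (rule norm_integral_le_prob[OF prob_space_torus]) (use assms in \<open>auto simp: norm_mult\<close>)

lemma fourier_coeff_convex:
  assumes f: "bounded_measurable (torus n) f" and g: "bounded_measurable (torus n) g"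
  shows "fourier_coeff n (\<lambda>x. a * f x + b * g x) m = a * fourier_coeff n f m + b * fourier_coeff n g m"
proof -
  have "fourier_coeff n (\<lambda>x. a * f x + b * g x) m
      = (LINT x|torus n. a * (f x * torus_char n (\<lambda>i. - m i) x) + b * (g x * torus_char n (\<lambda>i. - m i) x))"
    unfolding fourier_coeff_char by (simp add: algebra_simps)
  also have "\<dots> = (LINT x|torus n. a * (f x * torus_char n (\<lambda>i. - m i) x)) + (LINT x|torus n. b * (g x * torus_char n (\<lambda>i. - m i) x))"
    by (intro Bochner_Integration.integral_add integrable_torus bounded_measurable_intros f g)
  finally show ?thesis by (simp add: fourier_coeff_char)
qed

text \<open>The bound is imposed at every point, so convex combinations are estimated pointwise and
  no null sets have to be tracked.\<close>

definition sup_ball :: "nat \<Rightarrow> real \<Rightarrow> ((nat \<Rightarrow> complex) \<Rightarrow> complex) set" where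
  "sup_ball n M = {c \<in> borel_measurable (torus n). \<forall>x. norm (c x) \<le> M}"

lemma sup_ball_bounded_measurable: "c \<in> sup_ball n M \<Longrightarrow> bounded_measurable (torus n) c"
  unfolding sup_ball_def by (auto intro: bounded_measurableI)

lemma sup_ball_convex:
  assumes c: "c \<in> sup_ball n M" "c' \<in> sup_ball n M" and t: "0 \<le> t" "t \<le> 1"
  shows "(\<lambda>x. complex_of_real (1 - t) * c x + complex_of_real t * c' x) \<in> sup_ball n M"
proof -
  have "norm (complex_of_real (1 - t) * c x + complex_of_real t * c' x) \<le> M" for x
  proof -
    have "norm (complex_of_real (1 - t) * c x + complex_of_real t * c' x) \<le> (1 - t) * norm (c x) + t * norm (c' x)"
      using t by (intro norm_triangle_le) (simp add: norm_mult del: of_real_diff)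
    also have "\<dots> \<le> (1 - t) * M + t * M" using c t by (intro add_mono mult_left_mono) (auto simp: sup_ball_def)
    finally show ?thesis by (simp add: algebra_simps)
  qed
  then show ?thesis using c unfolding sup_ball_def by (auto intro!: borel_measurable_add borel_measurable_times)
qed

text \<open>For an almost minimiser \<open>c\<close> of the squared distance of the finitely many coefficients, the first-order condition
  tested against \<open>c' = M cnj h / \<bar>h\<bar>\<close>, where \<open>h\<close> is the polynomial built from the conjugated defects, contradicts the
  duality bound \<open>bound\<close> unless the defect is small.\<close>
lemma finite_interpolation:
  assumes \<psi>: "bounded_measurable (torus n) \<psi>" and M: "M > 0"
    and bound: "\<And>h. h \<in> trig_poly n {1..} \<Longrightarrow> norm (LINT y|torus n. \<psi> y * h y) \<le> M * (LINT y|torus n. norm (h y))"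
    and Q: "finite Q" "\<And>m. m \<in> Q \<Longrightarrow> (\<Sum>i\<in>{1..n}. m i) < 0" and \<epsilon>: "\<epsilon> > 0"
  shows "\<exists>c\<in>sup_ball n M. (\<Sum>m\<in>Q. (norm (fourier_coeff n \<psi> m - fourier_coeff n c m))\<^sup>2) \<le> \<epsilon>"
proof -
  define J where "J c = (\<Sum>m\<in>Q. (norm (fourier_coeff n \<psi> m - fourier_coeff n c m))\<^sup>2)" for c
  define K where "K = real (card Q) * (2 * M)\<^sup>2"
  have K: "K \<ge> 0" by (simp add: K_def)
  \<comment> \<open>Moving from c towards c' by t gains 2 t R to first order and loses at most t^2
    K; with minimality up to t^2, division by t leaves 2 R \<le> t (1 + K) \<le> \<epsilon>.\<close>
  define t where "t = min 1 (\<epsilon> / (1 + K))"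
  have t: "t > 0" "t \<le> 1" "t * (1 + K) \<le> \<epsilon>"
  proof -
    show "t > 0" "t \<le> 1" using \<epsilon> K by (auto simp: t_def)
    have "t * (1 + K) \<le> \<epsilon> / (1 + K) * (1 + K)" using K by (intro mult_right_mono) (auto simp: t_def)
    then show "t * (1 + K) \<le> \<epsilon>" using K by simp
  qed
  have ne: "sup_ball n M \<noteq> {}" using M by (auto simp: sup_ball_def intro!: exI[of _ "\<lambda>_. 0"])
  have bdd: "bdd_below (J ` sup_ball n M)"
    by (rule bdd_belowI[of _ 0]) (auto simp: J_def intro: sum_nonneg)
  define m0 where "m0 = Inf (J ` sup_ball n M)"
  have m0: "m0 \<le> J c" if "c \<in> sup_ball n M" for c
    unfolding m0_def using that bdd by (intro cInf_lower) auto
  obtain c where c: "c \<in> sup_ball n M" "J c < m0 + t\<^sup>2"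
    using cInf_lessD[of "J ` sup_ball n M" "m0 + t\<^sup>2"] ne t(1) by (auto simp: m0_def)
  note bc = sup_ball_bounded_measurable[OF c(1)]
  define b where "b m = fourier_coeff n \<psi> m - fourier_coeff n c m" for m
  \<comment> \<open>Inverting the characters turns total degrees below 0 into total degrees of at
    least 1, as the duality bound demands.\<close>
  define h where "h x = (\<Sum>m\<in>Q. cnj (b m) * torus_char n (\<lambda>i. - m i) x)" for x
  have h: "h \<in> trig_poly n {1..}"
    unfolding h_def[abs_def]
  proof (rule trig_poly_sum, rule trig_poly_char)
    fix m assume "m \<in> Q"
    then show "(\<Sum>i\<in>{1..n}. - m i) \<in> {1..}" using Q(2)[of m] by (simp add: sum_negf)
  qed
  note bh = bounded_measurable_trig_poly[OF h]
  \<comment> \<open>This choice maximizes the real part of the pairing with h over the ball. At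
    zeros of h, \<open>sgn\<close> is 0, and c' h = M |h| still holds.\<close>
  define c' where "c' x = complex_of_real M * cnj (sgn (h x))" for x
  have "norm (c' x) \<le> M" for x
    using M by (simp add: c'_def norm_mult norm_sgn)
  moreover have "c' \<in> borel_measurable (torus n)"
  proof -
    have "(\<lambda>x. complex_of_real M * cnj (h x) / complex_of_real (norm (h x))) \<in> borel_measurable (torus n)"
      using bounded_measurable_measurable[OF bounded_measurable_cnj[OF bh]] bounded_measurable_measurable[OF bh]
      by measurable
    moreover have "c' x = complex_of_real M * cnj (h x) / complex_of_real (norm (h x))" for x
      by (simp add: c'_def sgn_eq)
    ultimately show ?thesis by presburger
  qed
  ultimately have c': "c' \<in> sup_ball n M" by (simp add: sup_ball_def)
  note bc' = sup_ball_bounded_measurable[OF c']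
  define v where "v m = fourier_coeff n c' m - fourier_coeff n c m" for m
  define c2 where "c2 x = complex_of_real (1 - t) * c x + complex_of_real t * c' x" for x
  have c2: "c2 \<in> sup_ball n M"
    unfolding c2_def[abs_def] using t by (intro sup_ball_convex c c') auto
  have nv: "norm (v m) \<le> 2 * M" for m
  proof -
    have "norm (v m) \<le> norm (fourier_coeff n c' m) + norm (fourier_coeff n c m)"
      unfolding v_def by (rule norm_triangle_ineq4)
    also have "\<dots> \<le> M + M"
      using c c' M by (intro add_mono norm_fourier_coeff_le) (auto simp: sup_ball_def)
    finally show ?thesis by simp
  qed
  define R where "R = Re (\<Sum>m\<in>Q. cnj (b m) * v m)"
  have sq: "(norm (x - complex_of_real t * y))\<^sup>2 = (norm x)\<^sup>2 - 2 * t * Re (cnj x * y) + t\<^sup>2 * (norm y)\<^sup>2" for x y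
    unfolding cmod_power2 by (simp add: power2_eq_square algebra_simps)
  have "J c2 = (\<Sum>m\<in>Q. (norm (b m - complex_of_real t * v m))\<^sup>2)"
    unfolding J_def
  proof (rule sum.cong)
    fix m
    have "fourier_coeff n \<psi> m - fourier_coeff n c2 m = b m - complex_of_real t * v m"
      unfolding c2_def[abs_def] fourier_coeff_convex[OF bc bc'] b_def v_def by (simp add: algebra_simps)
    then show "(norm (fourier_coeff n \<psi> m - fourier_coeff n c2 m))\<^sup>2 = (norm (b m - complex_of_real t * v m))\<^sup>2" by simp
  qed simp
  also have "\<dots> = J c - 2 * t * R + t\<^sup>2 * (\<Sum>m\<in>Q. (norm (v m))\<^sup>2)"
    unfolding sq by (simp only: J_def b_def[symmetric] R_def Re_sum sum.distrib sum_subtractf sum_distrib_left)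
  also have "(\<Sum>m\<in>Q. (norm (v m))\<^sup>2) \<le> (\<Sum>m\<in>Q. (2 * M)\<^sup>2)"
    using nv by (intro sum_mono power_mono) auto
  also have "\<dots> = K" by (simp add: K_def)
  finally have "J c2 \<le> J c - 2 * t * R + t\<^sup>2 * K" by (simp add: mult_left_mono)
  with m0[OF c2] c(2) have "2 * t * R \<le> t\<^sup>2 * K + t\<^sup>2" by linarith
  also have "\<dots> = t * (t * (1 + K))" by (simp add: power2_eq_square algebra_simps)
  also have "\<dots> \<le> t * \<epsilon>" using t by (intro mult_left_mono) auto
  finally have "t * (2 * R) \<le> t * \<epsilon>" by (simp add: mult_ac)
  then have R: "2 * R \<le> \<epsilon>" using t(1) by simp
  have "(\<Sum>m\<in>Q. cnj (b m) * fourier_coeff n c' m) = (LINT x|torus n. c' x * h x)"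
    unfolding h_def by (rule fourier_coeff_trig_sum[OF bc', symmetric])
  also have "\<dots> = (LINT x|torus n. complex_of_real (M * norm (h x)))"
  proof (rule Bochner_Integration.integral_cong)
    fix x
    have "cnj (sgn (h x)) * h x = complex_of_real (norm (h x))"
    proof (cases "h x = 0")
      case False
      have "cnj (sgn (h x)) * h x = complex_of_real ((norm (h x))\<^sup>2) / complex_of_real (norm (h x))"
        by (simp only: sgn_eq complex_cnj_divide complex_cnj_complex_of_real complex_norm_square) (simp add: mult.commute)
      also have "\<dots> = complex_of_real (norm (h x))" using False by (simp add: power2_eq_square)
      finally show ?thesis .
    qed simp
    then show "c' x * h x = complex_of_real (M * norm (h x))" by (simp add: c'_def mult.assoc)
  qed simp
  also have "\<dots> = complex_of_real (M * (LINT x|torus n. norm (h x)))"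
    by (simp only: integral_complex_of_real) simp
  finally have s1: "(\<Sum>m\<in>Q. cnj (b m) * fourier_coeff n c' m) = complex_of_real (M * (LINT x|torus n. norm (h x)))" .
  have s2: "(\<Sum>m\<in>Q. cnj (b m) * fourier_coeff n \<psi> m) = (LINT x|torus n. \<psi> x * h x)"
    unfolding h_def by (rule fourier_coeff_trig_sum[OF \<psi>, symmetric])
  have s3: "(\<Sum>m\<in>Q. cnj (b m) * b m) = complex_of_real (J c)"
    unfolding J_def b_def of_real_sum complex_norm_square by (simp add: mult.commute)
  \<comment> \<open>In coefficients, c' - c = c' - \<psi> + b. The pairing with c' - \<psi> is
    nonnegative in real part by the duality bound, so the defect \<open>J c\<close> is at most
    R.\<close>
  have "(\<Sum>m\<in>Q. cnj (b m) * v m) = (\<Sum>m\<in>Q. cnj (b m) * fourier_coeff n c' m) - (\<Sum>m\<in>Q. cnj (b m) * fourier_coeff n \<psi> m) + (\<Sum>m\<in>Q. cnj (b m) * b m)"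
    unfolding sum_subtractf[symmetric] sum.distrib[symmetric]
    by (rule sum.cong) (auto simp: v_def b_def algebra_simps)
  then have "R = M * (LINT x|torus n. norm (h x)) - Re (LINT x|torus n. \<psi> x * h x) + J c"
    unfolding R_def s1 s2 s3 by simp
  moreover have "Re (LINT x|torus n. \<psi> x * h x) \<le> M * (LINT x|torus n. norm (h x))"
    using bound[OF h] complex_Re_le_cmod order_trans by blast
  ultimately have "J c \<le> R" by linarith
  moreover have "J c \<ge> 0" by (simp add: J_def sum_nonneg)
  ultimately have "J c \<le> \<epsilon>" using R by linarith
  then show ?thesis using c(1) by (auto simp: J_def)
qed

text \<open>The increments have summable L^1 norms, so for almost every x the telescoping series
  converges absolutely.\<close>

lemma fast_L2_Cauchy_converges:
  assumes c: "\<And>j. c j \<in> sup_ball n M" and M: "M \<ge> 0"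
    and fast: "\<And>j. (LINT x|torus n. (norm (c (Suc j) x - c j x))\<^sup>2) \<le> B * (1/4) ^ j"
  shows "AE x in torus n. convergent (\<lambda>j. c j x)"
proof -
  note bm = sup_ball_bounded_measurable[OF c]
  interpret prob_space "torus n" by (rule prob_space_torus)
  have "0 \<le> (LINT x|torus n. (norm (c (Suc 0) x - c 0 x))\<^sup>2)" by simp
  from order_trans[OF this fast[of 0]] have B: "B \<ge> 0" by simp
  have id: "bounded_measurable (torus n) (\<lambda>x. c (Suc j) x - c j x)" for j by (intro bounded_measurable_diff bm)
  have int: "integrable (torus n) (\<lambda>x. norm (c (Suc j) x - c j x))" for j
    by (intro integrable_norm integrable_torus id)
  have L1: "(LINT x|torus n. norm (c (Suc j) x - c j x)) \<le> (1 + B) * (1/2) ^ j" for j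
  proof -
    let ?v = "\<lambda>x. norm (c (Suc j) x - c j x)"
    have sqi: "integrable (torus n) (\<lambda>x. (?v x)\<^sup>2)" by (rule integrable_norm_sq[OF prob_space_torus id])
    \<comment> \<open>The weight 2^j balances the two terms: an increment of squared L^2 norm of
      order 4^(-j) gets an L^1 norm of order 2^(-j).\<close>
    have pt: "?v x \<le> (1/2) ^ j + 2 ^ j * (?v x)\<^sup>2" for x
    proof -
      have p: "(1/2::real) ^ j * 2 ^ j = 1" by (simp flip: power_mult_distrib)
      have "0 \<le> 2 ^ j * (?v x - (1/2) ^ j)\<^sup>2" by simp
      also have "\<dots> = 2 ^ j * (?v x)\<^sup>2 - 2 * ((1/2) ^ j * 2 ^ j) * ?v x + ((1/2) ^ j * 2 ^ j) * (1/2) ^ j"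
        by (simp add: power2_eq_square algebra_simps)
      also have "\<dots> = 2 ^ j * (?v x)\<^sup>2 - 2 * ?v x + (1/2) ^ j" by (simp only: p mult_1 mult_1_right)
      finally show ?thesis using norm_ge_zero[of "c (Suc j) x - c j x"] by linarith
    qed
    have "(LINT x|torus n. ?v x) \<le> (LINT x|torus n. (1/2) ^ j + 2 ^ j * (?v x)\<^sup>2)"
      using int sqi pt by (intro integral_mono) auto
    also have "\<dots> = (1/2) ^ j + 2 ^ j * (LINT x|torus n. (?v x)\<^sup>2)"
      using sqi by (simp add: prob_space)
    also have "\<dots> \<le> (1/2) ^ j + 2 ^ j * (B * (1/4) ^ j)"
      using fast[of j] by (intro add_left_mono mult_left_mono) auto
    also have "2 ^ j * (B * (1/4) ^ j) = B * (1/2::real) ^ j"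
    proof -
      have "2 ^ j * (1/4) ^ j = (1/2::real) ^ j" by (simp flip: power_mult_distrib)
      then show ?thesis by (metis mult.left_commute)
    qed
    finally show ?thesis by (simp add: algebra_simps)
  qed
  have "(\<integral>\<^sup>+x. (\<Sum>j. ennreal (norm (c (Suc j) x - c j x))) \<partial>torus n) = (\<Sum>j. \<integral>\<^sup>+x. ennreal (norm (c (Suc j) x - c j x)) \<partial>torus n)"
    using bounded_measurable_measurable[OF id]
    by (intro nn_integral_suminf measurable_compose[OF _ measurable_ennreal] measurable_compose[OF _ borel_measurable_norm])
  also have "\<dots> = (\<Sum>j. ennreal (LINT x|torus n. norm (c (Suc j) x - c j x)))"
    using int by (intro suminf_cong nn_integral_eq_integral) auto
  also have "\<dots> \<le> (\<Sum>j. ennreal ((1 + B) * (1/2) ^ j))"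
    by (intro suminf_le ennreal_leI L1) auto
  also have "\<dots> = ennreal (\<Sum>j. (1 + B) * (1/2) ^ j)"
    using B by (intro suminf_ennreal2) (auto intro!: summable_mult summable_geometric)
  finally have "(\<integral>\<^sup>+x. (\<Sum>j. ennreal (norm (c (Suc j) x - c j x))) \<partial>torus n) \<noteq> \<infinity>"
    by (auto simp: top_unique)
  then have "AE x in torus n. (\<Sum>j. ennreal (norm (c (Suc j) x - c j x))) \<noteq> \<infinity>"
    using bounded_measurable_measurable[OF id]
    by (intro nn_integral_PInf_AE borel_measurable_suminf_order measurable_compose[OF _ measurable_ennreal]
        measurable_compose[OF _ borel_measurable_norm]) auto
  then show ?thesis
  proof eventually_elim
    case (elim x)
    then have "summable (\<lambda>j. norm (c (Suc j) x - c j x))" by (intro summable_suminf_not_top) auto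
    then have "summable (\<lambda>j. c (Suc j) x - c j x)" by (rule summable_norm_cancel)
    then have "convergent (\<lambda>j. \<Sum>i<j. c (Suc i) x - c i x)" by (simp only: summable_iff_convergent)
    then have "convergent (\<lambda>j. c j x - c 0 x)" by (simp only: sum_lessThan_telescope[of "\<lambda>i. c i x"])
    then have "convergent (\<lambda>j. (c j x - c 0 x) + c 0 x)" by (intro convergent_add convergent_const)
    then show ?case by simp
  qed
qed

text \<open>A finite exhaustion of the half space of frequencies that must be matched.
  Extensionality makes the boxes finite; coefficients depend only on the values on
  \<open>{1..n}\<close>.\<close>

definition negative_box :: "nat \<Rightarrow> nat \<Rightarrow> (nat \<Rightarrow> int) set" where
  "negative_box n k = {m \<in> PiE {1..n} (\<lambda>_. {- int k..int k}). (\<Sum>i\<in>{1..n}. m i) < 0}"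

lemma finite_negative_box: "finite (negative_box n k)"
  unfolding negative_box_def by (rule finite_subset[of _ "PiE {1..n} (\<lambda>_. {- int k..int k})"]) (auto intro!: finite_PiE)

lemma negative_box_mono: "k \<le> l \<Longrightarrow> negative_box n k \<subseteq> negative_box n l"
  unfolding negative_box_def by (auto simp: PiE_iff)

lemma fourier_coeff_restrict: "fourier_coeff n f (restrict m {1..n}) = fourier_coeff n f m"
  unfolding fourier_coeff_def by simp

lemma restrict_in_negative_box:
  assumes "(\<Sum>i\<in>{1..n}. m i) < 0"
  shows "\<exists>k. restrict m {1..n} \<in> negative_box n k"
proof -
  let ?k = "\<Sum>i\<in>{1..n}. nat \<bar>m i\<bar>"
  have "\<bar>m i\<bar> \<le> int ?k" if "i \<in> {1..n}" for i
  proof -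
    have "nat \<bar>m i\<bar> \<le> ?k" using that by (intro member_le_sum) auto
    then show ?thesis by linarith
  qed
  then have "restrict m {1..n} \<in> PiE {1..n} (\<lambda>_. {- int ?k..int ?k})" by (auto simp: abs_le_iff simp del: of_nat_sum) (smt (verit, best))+
  then show ?thesis using assms unfolding negative_box_def by (intro exI[of _ ?k]) auto
qed

lemma interpolation:
  assumes \<psi>: "bounded_measurable (torus n) \<psi>" and M: "M > 0"
    and bound: "\<And>h. h \<in> trig_poly n {1..} \<Longrightarrow> norm (LINT y|torus n. \<psi> y * h y) \<le> M * (LINT y|torus n. norm (h y))"
  shows "\<exists>c\<in>borel_measurable (torus n). (AE x in torus n. norm (c x) \<le> M) \<and>
    (\<forall>m. (\<Sum>i\<in>{1..n}. m i) < 0 \<longrightarrow> fourier_coeff n c m = fourier_coeff n \<psi> m)"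
proof -
  let ?N = "\<lambda>c. LINT x|torus n. (norm (c x))\<^sup>2"
  interpret prob_space "torus n" by (rule prob_space_torus)
  \<comment> \<open>Finite interpolation is only approximate, so the tolerance shrinks while the box
    grows. The sets decrease, and a limit of members with index tending to infinity matches every
    coefficient exactly.\<close>
  define S where "S k = {c \<in> sup_ball n M. \<forall>m\<in>negative_box n k. norm (fourier_coeff n \<psi> m - fourier_coeff n c m) \<le> 1 / (real k + 1)}" for k
  have S_sub: "S k \<subseteq> sup_ball n M" for k by (auto simp: S_def)
  have S_mono: "S l \<subseteq> S k" if "k \<le> l" for k l
  proof
    fix c assume c: "c \<in> S l"
    have "1 / (real l + 1) \<le> 1 / (real k + 1)" using that by (intro divide_left_mono) auto
    then show "c \<in> S k" using c negative_box_mono[OF that] unfolding S_def by fastforce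
  qed
  have S_ne: "S k \<noteq> {}" for k
  proof -
    have "(1 / (real k + 1))\<^sup>2 > 0" by simp
    have neg: "\<And>m. m \<in> negative_box n k \<Longrightarrow> (\<Sum>i\<in>{1..n}. m i) < 0" by (simp add: negative_box_def)
    from finite_interpolation[OF \<psi> M bound finite_negative_box neg \<open>(1 / (real k + 1))\<^sup>2 > 0\<close>]
    obtain c where c: "c \<in> sup_ball n M"
      "(\<Sum>m\<in>negative_box n k. (norm (fourier_coeff n \<psi> m - fourier_coeff n c m))\<^sup>2) \<le> (1 / (real k + 1))\<^sup>2"
      by blast
    have "norm (fourier_coeff n \<psi> m - fourier_coeff n c m) \<le> 1 / (real k + 1)" if m: "m \<in> negative_box n k" for m
    proof (rule power2_le_imp_le)
      have "(norm (fourier_coeff n \<psi> m - fourier_coeff n c m))\<^sup>2 \<le> (\<Sum>m\<in>negative_box n k. (norm (fourier_coeff n \<psi> m - fourier_coeff n c m))\<^sup>2)"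
        using m by (intro member_le_sum finite_negative_box) auto
      then show "(norm (fourier_coeff n \<psi> m - fourier_coeff n c m))\<^sup>2 \<le> (1 / (real k + 1))\<^sup>2" using c(2) by linarith
    qed simp
    then show ?thesis using c(1) by (auto simp: S_def)
  qed
  \<comment> \<open>Midpoints are all the convexity that the parallelogram law needs;
    \<open>1 - 1/2\<close> keeps the shape of a convex combination with parameter 1/2.\<close>
  have S_mid: "(\<lambda>x. complex_of_real (1 - 1/2) * c x + complex_of_real (1/2) * c' x) \<in> S k" if cc: "c \<in> S k" "c' \<in> S k" for c c' k
  proof -
    have b: "bounded_measurable (torus n) c" "bounded_measurable (torus n) c'"
      using cc S_sub sup_ball_bounded_measurable by blast+
    have "norm (fourier_coeff n \<psi> m - fourier_coeff n (\<lambda>x. complex_of_real (1 - 1/2) * c x + complex_of_real (1/2) * c' x) m) \<le> 1 / (real k + 1)"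
      if m: "m \<in> negative_box n k" for m
    proof -
      let ?p = "fourier_coeff n \<psi> m - fourier_coeff n c m" and ?q = "fourier_coeff n \<psi> m - fourier_coeff n c' m"
      have "fourier_coeff n \<psi> m - fourier_coeff n (\<lambda>x. complex_of_real (1 - 1/2) * c x + complex_of_real (1/2) * c' x) m = (1/2) * (?p + ?q)"
        unfolding fourier_coeff_convex[OF b] by (simp add: field_simps)
      also have "norm \<dots> \<le> (1/2) * (norm ?p + norm ?q)"
      proof -
        have "norm ((1/2) * (p + q)) \<le> (1/2) * (norm p + norm q)" for p q :: complex
          using norm_triangle_ineq[of p q] by (simp add: norm_mult)
        then show ?thesis .
      qed
      also have "\<dots> \<le> (1/2) * (1 / (real k + 1) + 1 / (real k + 1))"
        using cc m by (intro mult_left_mono add_mono) (auto simp: S_def)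
      finally show ?thesis by simp
    qed
    then show ?thesis using sup_ball_convex[of c n M c' "1/2"] cc unfolding S_def by auto
  qed
  have N_le: "?N c \<le> M\<^sup>2" if "c \<in> sup_ball n M" for c
  proof -
    have "?N c \<le> (LINT x|torus n. M\<^sup>2)"
      using that by (intro integral_mono integrable_norm_sq prob_space_torus sup_ball_bounded_measurable[OF that])
        (auto simp: sup_ball_def intro: power_mono)
    then show ?thesis by (simp add: prob_space)
  qed
  define r where "r k = Inf (?N ` S k)" for k
  have bdd: "bdd_below (?N ` S k)" for k by (rule bdd_belowI[of _ 0]) auto
  have r_le: "r k \<le> ?N c" if "c \<in> S k" for c k
    unfolding r_def using that bdd by (intro cInf_lower) auto
  have r_mono: "incseq r"
    unfolding incseq_def r_def
    \<comment> \<open>Infima over decreasing sets increase; the bound M^2 makes them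
      converge.\<close>
    by (intro allI impI cInf_superset_mono bdd image_mono S_mono) (simp_all add: S_ne)
  have "r k \<le> M\<^sup>2" for k
    using S_ne[of k] r_le[of _ k] N_le S_sub by (metis all_not_in_conv order_trans subsetD)
  then obtain L where L: "r \<longlonglongrightarrow> L" "\<And>k. r k \<le> L"
    using incseq_convergent[OF r_mono] by metis
  have "\<exists>k0. \<forall>k\<ge>k0. L - r k \<le> (1/4) ^ j" for j :: nat
  proof -
    have "(0::real) < (1/4) ^ j" by simp
    from LIMSEQ_D[OF L(1) this] obtain k0 where "\<forall>k\<ge>k0. norm (r k - L) < (1/4) ^ j" by blast
    then show ?thesis by (intro exI[of _ k0]) (auto simp: abs_if split: if_splits)
  qed
  then obtain k0 where k0: "\<And>j k. k \<ge> k0 j \<Longrightarrow> L - r k \<le> (1/4) ^ j" by metis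
  \<comment> \<open>A subsequence of indices past every \<open>k0 j\<close>, increasing so that
    \<open>S_mono\<close> applies, and at least j so that the tolerances tend to 0.\<close>
  define K where "K j = j + (\<Sum>i\<le>j. k0 i)" for j
  have K_ge: "K j \<ge> k0 j" "K j \<ge> j" for j
    using member_le_sum[of j "{..j}" k0] by (auto simp: K_def)
  have K_mono: "K j \<le> K (Suc j)" for j by (simp add: K_def)
  have "\<exists>c\<in>S (K j). ?N c < r (K j) + (1/4) ^ j" for j
    using cInf_lessD[of "?N ` S (K j)" "r (K j) + (1/4) ^ j"] S_ne by (auto simp: r_def)
  then obtain c where c: "\<And>j. c j \<in> S (K j)" "\<And>j. ?N (c j) < r (K j) + (1/4) ^ j" by metis
  have cb: "c j \<in> sup_ball n M" for j using c(1) S_sub by blast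
  note bm = sup_ball_bounded_measurable[OF cb]
  \<comment> \<open>The midpoint of consecutive terms lies in the larger set \<open>S (K j)\<close>,
    so its squared norm is at least \<open>r (K j)\<close>. The parallelogram law then leaves twice
    the remaining increase of r and the minimization errors, at most 2 + 4 units of (1/4)^j.\<close>
  have fast: "(LINT x|torus n. (norm (c (Suc j) x - c j x))\<^sup>2) \<le> 6 * (1/4) ^ j" for j
  proof -
    let ?a = "c (Suc j)" and ?b = "c j"
    let ?mid = "\<lambda>x. complex_of_real (1 - 1/2) * ?b x + complex_of_real (1/2) * ?a x"
    have mid: "?mid \<in> S (K j)" using c(1) S_mono[OF K_mono] by (intro S_mid) auto
    have bmid: "bounded_measurable (torus n) ?mid" using mid S_sub sup_ball_bounded_measurable by blast
    note i = integrable_norm_sq[OF prob_space_torus bm] integrable_norm_sq[OF prob_space_torus bmid]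
    have par: "(norm (?a x - ?b x))\<^sup>2 = 2 * (norm (?a x))\<^sup>2 + 2 * (norm (?b x))\<^sup>2 - 4 * (norm (?mid x))\<^sup>2" for x
      unfolding cmod_power2 by (simp add: power2_eq_square field_simps)
    have "(LINT x|torus n. (norm (?a x - ?b x))\<^sup>2) = 2 * ?N ?a + 2 * ?N ?b - 4 * ?N ?mid"
      unfolding par using i by simp
    also have "\<dots> \<le> 2 * (r (K (Suc j)) + (1/4) ^ Suc j) + 2 * (r (K j) + (1/4) ^ j) - 4 * r (K j)"
    proof -
      have "2 * a + 2 * b - 4 * m \<le> 2 * a' + 2 * b' - 4 * m'" if "a < a'" "b < b'" "m' \<le> m" for a b m a' b' m' :: real
        using that by linarith
      from this[OF c(2) c(2) r_le[OF mid]] show ?thesis .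
    qed
    also have "\<dots> \<le> 2 * (L - r (K j)) + 4 * (1/4) ^ j"
    proof -
      have "2 * (a + 1/4 * q) + 2 * (b + q) - 4 * b \<le> 2 * (l - b) + 4 * q" if "0 \<le> q" "a \<le> l" for a b q l :: real
        using that by (simp add: algebra_simps)
      from this[OF _ L(2)] show ?thesis unfolding power_Suc by simp
    qed
    also have "\<dots> \<le> 6 * (1/4) ^ j" using k0[OF K_ge(1), of j] by simp
    finally show ?thesis .
  qed
  have conv: "AE x in torus n. convergent (\<lambda>j. c j x)"
    by (rule fast_L2_Cauchy_converges[OF cb _ fast]) (use M in simp)
  \<comment> \<open>Where the sequence diverges, \<open>lim\<close> is arbitrary, hence the bound
    for l is claimed only almost everywhere.\<close>
  define l where "l x = lim (\<lambda>j. c j x)" for x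
  have cl: "AE x in torus n. (\<lambda>j. c j x) \<longlonglongrightarrow> l x"
    using conv by eventually_elim (simp add: l_def convergent_LIMSEQ_iff)
  have lm: "l \<in> borel_measurable (torus n)"
    unfolding l_def[abs_def] using cb by (intro borel_measurable_lim_metric) (auto simp: sup_ball_def)
  have "AE x in torus n. norm (l x) \<le> M"
    using cl by eventually_elim (rule LIMSEQ_le_const2[OF tendsto_norm], use cb in \<open>auto simp: sup_ball_def\<close>)
  moreover have "fourier_coeff n l m = fourier_coeff n \<psi> m" if m: "(\<Sum>i\<in>{1..n}. m i) < 0" for m
  proof -
    have "(\<lambda>j. fourier_coeff n (c j) m) \<longlonglongrightarrow> fourier_coeff n l m"
      unfolding fourier_coeff_char
    proof (rule integral_dominated_convergence[where w = "\<lambda>_. M"])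
      show "AE x in torus n. (\<lambda>j. c j x * torus_char n (\<lambda>i. - m i) x) \<longlonglongrightarrow> l x * torus_char n (\<lambda>i. - m i) x"
        using cl by eventually_elim (intro tendsto_mult tendsto_const)
      show "AE x in torus n. norm (c j x * torus_char n (\<lambda>i. - m i) x) \<le> M" for j
        by (rule AE_I2) (use cb in \<open>auto simp: norm_mult sup_ball_def\<close>)
    qed (use lm cb in \<open>auto simp: sup_ball_def intro!: borel_measurable_times torus_char_measurable\<close>)
    moreover have "(\<lambda>j. fourier_coeff n (c j) m) \<longlonglongrightarrow> fourier_coeff n \<psi> m"
    proof -
      obtain k where k: "restrict m {1..n} \<in> negative_box n k" using restrict_in_negative_box[OF m] by blast
      have "norm (fourier_coeff n (c j) m - fourier_coeff n \<psi> m) \<le> 1 / (real j + 1)" if "j \<ge> k" for j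
      proof -
        have "restrict m {1..n} \<in> negative_box n (K j)"
          using negative_box_mono[of k "K j" n] that K_ge(2)[of j] k by (meson order_trans subsetD)
        then have "norm (fourier_coeff n \<psi> m - fourier_coeff n (c j) m) \<le> 1 / (real (K j) + 1)"
          using c(1)[of j] fourier_coeff_restrict[of n _ m] unfolding S_def by force
        also have "\<dots> \<le> 1 / (real j + 1)" using K_ge(2)[of j] by (intro divide_left_mono) auto
        finally show ?thesis by (simp add: norm_minus_commute)
      qed
      then have "eventually (\<lambda>j. norm (fourier_coeff n (c j) m - fourier_coeff n \<psi> m) \<le> 1 / (real j + 1)) sequentially"
        by (auto simp: eventually_sequentially)
      moreover have "(\<lambda>j. 1 / (real j + 1)) \<longlonglongrightarrow> 0"
        using LIMSEQ_inverse_real_of_nat by (simp add: inverse_eq_divide add.commute)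
      ultimately have "(\<lambda>j. fourier_coeff n (c j) m - fourier_coeff n \<psi> m) \<longlonglongrightarrow> 0"
        by (rule Lim_null_comparison)
      then show ?thesis by (simp only: LIM_zero_iff)
    qed
    ultimately show ?thesis by (rule LIMSEQ_unique)
  qed
  ultimately show ?thesis using lm by blast
qed

lemma dist_inf_le:
  assumes \<phi>: "\<phi> \<in> Linf (Suc d)" and M: "M > 0" "op_norm d (hankel_op (Suc d) \<phi>) \<le> ennreal M"
  shows "dist_inf (Suc d) \<phi> (H1 (Suc d)) \<le> ennreal M"
proof -
  have \<phi>m: "\<phi> \<in> borel_measurable (torus (Suc d))" using \<phi> by (simp add: Linf_def)
  obtain \<psi> where \<psi>: "\<psi> \<in> borel_measurable (torus (Suc d))" "\<And>x. norm (\<psi> x) \<le> enn2real (Linf_norm (Suc d) \<phi>)"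
    "AE x in torus (Suc d). \<phi> x = \<psi> x"
    using Linf_truncate[OF \<phi>] by blast
  have b\<psi>: "bounded_measurable (torus (Suc d)) \<psi>" by (rule bounded_measurableI[OF \<psi>(1,2)])
  have coeff: "fourier_coeff (Suc d) \<phi> m = fourier_coeff (Suc d) \<psi> m" for m
    by (rule fourier_coeff_cong_AE[OF \<phi>m \<psi>(1,3)])
  have sl: "AE x in torus d. slice (Suc d) \<phi> k x = fibre_coeff d \<psi> k x" for k
    by (rule slice_AE(2)[OF b\<psi> coeff])
  obtain c where c: "c \<in> borel_measurable (torus (Suc d))" "AE x in torus (Suc d). norm (c x) \<le> M"
    "\<And>m. (\<Sum>i\<in>{1..Suc d}. m i) < 0 \<Longrightarrow> fourier_coeff (Suc d) c m = fourier_coeff (Suc d) \<psi> m"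
    using interpolation[OF b\<psi> M(1) hankel_op_functional_bound[OF b\<psi> sl M]] by blast
  have cM: "Linf_norm (Suc d) c \<le> ennreal M"
    unfolding Linf_norm_le_iff[OF c(1)] using c(2) by eventually_elim (rule ennreal_leI)
  have cL: "c \<in> Linf (Suc d)" using c(1) le_less_trans[OF cM, of \<infinity>] by (simp add: Linf_def)
  define g where "g z = \<phi> z - c z" for z
  have gm: "g \<in> borel_measurable (torus (Suc d))" unfolding g_def[abs_def] using \<phi>m c(1) by (rule borel_measurable_diff)
  have "Linf_norm (Suc d) g \<le> ennreal (enn2real (Linf_norm (Suc d) \<phi>) + M)"
    unfolding Linf_norm_le_iff[OF gm] using \<psi>(3) c(2)
  proof eventually_elim
    case (elim x)
    have "norm (g x) \<le> norm (\<psi> x) + norm (c x)" unfolding g_def elim(1) by (rule norm_triangle_ineq4)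
    then show ?case using \<psi>(2)[of x] elim(2) by (intro ennreal_leI) linarith
  qed
  then have "Linf_norm (Suc d) g < \<infinity>" by (rule le_less_trans) simp
  then have gL: "g \<in> Linf (Suc d)" using gm by (simp add: Linf_def)
  have "fourier_coeff (Suc d) g m = 0" if "(\<Sum>i\<in>{1..Suc d}. m i) < 0" for m
  proof -
    have "fourier_coeff (Suc d) g m = fourier_coeff (Suc d) \<phi> m - fourier_coeff (Suc d) c m"
      unfolding fourier_coeff_char g_def left_diff_distrib
      by (intro Bochner_Integration.integral_diff Linf_char_integrable \<phi> cL)
    then show ?thesis using c(3)[OF that] coeff by simp
  qed
  then have "g \<in> H1 (Suc d)" using gL by (simp add: H1_def)
  then have "dist_inf (Suc d) \<phi> (H1 (Suc d)) \<le> Linf_norm (Suc d) (\<lambda>z. \<phi> z - g z)"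
    unfolding dist_inf_def by (rule INF_lower)
  also have "\<dots> = Linf_norm (Suc d) c" by (simp add: g_def)
  also note cM
  finally show ?thesis .
qed

theorem theorem4p8:
  fixes n :: nat and \<phi> :: "(nat \<Rightarrow> complex) \<Rightarrow> complex"
  assumes "n \<ge> 2" and "\<phi> \<in> Linf n"
  shows "op_norm (n - 1) (hankel_op n \<phi>) = dist_inf n \<phi> (H1 n)"
proof -
  obtain d where n: "n = Suc d" using assms(1) by (cases n) auto
  have \<phi>: "\<phi> \<in> Linf (Suc d)" using assms(2) n by simp
  have "op_norm d (hankel_op (Suc d) \<phi>) = dist_inf (Suc d) \<phi> (H1 (Suc d))"
  proof (rule antisym)
    show "op_norm d (hankel_op (Suc d) \<phi>) \<le> dist_inf (Suc d) \<phi> (H1 (Suc d))"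
      unfolding dist_inf_def by (intro INF_greatest op_norm_hankel_le \<phi>)
    show "dist_inf (Suc d) \<phi> (H1 (Suc d)) \<le> op_norm d (hankel_op (Suc d) \<phi>)"
    \<comment> \<open>The operator norm may be 0, whereas the converse estimate asks for a positive
      M; an arbitrarily small surplus e bridges the gap.\<close>
    proof (rule ennreal_le_epsilon)
      fix e :: real assume fin: "op_norm d (hankel_op (Suc d) \<phi>) < top" and e: "e > 0"
      define M where "M = enn2real (op_norm d (hankel_op (Suc d) \<phi>)) + e"
      have M: "ennreal M = op_norm d (hankel_op (Suc d) \<phi>) + ennreal e"
        using fin e by (simp add: M_def)
      have "M > 0" using e by (simp add: M_def add_nonneg_pos)
      moreover have "op_norm d (hankel_op (Suc d) \<phi>) \<le> ennreal M" unfolding M by simp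
      ultimately show "dist_inf (Suc d) \<phi> (H1 (Suc d)) \<le> op_norm d (hankel_op (Suc d) \<phi>) + ennreal e"
        unfolding M[symmetric] by (rule dist_inf_le[OF \<phi>])
    qed
  qed
  then show ?thesis by (simp add: n)
qed

end
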